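(* Suppose $\mathbf{Y}\sim SE_k(\boldsymbol{\mu},\mathbf{\Omega},\boldsymbol{\delta},g^{(k+1)})$ and the first four moments of $\mathbf{Y}$ exist. Then the delta-method approximation of the Song measure $S(f_{\mathbf{Y}})=\mathrm{Var}[\log(f_{\mathbf{Y}}(\mathbf{Y}))]$ is $$(b-a^2\delta_{\ast}^2)\,h_{\ast}^2,$$ where $$h_{\ast}=\frac{2a\delta_{\ast}\int_{-\infty}^{\eta(a\delta_{\ast})}g^{(k+1)\prime}\left(r^2+a^2\delta_{\ast}^2\right)\mathrm{d}r+\eta(1)\,g^{(k+1)}\left((\eta(a\delta_{\ast}))^2+a^2\delta_{\ast}^2\right)}{\int_{-\infty}^{\eta(a\delta_{\ast})}g^{(k+1)}\left(r^2+a^2\delta_{\ast}^2\right)\mathrm{d}r}$$ with $\eta(x)=\frac{\delta_{\ast}x}{\sqrt{1-\delta_{\ast}^2}}$, $\delta_{\ast}=\boldsymbol{\delta}^{\top}\mathbf{\Omega}^{-1}\boldsymbol{\delta}$, $a=\frac{\mathrm{E}[R]}{\mathrm{E}[R_0]}\sqrt{\frac{2}{\pi}}$, $b=\frac{\mathrm{E}[R^2]}{\mathrm{E}[R_0^2]}$, and $g^{(k+1)\prime}$ the derivative of $g^{(k+1)}$.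
   Context: Skew-elliptical distribution: let $\boldsymbol{\mu}\in\mathbb{R}^k$, let $\mathbf{\Omega}$ be a $k\times k$ symmetric positive definite matrix, let $\boldsymbol{\delta}\in\mathbb{R}^k$ with $\boldsymbol{\delta}^{\top}\mathbf{\Omega}^{-1}\boldsymbol{\delta}<1$, and let $g^{(k+1)}$ be a spherical $(k+1)$-dimensional density generator, i.e. a nonnegative function on $[0,\infty)$ such that $\boldsymbol{x}\mapsto g^{(k+1)}(\boldsymbol{x}^{\top}\boldsymbol{x})$ is a probability density on $\mathbb{R}^{k+1}$. One writes $\mathbf{Y}\sim SE_k(\boldsymbol{\mu},\mathbf{\Omega},\boldsymbol{\delta},g^{(k+1)})$ if the random vector $\mathbf{Y}$ in $\mathbb{R}^k$ has density $$f_{\mathbf{Y}}(\boldsymbol{y})=2|\mathbf{\Omega}|^{-1/2}\int_{-\infty}^{\boldsymbol{\alpha}^{\top}(\boldsymbol{y}-\boldsymbol{\mu})}g^{(k+1)}\left(r^2+(\boldsymbol{y}-\boldsymbol{\mu})^{\top}\mathbf{\Omega}^{-1}(\boldsymbol{y}-\boldsymbol{\mu})\right)\mathrm{d}r,\quad \boldsymbol{y}\in\mathbb{R}^k,\qquad \boldsymbol{\alpha}^{\top}=\frac{\boldsymbol{\delta}^{\top}\mathbf{\Omega}^{-1}}{(1-\boldsymbol{\delta}^{\top}\mathbf{\Omega}^{-1}\boldsymbol{\delta})^{1/2}}.$$ $R$ is a nonnegative random variable with density $h(r)=\frac{2\pi^{(k+1)/2}r^k g^{(k+1)}(r^2)}{\Gamma((k+1)/2)}$,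 $r>0$. $R_0\sim\chi_{k+1}$ (i.e. $R_0\ge 0$ and $R_0^2$ is chi-square with $k+1$ degrees of freedom), so $\mathrm{E}[R_0]=\frac{\sqrt{2}\,\Gamma(k/2+1)}{\Gamma((k+1)/2)}$, $\mathrm{E}[R_0^2]=k+1$. Delta-method approximation: with $G_{\mathbf{Y}}(\boldsymbol{y})=\log f_{\mathbf{Y}}(\boldsymbol{y})$, the delta-method approximation of $\mathrm{Var}[\log(f_{\mathbf{Y}}(\mathbf{Y}))]$ is the quantity $[\nabla G_{\mathbf{Y}}(\mathrm{E}(\mathbf{Y}))]^{\top}\,\mathrm{Var}(\mathbf{Y})\,[\nabla G_{\mathbf{Y}}(\mathrm{E}(\mathbf{Y}))]$.
   Formalization: The formula is proved with δ_* equal to the square root of δᵀΩ⁻¹δ; with δ_* = δᵀΩ⁻¹δ as printed it fails, e.g. for the normal generator with k = 1, Ω = 1 and small nonzero δ. *)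

theory Defs
  imports "HOL-Probability.Probability"
begin

definition positive_definite :: "real^'n^'n \<Rightarrow> bool" where
  "positive_definite A \<longleftrightarrow> transpose A = A \<and> (\<forall>x. x \<noteq> 0 \<longrightarrow> x \<bullet> (A *v x) > 0)"

text \<open>
  The type \<open>'a\<close> is the space carrying the spherical density. For a \<open>(k+1)\<close>-dimensional generator it is
  \<open>(real^'n) \<times> real\<close> with \<open>k = CARD('n)\<close>, whose inner product is the Euclidean one. Values
  of \<open>g\<close> at negative arguments are never used.
\<close>

definition spherical_generator :: "'a::euclidean_space itself \<Rightarrow> (real \<Rightarrow> real) \<Rightarrow> bool" where
  "spherical_generator _ g \<longleftrightarrow>
     (\<forall>t\<ge>0. 0 \<le> g t) \<and>
     (\<lambda>x::'a. g (x \<bullet> x)) \<in> borel_measurable lborel \<and>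
     (\<integral>\<^sup>+ x. ennreal (g ((x::'a) \<bullet> x)) \<partial>lborel) = 1"

definition skew_alpha :: "real^'n^'n \<Rightarrow> real^'n \<Rightarrow> real^'n" where
  "skew_alpha \<Omega> \<delta> =
     (1 / sqrt (1 - \<delta> \<bullet> (matrix_inv \<Omega> *v \<delta>))) *\<^sub>R (\<delta> v* matrix_inv \<Omega>)"

definition se_density ::
  "real^'n \<Rightarrow> real^'n^'n \<Rightarrow> real^'n \<Rightarrow> (real \<Rightarrow> real) \<Rightarrow> real^'n \<Rightarrow> real" where
  "se_density \<mu> \<Omega> \<delta> g y =
     2 * det \<Omega> powr (-1/2) *
     (LINT r:{..skew_alpha \<Omega> \<delta> \<bullet> (y - \<mu>)}|lborel.
        g (r\<^sup>2 + (y - \<mu>) \<bullet> (matrix_inv \<Omega> *v (y - \<mu>))))"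

definition skew_elliptical ::
  "'w measure \<Rightarrow> ('w \<Rightarrow> real^'n) \<Rightarrow> real^'n \<Rightarrow> real^'n^'n \<Rightarrow> real^'n \<Rightarrow> (real \<Rightarrow> real) \<Rightarrow> bool" where
  "skew_elliptical M Y \<mu> \<Omega> \<delta> g \<longleftrightarrow>
     positive_definite \<Omega> \<and>
     \<delta> \<bullet> (matrix_inv \<Omega> *v \<delta>) < 1 \<and>
     spherical_generator TYPE((real^'n) \<times> real) g \<and>
     distributed M lborel Y (\<lambda>y. ennreal (se_density \<mu> \<Omega> \<delta> g y))"

text \<open>Existence of all mixed moments of order at most \<open>p\<close>.\<close>

definition moments_exist :: "'w measure \<Rightarrow> ('w \<Rightarrow> real^'n) \<Rightarrow> nat \<Rightarrow> bool" where
  "moments_exist M Y p \<longleftrightarrow>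
     (\<forall>m\<in>{1..p}. \<forall>i :: nat \<Rightarrow> 'n. integrable M (\<lambda>\<omega>. \<Prod>j<m. Y \<omega> $ i j))"

definition radial_density :: "nat \<Rightarrow> (real \<Rightarrow> real) \<Rightarrow> real \<Rightarrow> real" where
  "radial_density k g r =
     (if 0 < r
      then 2 * pi powr ((real k + 1) / 2) * r ^ k * g (r\<^sup>2) / Gamma ((real k + 1) / 2)
      else 0)"

definition chi_square_density :: "nat \<Rightarrow> real \<Rightarrow> real" where
  "chi_square_density n x =
     (if 0 < x
      then x powr (real n / 2 - 1) * exp (- x / 2) / (2 powr (real n / 2) * Gamma (real n / 2))
      else 0)"

definition chi_distributed :: "'w measure \<Rightarrow> ('w \<Rightarrow> real) \<Rightarrow> nat \<Rightarrow> bool" where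
  "chi_distributed M X n \<longleftrightarrow>
     X \<in> borel_measurable M \<and> (AE \<omega> in M. 0 \<le> X \<omega>) \<and>
     distributed M lborel (\<lambda>\<omega>. (X \<omega>)\<^sup>2) (\<lambda>x. ennreal (chi_square_density n x))"

definition mean_vector :: "'w measure \<Rightarrow> ('w \<Rightarrow> real^'n) \<Rightarrow> real^'n" where
  "mean_vector M Y = (\<chi> i. \<integral>\<omega>. Y \<omega> $ i \<partial>M)"

definition covariance_matrix :: "'w measure \<Rightarrow> ('w \<Rightarrow> real^'n) \<Rightarrow> real^'n^'n" where
  "covariance_matrix M Y =
     (\<chi> i j. \<integral>\<omega>. (Y \<omega> $ i - mean_vector M Y $ i) * (Y \<omega> $ j - mean_vector M Y $ j) \<partial>M)"

text \<open>Unspecified where \<open>F\<close> is not differentiable.\<close>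

definition gradient :: "('a::real_inner \<Rightarrow> real) \<Rightarrow> 'a \<Rightarrow> 'a" where
  "gradient F x = (THE D. GDERIV F x :> D)"

text \<open>The delta-method approximation of the variance of \<open>G(Y)\<close>.\<close>

definition delta_method_variance ::
  "'w measure \<Rightarrow> ('w \<Rightarrow> real^'n) \<Rightarrow> (real^'n \<Rightarrow> real) \<Rightarrow> real" where
  "delta_method_variance M Y G =
     gradient G (mean_vector M Y) \<bullet>
       (covariance_matrix M Y *v gradient G (mean_vector M Y))"

text \<open>
  The square root is essential: with the mean \<open>\<mu> + a \<delta>\<close>, the upper limit of integration in the density
  is \<open>a \<delta>\<^sup>T \<Omega>\<^sup>-\<^sup>1 \<delta> / sqrt (1 - \<delta>\<^sup>T \<Omega>\<^sup>-\<^sup>1 \<delta>)\<close> and has to equal \<open>skew_eta d (a * d)\<close>.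
  Without the root the formula for the delta-method variance fails, already for normal generators.
\<close>

definition delta_star :: "real^'n^'n \<Rightarrow> real^'n \<Rightarrow> real" where
  "delta_star \<Omega> \<delta> = sqrt (\<delta> \<bullet> (matrix_inv \<Omega> *v \<delta>))"

definition skew_eta :: "real \<Rightarrow> real \<Rightarrow> real" where
  "skew_eta d x = d * x / sqrt (1 - d\<^sup>2)"

definition h_star :: "(real \<Rightarrow> real) \<Rightarrow> (real \<Rightarrow> real) \<Rightarrow> real \<Rightarrow> real \<Rightarrow> real" where
  "h_star g g' a d =
     (2 * a * d * (LINT r:{..skew_eta d (a * d)}|lborel. g' (r\<^sup>2 + a\<^sup>2 * d\<^sup>2))
        + skew_eta d 1 * g ((skew_eta d (a * d))\<^sup>2 + a\<^sup>2 * d\<^sup>2))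
     / (LINT r:{..skew_eta d (a * d)}|lborel. g (r\<^sup>2 + a\<^sup>2 * d\<^sup>2))"

end

theory Submission
  imports Defs
begin

text \<open>
  Choose a linear isomorphism \<open>L\<close> that carries the Euclidean inner product to the form given by
  \<open>\<Omega>\<^sup>-\<^sup>1\<close>, and write \<open>Y = \<mu> + L Z\<close> and \<open>\<delta> = L \<theta>\<close>, so that \<open>d\<close> is the length of \<open>\<theta>\<close>.
  The inner integral in the density of \<open>Y\<close> then says that \<open>Z\<close> is the first component of a
  spherically distributed vector \<open>(X, X\<^sub>0)\<close> of dimension \<open>k + 1\<close>, conditioned on the half-space
  \<open>X\<^sub>0 \<le> \<theta> \<bullet> X / sqrt (1 - d\<^sup>2)\<close> (lemma \<open>standardized_law\<close>). Even functions do not notice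
  the conditioning, so second moments about \<open>\<mu>\<close> are those of the spherical law; the mean of \<open>Z\<close>
  points along the normal of the half-space, and \<open>E Z = E|X\<^sub>0| \<theta>\<close>. Comparing the radial part of
  a spherical law with the chi law, for which everything is explicit, gives \<open>E|X\<^sub>0| = a\<close> and
  \<open>E X\<^sub>0\<^sup>2 = b\<close> (lemma \<open>radial_parameters\<close>). Hence \<open>E Y = \<mu> + a \<delta>\<close> and
  \<open>Var Y = b \<Omega> - a\<^sup>2 \<delta> \<delta>\<^sup>T\<close> (lemmas \<open>mean_vector_eq\<close>, \<open>covariance_form\<close>).

  At the mean, the upper limit of integration and the quadratic form are \<open>s = a d\<^sup>2 / sqrt (1 - d\<^sup>2)\<close>
  and \<open>q = a\<^sup>2 d\<^sup>2\<close>. Both have gradients proportional to \<open>\<Omega>\<^sup>-\<^sup>1 \<delta>\<close>, and the chain rule gives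
  \<open>(h\<^sub>* / d) \<Omega>\<^sup>-\<^sup>1 \<delta>\<close> as gradient of the log-density, where \<open>h\<^sub>*\<close> is the value of \<open>h_star\<close>.
  Inserting it into the quadratic form of the covariance yields
  \<open>(h\<^sub>* / d)\<^sup>2 (b d\<^sup>2 - a\<^sup>2 d\<^sup>4) = (b - a\<^sup>2 d\<^sup>2) h\<^sub>*\<^sup>2\<close>; for \<open>d = 0\<close> both sides vanish.

  Two analytic points carry the weight. The derivative of the generator is known to be integrable
  along the single ray \<open>r\<^sup>2 + q\<close> only, without a bound that is uniform in \<open>q\<close>, so the usual theorem on
  differentiation under the integral sign does not apply. Writing an increment of \<open>g\<close> as an integral of
  its derivative and exchanging the order of integration moves the dependence on \<open>q\<close> into an explicit
  kernel, which is dominated (lemma \<open>increment_derivative\<close>). And the density has to be positive at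
  the mean: otherwise the spherical law would live on the ball of radius \<open>a d\<close>, which is
  impossible because \<open>E|X\<^sub>0| = a\<close> and \<open>d < 1\<close> (lemma \<open>generator_section_pos\<close>).
\<close>

section \<open>Differentiating a truncated integral under the integral sign\<close>

lemma set_integral_derivative:
  fixes F f :: "real \<Rightarrow> real"
  assumes "a \<le> b" "\<And>x. x \<in> {a..b} \<Longrightarrow> (F has_real_derivative f x) (at x)"
    and "set_integrable lborel {a..b} f"
  shows "(LINT x:{a..b}|lborel. f x) = F b - F a"
proof -
  have "(f has_integral (F b - F a)) {a..b}"
    using assms by (intro fundamental_theorem_of_calculus)
      (auto simp: has_real_derivative_iff_has_vector_derivative[symmetric] intro: DERIV_subset)
  then show ?thesis
    using set_borel_integral_eq_integral(2)[OF assms(3)] by (simp add: integral_unique)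
qed

text \<open>
  Passing from \<open>r\<^sup>2\<close> to \<open>r\<^sup>2 + h\<close> moves the radius from \<open>r\<close> to \<open>sqrt (r\<^sup>2 + h)\<close>, to the right or
  to the left according to the sign of \<open>h\<close>. The predicate says that \<open>v\<close> lies on the way.
\<close>

definition displaced :: "real \<Rightarrow> real \<Rightarrow> real \<Rightarrow> bool" where
  "displaced h r v \<longleftrightarrow> 0 < r \<and> 0 < v \<and> 0 < r\<^sup>2 + h \<and>
     min (r\<^sup>2) (r\<^sup>2 + h) \<le> v\<^sup>2 \<and> v\<^sup>2 \<le> max (r\<^sup>2) (r\<^sup>2 + h)"

lemma abs_diff_times_sum:
  fixes v w :: real
  assumes "0 \<le> v" "0 \<le> w" shows "\<bar>v - w\<bar> * (v + w) = \<bar>v\<^sup>2 - w\<^sup>2\<bar>"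
proof -
  have "v\<^sup>2 - w\<^sup>2 = (v - w) * (v + w)" by (simp add: power2_eq_square algebra_simps)
  then show ?thesis using assms by (simp add: abs_mult)
qed

lemma displaced_nonneg:
  "0 \<le> h \<Longrightarrow> displaced h r v \<longleftrightarrow> 0 < r \<and> 0 < v \<and> r\<^sup>2 \<le> v\<^sup>2 \<and> v\<^sup>2 \<le> r\<^sup>2 + h"
  using add_pos_nonneg[of "r\<^sup>2" h] by (cases "0 < r") (auto simp: displaced_def min_absorb1 max_absorb2)

lemma displaced_nonpos:
  "h \<le> 0 \<Longrightarrow> displaced h r v \<longleftrightarrow> 0 < r \<and> 0 < v \<and> 0 < r\<^sup>2 + h \<and> r\<^sup>2 + h \<le> v\<^sup>2 \<and> v\<^sup>2 \<le> r\<^sup>2"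
  by (auto simp: displaced_def min_absorb2 max_absorb1)

text \<open>
  The radii whose path crosses a given \<open>v\<close> lie between \<open>v\<close> and the radius that is carried to \<open>v\<close>, if
  there is one. The length of this interval is at most \<open>\<bar>h\<bar> / v\<close>, which is the bound that makes dominated convergence work.
\<close>

lemma displaced_subset:
  fixes v h :: real
  assumes "0 < v"
  defines "w \<equiv> sqrt (max 0 (v\<^sup>2 - h))"
  shows "{r. displaced h r v} \<subseteq> {min v w..max v w}" and "\<bar>v - w\<bar> \<le> \<bar>h\<bar> / v"
proof -
  have w: "0 \<le> w" "w\<^sup>2 = max 0 (v\<^sup>2 - h)" by (auto simp: w_def)
  show "{r. displaced h r v} \<subseteq> {min v w..max v w}"
  proof (intro subsetI, unfold mem_Collect_eq)
    fix r assume E: "displaced h r v"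
    then have r: "0 < r" by (simp add: displaced_def)
    consider "0 \<le> h" "r\<^sup>2 \<le> v\<^sup>2" "w\<^sup>2 \<le> r\<^sup>2" | "h \<le> 0" "v\<^sup>2 \<le> r\<^sup>2" "r\<^sup>2 \<le> w\<^sup>2"
      using E w by (cases "0 \<le> h") (auto simp: displaced_def)
    then show "r \<in> {min v w..max v w}"
      using r w(1) assms(1) by cases (auto simp: abs_le_square_iff[symmetric])
  qed
  have "\<bar>v - w\<bar> * v \<le> \<bar>v - w\<bar> * (v + w)" using w assms(1) by (intro mult_left_mono) auto
  also have "\<dots> = \<bar>v\<^sup>2 - w\<^sup>2\<bar>"
    using w assms(1) by (intro abs_diff_times_sum) auto
  also have "\<dots> \<le> \<bar>h\<bar>" unfolding w by (auto simp: max_def)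
  finally show "\<bar>v - w\<bar> \<le> \<bar>h\<bar> / v" using assms(1) by (simp add: field_simps)
qed

text \<open>
  For small \<open>h\<close> the interval is not cut off at the origin, and the crossing radii fill it.
\<close>

lemma displaced_eq:
  fixes v h :: real
  assumes "0 < v" "\<bar>h\<bar> < v\<^sup>2"
  defines "w \<equiv> sqrt (v\<^sup>2 - h)"
  shows "{r. displaced h r v} = {min v w..max v w}"
proof -
  have p: "0 < v\<^sup>2 - h" using assms by auto
  then have w: "0 < w" "w\<^sup>2 = v\<^sup>2 - h" by (auto simp: w_def)
  have "displaced h r v" if r: "r \<in> {min v w..max v w}" for r
  proof (cases "0 \<le> h")
    case True
    then have "w\<^sup>2 \<le> v\<^sup>2" using w by simp
    then have "w \<le> v" using assms(1) by (auto intro: power2_le_imp_le)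
    then have r': "w \<le> r" "r \<le> v" using r by auto
    then have "w\<^sup>2 \<le> r\<^sup>2" "r\<^sup>2 \<le> v\<^sup>2" using w(1) by (auto intro!: power_mono)
    then show ?thesis unfolding displaced_nonneg[OF True] using w r' assms(1) by simp
  next
    case False
    then have "v\<^sup>2 \<le> w\<^sup>2" using w by simp
    then have "v \<le> w" using w(1) by (auto intro: power2_le_imp_le)
    then have r': "v \<le> r" "r \<le> w" using r by auto
    then have "v\<^sup>2 \<le> r\<^sup>2" "r\<^sup>2 \<le> w\<^sup>2" using assms(1) by (auto intro: power_mono)
    then have "displaced h r v \<longleftrightarrow> 0 < r"
      using displaced_nonpos[of h r v] False w assms(1,2) by auto
    then show ?thesis using r' assms(1) by simp
  qed
  moreover have "sqrt (max 0 (v\<^sup>2 - h)) = w" using p by (simp add: w_def)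
  ultimately show ?thesis using displaced_subset(1)[OF assms(1), of h] by auto
qed

lemma displaced_section:
  assumes "0 < r" "0 < r\<^sup>2 + h"
  shows "{v. displaced h r v} = {min r (sqrt (r\<^sup>2 + h))..max r (sqrt (r\<^sup>2 + h))}"
proof -
  define s where "s = sqrt (r\<^sup>2 + h)"
  have s: "0 < s" "r\<^sup>2 + h = s\<^sup>2" using assms by (auto simp: s_def)
  have "displaced h r v \<longleftrightarrow> min r s \<le> v \<and> v \<le> max r s" for v
    unfolding displaced_def s(2) using assms(1) s(1)
    by (auto simp: min_def max_def abs_le_square_iff[symmetric])
  then show ?thesis unfolding set_eq_iff mem_Collect_eq atLeastAtMost_iff s_def by blast
qed

text \<open>
  In the following, \<open>\<phi>\<close> stands for \<open>\<lambda>r. g (r\<^sup>2 + q)\<close> and \<open>\<gamma>\<close> for \<open>\<lambda>r. g' (r\<^sup>2 + q)\<close>. The factor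
  \<open>2 * v\<close> of the chain rule cancels against the bound \<open>\<bar>h\<bar> / v\<close> for the crossing radii, which is why
  integrability of \<open>\<gamma>\<close> alone suffices. The bounded weight \<open>c\<close> encodes the domain of integration.
\<close>

context
  fixes \<phi> \<gamma> c :: "real \<Rightarrow> real" and C :: real
  assumes deriv: "\<And>v. 0 < v \<Longrightarrow> (\<phi> has_real_derivative 2 * v * \<gamma> v) (at v)"
    and \<gamma>: "set_integrable lborel {0<..} \<gamma>"
    and c: "c \<in> borel_measurable borel" "\<And>r. \<bar>c r\<bar> \<le> C"
begin

definition crossing_weight :: "real \<Rightarrow> real \<Rightarrow> real" where
  "crossing_weight h v = (\<integral>r. c r * indicator {r. displaced h r v} r \<partial>lborel)"

lemma integrable_crossing:
  assumes "0 < v" shows "integrable lborel (\<lambda>r. c r * indicator {r. displaced h r v} r)"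
proof -
  define w where "w = sqrt (max 0 (v\<^sup>2 - h))"
  have [measurable]: "{r. displaced h r v} \<in> sets borel" unfolding displaced_def by measurable
  have [measurable]: "c \<in> borel_measurable borel" by (rule c)
  have "integrable lborel (\<lambda>r. C * indicator {min v w..max v w} r)"
    by (auto simp: min_def max_def)
  then show ?thesis
  proof (rule Bochner_Integration.integrable_bound, goal_cases)
    case 2
    have "0 \<le> C" using c(2)[of 0] by linarith
    then show ?case using displaced_subset(1)[OF assms, of h] c(2) unfolding w_def
      by (intro AE_I2) (auto simp: indicator_def intro: order_trans)
  qed measurable
qed

lemma abs_crossing_integral_le:
  assumes "0 < v"
  shows "(\<integral>r. \<bar>c r\<bar> * indicator {r. displaced h r v} r \<partial>lborel) \<le> C * (\<bar>h\<bar> / v)"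
proof -
  define w where "w = sqrt (max 0 (v\<^sup>2 - h))"
  have C: "0 \<le> C" using c(2)[of 0] by linarith
  have "(\<integral>r. \<bar>c r\<bar> * indicator {r. displaced h r v} r \<partial>lborel) \<le> (\<integral>r. C * indicator {min v w..max v w} r \<partial>lborel)"
  proof (rule integral_mono)
    show "integrable lborel (\<lambda>r. \<bar>c r\<bar> * indicator {r. displaced h r v} r)"
      using integrable_abs[OF integrable_crossing[OF assms, of h]] by (simp add: abs_mult)
    show "integrable lborel (\<lambda>r. C * indicator {min v w..max v w} r)" by (auto simp: min_def max_def)
    show "\<bar>c r\<bar> * indicator {r. displaced h r v} r \<le> C * indicator {min v w..max v w} r" for r
      using displaced_subset(1)[OF assms, of h] c(2) C unfolding w_def
      by (auto simp: indicator_def intro: order_trans)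
  qed
  also have "\<dots> = C * \<bar>v - w\<bar>" by (auto simp: min_def max_def)
  also have "\<dots> \<le> C * (\<bar>h\<bar> / v)"
    using displaced_subset(2)[OF assms, of h] C unfolding w_def by (intro mult_left_mono)
  finally show ?thesis .
qed

lemma abs_crossing_weight_le: "0 < v \<Longrightarrow> \<bar>crossing_weight h v\<bar> \<le> C * (\<bar>h\<bar> / v)"
  unfolding crossing_weight_def
  by (rule order_trans[OF _ abs_crossing_integral_le], rule order_trans[OF integral_abs_bound]) (simp_all add: abs_mult)

text \<open>
  Cutting off at the origin turns set integrals into integrals over the line, the form in which
  Fubini's theorem is stated.
\<close>

definition \<gamma>pos :: "real \<Rightarrow> real" where "\<gamma>pos v = indicator {0<..} v * \<gamma> v"

lemma integrable_\<gamma>pos: "integrable lborel \<gamma>pos"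
  using \<gamma> by (simp add: \<gamma>pos_def[abs_def] set_integrable_def)

lemma measurable_crossing_weight[measurable]: "crossing_weight h \<in> borel_measurable borel"
proof -
  note [measurable] = c(1)
  have "(\<lambda>(v, r). c r * indicator {r. displaced h r v} r) \<in> borel_measurable (borel \<Otimes>\<^sub>M lborel)"
  proof -
    have "(\<lambda>(v, r). c r * (if displaced h r v then 1 else 0)) \<in> borel_measurable (borel \<Otimes>\<^sub>M borel)"
      unfolding displaced_def by measurable
    then show ?thesis by (simp add: indicator_def of_bool_def measurable_def space_pair_measure sets_pair_measure cong: measurable_cong_sets)
  qed
  then show ?thesis unfolding crossing_weight_def[abs_def] by measurable
qed

text \<open>
  The integral over \<open>r\<close> is at most a constant times \<open>2 * v * \<bar>\<gamma> v\<bar> * \<bar>h\<bar> / v\<close>, which is integrable in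
  \<open>v\<close>; so the order of integration may be exchanged.
\<close>

lemma integrable_displacement:
  "integrable (lborel \<Otimes>\<^sub>M lborel) (\<lambda>(v, r). sgn h * (2 * v * \<gamma>pos v) * (c r * indicator {r. displaced h r v} r))"
proof (rule lborel_pair.Fubini_integrable)
  note [measurable] = c(1) borel_measurable_integrable[OF integrable_\<gamma>pos]
  show "(\<lambda>(v, r). sgn h * (2 * v * \<gamma>pos v) * (c r * indicator {r. displaced h r v} r)) \<in> borel_measurable (lborel \<Otimes>\<^sub>M lborel)"
  proof -
    have "(\<lambda>(v, r). sgn h * (2 * v * \<gamma>pos v) * (c r * (if displaced h r v then 1 else 0))) \<in> borel_measurable (lborel \<Otimes>\<^sub>M lborel)"
      unfolding displaced_def by measurable
    then show ?thesis by (simp add: indicator_def of_bool_def)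
  qed
  then have m: "(\<lambda>v. \<integral>r. norm (sgn h * (2 * v * \<gamma>pos v) * (c r * indicator {r. displaced h r v} r)) \<partial>lborel) \<in> borel_measurable lborel"
    by measurable
  have "integrable lborel (\<lambda>v. 2 * C * \<bar>h\<bar> * \<bar>\<gamma>pos v\<bar>)"
    using integrable_\<gamma>pos by simp
  then have "integrable lborel (\<lambda>v. \<integral>r. norm (sgn h * (2 * v * \<gamma>pos v) * (c r * indicator {r. displaced h r v} r)) \<partial>lborel)"
  proof (rule Bochner_Integration.integrable_bound[OF _ m], intro AE_I2)
    fix v
    show "norm (\<integral>r. norm (sgn h * (2 * v * \<gamma>pos v) * (c r * indicator {r. displaced h r v} r)) \<partial>lborel) \<le> norm (2 * C * \<bar>h\<bar> * \<bar>\<gamma>pos v\<bar>)"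
    proof (cases "0 < v")
      case True
      have C: "0 \<le> C" using c(2)[of 0] by linarith
      have "norm (\<integral>r. norm (sgn h * (2 * v * \<gamma>pos v) * (c r * indicator {r. displaced h r v} r)) \<partial>lborel)
         = \<bar>sgn h * (2 * v * \<gamma>pos v)\<bar> * (\<integral>r. \<bar>c r\<bar> * indicator {r. displaced h r v} r \<partial>lborel)"
        by (simp add: abs_mult Bochner_Integration.integral_nonneg)
      also have "\<dots> \<le> \<bar>sgn h * (2 * v * \<gamma>pos v)\<bar> * (C * (\<bar>h\<bar> / v))"
        by (intro mult_left_mono abs_crossing_integral_le True) auto
      also have "\<dots> = \<bar>sgn h\<bar> * (2 * C * \<bar>h\<bar> * \<bar>\<gamma>pos v\<bar>)" using True by (simp add: abs_mult)
      also have "\<dots> \<le> 2 * C * \<bar>h\<bar> * \<bar>\<gamma>pos v\<bar>" using C by (auto simp: sgn_if)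
      finally show ?thesis using C by (simp add: abs_mult)
    qed (simp add: \<gamma>pos_def)
  qed
  then show "integrable lborel (\<lambda>v. \<integral>r. norm (case (v, r) of (v, r) \<Rightarrow> sgn h * (2 * v * \<gamma>pos v) * (c r * indicator {r. displaced h r v} r)) \<partial>lborel)"
    by simp
  show "AE v in lborel. integrable lborel (\<lambda>r. case (v, r) of (v, r) \<Rightarrow> sgn h * (2 * v * \<gamma>pos v) * (c r * indicator {r. displaced h r v} r))"
  proof (intro AE_I2, unfold prod.case, goal_cases)
    case (1 v)
    show ?case using integrable_crossing[of v h] by (cases "0 < v") (auto simp: \<gamma>pos_def)
  qed
qed

text \<open>
  The other order of integration recovers the increments of \<open>\<phi>\<close>, by the fundamental theorem of
  calculus on the path from \<open>r\<close> to \<open>sqrt (r\<^sup>2 + h)\<close>; the sign of \<open>h\<close> accounts for its direction.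
\<close>

lemma displacement_section:
  "(\<integral>v. sgn h * (2 * v * \<gamma>pos v) * (c r * indicator {r. displaced h r v} r) \<partial>lborel)
     = indicator {r. 0 < r \<and> 0 < r\<^sup>2 + h} r * (c r * (\<phi> (sqrt (r\<^sup>2 + h)) - \<phi> r))"
proof (cases "0 < r \<and> 0 < r\<^sup>2 + h")
  case False
  then have "\<not> displaced h r v" for v by (auto simp: displaced_def)
  then show ?thesis using False by simp
next
  case True
  define s where "s = sqrt (r\<^sup>2 + h)"
  have s: "0 < s" "s\<^sup>2 = r\<^sup>2 + h" using True by (auto simp: s_def)
  have FTC: "(LINT v:{x..y}|lborel. 2 * v * \<gamma> v) = \<phi> y - \<phi> x" if "0 < x" "x \<le> y" for x y
  proof (rule set_integral_derivative[OF that(2)])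
    show "(\<phi> has_real_derivative 2 * v * \<gamma> v) (at v)" if "v \<in> {x..y}" for v
      using that \<open>0 < x\<close> by (intro deriv) auto
    have i: "integrable lborel (\<lambda>v. indicator {x..y} v * \<gamma> v)"
    proof -
      have "{x..y} \<subseteq> {0<..}" using that by auto
      then show ?thesis using set_integrable_subset[OF \<gamma>, of "{x..y}"] by (simp add: set_integrable_def)
    qed
    then have [measurable]: "(\<lambda>v. indicator {x..y} v * \<gamma> v) \<in> borel_measurable lborel"
      by (rule borel_measurable_integrable)
    have "integrable lborel (\<lambda>v. 2 * v * (indicator {x..y} v * \<gamma> v))"
    proof (rule Bochner_Integration.integrable_bound[OF integrable_mult_right[of "2 * y", OF i]])
      show "AE v in lborel. norm (2 * v * (indicator {x..y} v * \<gamma> v)) \<le> norm (2 * y * (indicator {x..y} v * \<gamma> v))"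
        using that by (intro AE_I2) (auto simp: indicator_def abs_mult intro!: mult_right_mono)
    qed measurable
    then show "set_integrable lborel {x..y} (\<lambda>v. 2 * v * \<gamma> v)"
      by (simp add: set_integrable_def ac_simps)
  qed
  have "(\<integral>v. sgn h * (2 * v * \<gamma>pos v) * (c r * indicator {r. displaced h r v} r) \<partial>lborel)
     = sgn h * c r * (LINT v:{min r s..max r s}|lborel. 2 * v * \<gamma> v)"
    unfolding set_lebesgue_integral_def displaced_section[OF conjunct1[OF True] conjunct2[OF True], folded s_def, symmetric]
    by (subst integral_mult_right_zero[symmetric], intro Bochner_Integration.integral_cong)
       (auto simp: \<gamma>pos_def indicator_def displaced_def[THEN iffD1, THEN conjunct2, THEN conjunct1])
  also have "\<dots> = c r * (\<phi> s - \<phi> r)"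
  proof (cases h "0::real" rule: linorder_cases)
    case less
    then have "s\<^sup>2 < r\<^sup>2" using s by simp
    then have "s < r" using True by (auto intro: power2_less_imp_less)
    then show ?thesis using less FTC[of s r] s(1) by (simp add: right_diff_distrib)
  next
    case equal
    then show ?thesis using True by (simp add: s_def)
  next
    case greater
    then have "r\<^sup>2 < s\<^sup>2" using s by simp
    then have "r < s" using s(1) by (auto intro: power2_less_imp_less)
    then show ?thesis using greater FTC[of r s] True by simp
  qed
  finally show ?thesis using True by (simp add: s_def)
qed

lemma integrable_increment:
  "set_integrable lborel {r. 0 < r \<and> 0 < r\<^sup>2 + h} (\<lambda>r. c r * (\<phi> (sqrt (r\<^sup>2 + h)) - \<phi> r))"
  using lborel_pair.integrable_snd[OF integrable_displacement, of h]
  unfolding displacement_section set_integrable_def by simp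

lemma integral_increment:
  "(LINT r:{r. 0 < r \<and> 0 < r\<^sup>2 + h}|lborel. c r * (\<phi> (sqrt (r\<^sup>2 + h)) - \<phi> r))
     = (\<integral>v. sgn h * (2 * v * \<gamma>pos v) * crossing_weight h v \<partial>lborel)"
  using lborel_pair.Fubini_integral[OF integrable_displacement, of h]
  unfolding displacement_section set_lebesgue_integral_def by (simp add: crossing_weight_def)

text \<open>
  The difference quotient is the integral of \<open>\<gamma> v\<close> against \<open>2 * v * crossing_weight h v / \<bar>h\<bar>\<close>. The latter
  is bounded, and it tends to \<open>c v\<close> wherever \<open>c\<close> is locally constant, since
  \<open>\<bar>v - sqrt (v\<^sup>2 - h)\<bar> = \<bar>h\<bar> / (v + sqrt (v\<^sup>2 - h))\<close>.
\<close>

lemma increment_derivative: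
  assumes lc: "AE v in lborel. 0 < v \<longrightarrow> (\<forall>\<^sub>F r in nhds v. c r = c v)"
  shows "((\<lambda>h. (LINT r:{r. 0 < r \<and> 0 < r\<^sup>2 + h}|lborel. c r * (\<phi> (sqrt (r\<^sup>2 + h)) - \<phi> r)) / h)
           \<longlongrightarrow> (LINT v:{0<..}|lborel. c v * \<gamma> v)) (at 0)"
  unfolding tendsto_at_iff_sequentially
proof (intro allI impI)
  fix X :: "nat \<Rightarrow> real" assume X: "\<forall>i. X i \<in> UNIV - {0}" and X0: "X \<longlonglongrightarrow> 0"
  note [measurable] = c(1) borel_measurable_integrable[OF integrable_\<gamma>pos]
  have "(\<lambda>i. \<integral>v. sgn (X i) * (2 * v * \<gamma>pos v) * crossing_weight (X i) v / X i \<partial>lborel) \<longlonglongrightarrow> (\<integral>v. c v * \<gamma>pos v \<partial>lborel)"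
  proof (rule integral_dominated_convergence[where w="\<lambda>v. 2 * C * \<bar>\<gamma>pos v\<bar>"])
    show "integrable lborel (\<lambda>v. 2 * C * \<bar>\<gamma>pos v\<bar>)" using integrable_\<gamma>pos by simp
    show "AE v in lborel. norm (sgn (X i) * (2 * v * \<gamma>pos v) * crossing_weight (X i) v / X i) \<le> 2 * C * \<bar>\<gamma>pos v\<bar>" for i
    proof (intro AE_I2)
      fix v
      have Xi: "X i \<noteq> 0" using X by simp
      show "norm (sgn (X i) * (2 * v * \<gamma>pos v) * crossing_weight (X i) v / X i) \<le> 2 * C * \<bar>\<gamma>pos v\<bar>"
      proof (cases "0 < v")
        case True
        have "norm (sgn (X i) * (2 * v * \<gamma>pos v) * crossing_weight (X i) v / X i) = 2 * v * \<bar>\<gamma>pos v\<bar> / \<bar>X i\<bar> * \<bar>crossing_weight (X i) v\<bar>"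
          using True Xi by (simp add: abs_mult)
        also have "\<dots> \<le> 2 * v * \<bar>\<gamma>pos v\<bar> / \<bar>X i\<bar> * (C * (\<bar>X i\<bar> / v))"
          using True by (intro mult_left_mono abs_crossing_weight_le) auto
        also have "\<dots> = 2 * C * \<bar>\<gamma>pos v\<bar>" using True Xi by (simp add: field_simps)
        finally show ?thesis .
      qed (simp add: \<gamma>pos_def)
    qed
    show "AE v in lborel. (\<lambda>i. sgn (X i) * (2 * v * \<gamma>pos v) * crossing_weight (X i) v / X i) \<longlonglongrightarrow> c v * \<gamma>pos v"
      using lc
    proof eventually_elim
      case (elim v)
      show ?case
      proof (cases "0 < v")
        case True
        define w where "w i = sqrt (v\<^sup>2 - X i)" for i
        have "w \<longlonglongrightarrow> sqrt (v\<^sup>2 - 0)" unfolding w_def by (intro tendsto_intros X0)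
        then have wv: "w \<longlonglongrightarrow> v" using True by simp
        obtain e where e: "e > 0" "\<And>r. dist r v < e \<Longrightarrow> c r = c v"
          using elim True by (auto simp: eventually_nhds_metric)
        have ev1: "\<forall>\<^sub>F i in sequentially. dist (w i) v < e" using wv e(1) by (rule tendstoD)
        have ev2: "\<forall>\<^sub>F i in sequentially. \<bar>X i\<bar> < v\<^sup>2"
          using tendstoD[OF X0, of "v\<^sup>2"] True by simp
        have "(\<lambda>i. 2 * v / (v + w i) * (c v * \<gamma>pos v)) \<longlonglongrightarrow> 2 * v / (v + v) * (c v * \<gamma>pos v)"
          using True by (intro tendsto_intros wv) auto
        then have lim: "(\<lambda>i. 2 * v / (v + w i) * (c v * \<gamma>pos v)) \<longlonglongrightarrow> c v * \<gamma>pos v" using True by simp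
        show ?thesis
        proof (rule Lim_transform_eventually[OF lim])
          show "\<forall>\<^sub>F i in sequentially. 2 * v / (v + w i) * (c v * \<gamma>pos v) = sgn (X i) * (2 * v * \<gamma>pos v) * crossing_weight (X i) v / X i"
            using ev1 ev2
          proof eventually_elim
            case (elim i)
            have Xi: "X i \<noteq> 0" using X by simp
            have w: "0 < w i" "(w i)\<^sup>2 = v\<^sup>2 - X i" using elim(2) by (auto simp: w_def)
            have "crossing_weight (X i) v = (\<integral>r. c v * indicator {min v (w i)..max v (w i)} r \<partial>lborel)"
              unfolding crossing_weight_def displaced_eq[OF True elim(2), folded w_def]
            proof (intro Bochner_Integration.integral_cong refl)
              fix r show "c r * indicator {min v (w i)..max v (w i)} r = c v * indicator {min v (w i)..max v (w i)} r"
                using e(2)[of r] elim(1) by (auto simp: indicator_def dist_real_def)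
            qed
            also have "\<dots> = c v * \<bar>v - w i\<bar>" by (auto simp: min_def max_def)
            also have "\<bar>v - w i\<bar> = \<bar>X i\<bar> / (v + w i)"
            proof -
              have "\<bar>v - w i\<bar> * (v + w i) = \<bar>v\<^sup>2 - (w i)\<^sup>2\<bar>"
                using w True by (intro abs_diff_times_sum) auto
              then show ?thesis using w True by (simp add: field_simps)
            qed
            finally have K: "crossing_weight (X i) v = c v * (\<bar>X i\<bar> / (v + w i))" .
            have "sgn (X i) * (2 * v * \<gamma>pos v) * crossing_weight (X i) v / X i
              = (sgn (X i) * \<bar>X i\<bar>) * (2 * v * \<gamma>pos v * c v / (v + w i)) / X i"
              unfolding K by (simp only: times_divide_eq_right times_divide_eq_left ac_simps)
            also have "\<dots> = X i * (2 * v * \<gamma>pos v * c v / (v + w i)) / X i"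
              by (simp only: sgn_mult_abs)
            also have "\<dots> = 2 * v / (v + w i) * (c v * \<gamma>pos v)" using Xi by simp
            finally show ?case by simp
          qed
        qed
      qed (simp add: \<gamma>pos_def)
    qed
  qed measurable
  then show "((\<lambda>h. (LINT r:{r. 0 < r \<and> 0 < r\<^sup>2 + h}|lborel. c r * (\<phi> (sqrt (r\<^sup>2 + h)) - \<phi> r)) / h) \<circ> X)
     \<longlonglongrightarrow> (LINT v:{0<..}|lborel. c v * \<gamma> v)"
    unfolding integral_increment o_def by (simp add: set_lebesgue_integral_def \<gamma>pos_def ac_simps)
qed

end

lemma set_integral_reflect_even:
  fixes f :: "real \<Rightarrow> real"
  assumes even: "\<And>r. f (- r) = f r"
  shows "set_integrable lborel {..<0} f \<longleftrightarrow> set_integrable lborel {0<..} f"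
    and "(LINT r:{..<0}|lborel. f r) = (LINT r:{0<..}|lborel. f r)"
proof -
  have *: "indicator {..<0} (- r) *\<^sub>R f (- r) = indicator {0<..} r *\<^sub>R f r" for r :: real
    using even by (simp add: indicator_def)
  show "set_integrable lborel {..<0} f \<longleftrightarrow> set_integrable lborel {0<..} f"
    unfolding set_integrable_def
    by (subst lborel_integrable_real_affine_iff[of "-1" _ 0, symmetric]) (simp_all add: *[simplified])
  show "(LINT r:{..<0}|lborel. f r) = (LINT r:{0<..}|lborel. f r)"
    unfolding set_lebesgue_integral_def
    by (subst lborel_integral_real_affine[of "-1" _ 0]) (simp_all add: *[simplified])
qed

text \<open>
  Folding the line at the origin: integrating an even function over \<open>{..s}\<close> counts the positive
  radii up to \<open>s\<close> twice and the others once.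
\<close>

definition fold_weight :: "real \<Rightarrow> real \<Rightarrow> real" where
  "fold_weight s r = 1 + indicator {..s} r"

lemma fold_even:
  fixes f :: "real \<Rightarrow> real"
  assumes even: "\<And>r. f (- r) = f r" and s: "0 \<le> s" and f: "set_integrable lborel {0<..} f"
  shows "integrable lborel f"
    and "set_integrable lborel {0<..} (\<lambda>r. fold_weight s r * f r)"
    and "(LINT r:{..s}|lborel. f r) = (LINT r:{0<..}|lborel. fold_weight s r * f r)"
proof -
  have f': "set_integrable lborel {..<0} f" using f set_integral_reflect_even(1)[of f, OF even] by simp
  have "set_integrable lborel ({..<0} \<union> {0<..}) f"
    by (rule set_integrable_Un[OF f' f]) auto
  then have i: "integrable lborel (\<lambda>r. indicator ({..<0} \<union> {0<..}) r *\<^sub>R f r)"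
    by (simp add: set_integrable_def)
  show "integrable lborel f"
  proof (rule integrable_cong_AE_imp[OF i])
    have "(\<lambda>r. indicator ({..<0} \<union> {0<..}) r *\<^sub>R f r + indicator {0} r * f 0) \<in> borel_measurable lborel"
      using borel_measurable_integrable[OF i] by measurable
    moreover have "indicator ({..<0} \<union> {0<..}) r *\<^sub>R f r + indicator {0} r * f 0 = f r" for r
      by (cases r "0::real" rule: linorder_cases) auto
    ultimately show "f \<in> borel_measurable lborel" by simp
    show "AE x in lborel. indicator ({..<0} \<union> {0<..}) x *\<^sub>R f x = f x"
      using AE_lborel_singleton[of 0] by eventually_elim (auto simp: indicator_def)
  qed
  have fs: "set_integrable lborel {0<..s} f" by (rule set_integrable_subset[OF f]) auto
  have *: "indicator {0<..} r *\<^sub>R (fold_weight s r * f r)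
      = indicator {0<..} r *\<^sub>R f r + indicator {0<..s} r *\<^sub>R f r" for r
    by (auto simp: fold_weight_def indicator_def)
  show "set_integrable lborel {0<..} (\<lambda>r. fold_weight s r * f r)"
    using f fs unfolding set_integrable_def * by (rule Bochner_Integration.integrable_add)
  have "(LINT r:{..s}|lborel. f r) = (LINT r:{..<0} \<union> {0<..s}|lborel. f r)"
  proof (rule set_integral_null_delta)
    have "({..s} - ({..<0} \<union> {0<..s})) \<union> (({..<0} \<union> {0<..s}) - {..s}) = {0}" using s by auto
    then show "({..s} - ({..<0} \<union> {0<..s})) \<union> (({..<0} \<union> {0<..s}) - {..s}) \<in> null_sets lborel"
      by (simp add: null_sets_def)
  qed (use \<open>integrable lborel f\<close> in auto)
  also have "\<dots> = (LINT r:{..<0}|lborel. f r) + (LINT r:{0<..s}|lborel. f r)"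
    by (rule set_integral_Un[OF _ f' fs]) auto
  also have "\<dots> = (LINT r:{0<..}|lborel. f r) + (LINT r:{0<..s}|lborel. f r)"
    using set_integral_reflect_even(2)[of f, OF even] by simp
  also have "\<dots> = (LINT r:{0<..}|lborel. fold_weight s r * f r)"
    using f fs unfolding set_integrable_def set_lebesgue_integral_def *
    by (rule Bochner_Integration.integral_add[symmetric])
  finally show "(LINT r:{..s}|lborel. f r) = (LINT r:{0<..}|lborel. fold_weight s r * f r)" .
qed

text \<open>
  Displacing the radius by \<open>h\<close> amounts to replacing \<open>q0\<close> by \<open>q0 + h\<close>: if \<open>\<phi> r = g (r\<^sup>2 + q0)\<close>, then
  \<open>\<phi> (sqrt (r\<^sup>2 + h)) = g (r\<^sup>2 + (q0 + h))\<close>.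
\<close>

lemma translate_increment:
  fixes g g' :: "real \<Rightarrow> real"
  assumes g': "\<And>t. 0 < t \<Longrightarrow> (g has_real_derivative g' t) (at t)"
    and q0: "0 \<le> q0"
    and int': "set_integrable lborel {0<..} (\<lambda>r. g' (r\<^sup>2 + q0))"
    and c: "c \<in> borel_measurable borel" "\<And>r. \<bar>c r\<bar> \<le> C"
  shows "set_integrable lborel {r. 0 < r \<and> 0 < r\<^sup>2 + h} (\<lambda>r. c r * (g (r\<^sup>2 + (q0 + h)) - g (r\<^sup>2 + q0)))"
    and "AE v in lborel. 0 < v \<longrightarrow> (\<forall>\<^sub>F r in nhds v. c r = c v) \<Longrightarrow>
      ((\<lambda>h. (LINT r:{r. 0 < r \<and> 0 < r\<^sup>2 + h}|lborel. c r * (g (r\<^sup>2 + (q0 + h)) - g (r\<^sup>2 + q0))) / h)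
           \<longlongrightarrow> (LINT v:{0<..}|lborel. c v * g' (v\<^sup>2 + q0))) (at 0)"
proof -
  define \<phi> where "\<phi> r = g (r\<^sup>2 + q0)" for r
  have deriv: "(\<phi> has_real_derivative 2 * v * g' (v\<^sup>2 + q0)) (at v)" if "0 < v" for v
  proof -
    have "(g has_real_derivative g' (v\<^sup>2 + q0)) (at (v\<^sup>2 + q0))"
      using that q0 by (intro g' add_pos_nonneg) auto
    then have "((\<lambda>r. g (r\<^sup>2 + q0)) has_real_derivative g' (v\<^sup>2 + q0) * (2 * v)) (at v)"
      by (rule DERIV_chain2) (auto intro!: derivative_eq_intros)
    then show ?thesis unfolding \<phi>_def by (simp add: ac_simps)
  qed
  have eq: "indicator {r. 0 < r \<and> 0 < r\<^sup>2 + h} r *\<^sub>R (c r * (\<phi> (sqrt (r\<^sup>2 + h)) - \<phi> r))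
    = indicator {r. 0 < r \<and> 0 < r\<^sup>2 + h} r *\<^sub>R (c r * (g (r\<^sup>2 + (q0 + h)) - g (r\<^sup>2 + q0)))" for r h
    by (auto simp: indicator_def \<phi>_def ac_simps)
  show "set_integrable lborel {r. 0 < r \<and> 0 < r\<^sup>2 + h} (\<lambda>r. c r * (g (r\<^sup>2 + (q0 + h)) - g (r\<^sup>2 + q0)))"
    using integrable_increment[of \<phi> "\<lambda>v. g' (v\<^sup>2 + q0)" c C h, OF deriv int' c]
    unfolding set_integrable_def eq .
  show "((\<lambda>h. (LINT r:{r. 0 < r \<and> 0 < r\<^sup>2 + h}|lborel. c r * (g (r\<^sup>2 + (q0 + h)) - g (r\<^sup>2 + q0))) / h)
           \<longlongrightarrow> (LINT v:{0<..}|lborel. c v * g' (v\<^sup>2 + q0))) (at 0)"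
    if "AE v in lborel. 0 < v \<longrightarrow> (\<forall>\<^sub>F r in nhds v. c r = c v)"
    using increment_derivative[of \<phi> "\<lambda>v. g' (v\<^sup>2 + q0)" c C, OF deriv int' c that]
    unfolding set_lebesgue_integral_def eq .
qed

text \<open>
  Integrability of the generator along one ray \<open>r\<^sup>2 + q1\<close> propagates to the other rays, because the
  differences between rays are integrable.
\<close>

context
  fixes g g' :: "real \<Rightarrow> real" and q0 q1 s :: real
  assumes g': "\<And>t. 0 < t \<Longrightarrow> (g has_real_derivative g' t) (at t)"
    and q0: "0 \<le> q0" and s: "0 \<le> s"
    and int': "set_integrable lborel {..s} (\<lambda>r. g' (r\<^sup>2 + q0))"
    and q1: "q0 < q1" and int1: "set_integrable lborel {0<..} (\<lambda>r. g (r\<^sup>2 + q1))"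
begin

lemma integrable_derivative_translate: "set_integrable lborel {0<..} (\<lambda>r. g' (r\<^sup>2 + q0))"
proof -
  have "{..<0} \<subseteq> {..s}" using s by auto
  then have "set_integrable lborel {..<0} (\<lambda>r. g' (r\<^sup>2 + q0))" using set_integrable_subset[OF int', of "{..<0}"] by simp
  then show ?thesis using set_integral_reflect_even(1)[of "\<lambda>r. g' (r\<^sup>2 + q0)"] by simp
qed

lemma isCont_generator: "0 < t \<Longrightarrow> isCont g t"
  using g' DERIV_isCont by blast

lemma integrable_translate0: "set_integrable lborel {0<..} (\<lambda>r. g (r\<^sup>2 + q0))"
proof -
  have "{r. 0 < r \<and> 0 < r\<^sup>2 + (q1 - q0)} = {0<..}" using q1 by (auto intro!: add_pos_pos)
  then have "set_integrable lborel {0<..} (\<lambda>r. g (r\<^sup>2 + q1) - g (r\<^sup>2 + q0))"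
    using translate_increment(1)[OF g' q0 integrable_derivative_translate, of "\<lambda>_. 1" 1 "q1 - q0"] q1 q0 by simp
  from set_integral_diff(1)[OF int1 this] show ?thesis by simp
qed

text \<open>
  For \<open>q < q0\<close> the radii with \<open>r\<^sup>2 + q \<le> q0\<close> have to be treated apart: there the increment involves
  values of \<open>g'\<close> below \<open>q0\<close>, which may fail to be integrable; but \<open>g\<close> is continuous on this compact
  piece.
\<close>

lemma integrable_translate:
  assumes q: "q0 \<le> q \<or> 0 < q" shows "set_integrable lborel {0<..} (\<lambda>r. g (r\<^sup>2 + q))"
proof -
  define h where "h = q - q0"
  define P where "P = {r. 0 < r \<and> 0 < r\<^sup>2 + h}"
  define m where "m = sqrt (max 0 (- h))"
  have m: "0 \<le> m" "m\<^sup>2 = max 0 (- h)" by (auto simp: m_def)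
  have "{0<..} = P \<union> {0<..m}"
  proof (intro equalityI subsetI)
    fix r :: real assume r: "r \<in> {0<..}"
    show "r \<in> P \<union> {0<..m}"
    proof (cases "r \<le> m")
      case False
      then have "m\<^sup>2 < r\<^sup>2" using m(1) by (intro power_strict_mono) auto
      then show ?thesis using r m(2) by (auto simp: P_def)
    qed (use r in auto)
  qed (auto simp: P_def)
  moreover have "set_integrable lborel P (\<lambda>r. g (r\<^sup>2 + q) - g (r\<^sup>2 + q0))"
    using translate_increment(1)[OF g' q0 integrable_derivative_translate, of "\<lambda>_. 1" 1 h] q
    by (auto simp: P_def h_def)
  moreover have [measurable]: "P \<in> sets borel" unfolding P_def by measurable
  moreover have "set_integrable lborel P (\<lambda>r. g (r\<^sup>2 + q0))"
    by (rule set_integrable_subset[OF integrable_translate0]) (auto simp: P_def)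
  ultimately have P: "set_integrable lborel P (\<lambda>r. g (r\<^sup>2 + q))"
    using set_integral_add(1)[of lborel P "\<lambda>r. g (r\<^sup>2 + q) - g (r\<^sup>2 + q0)" "\<lambda>r. g (r\<^sup>2 + q0)"] by simp
  have m': "set_integrable lborel {0<..m} (\<lambda>r. g (r\<^sup>2 + q))"
  proof (cases "h < 0")
    case True
    then have "0 < q" using q by (auto simp: h_def)
    then have "continuous_on {0..m} (\<lambda>r. g (r\<^sup>2 + q))"
      by (intro continuous_at_imp_continuous_on ballI isCont_o2[OF _ isCont_generator] continuous_intros) (auto intro!: add_nonneg_pos)
    then have "set_integrable lborel {0..m} (\<lambda>r. g (r\<^sup>2 + q))"
      unfolding set_integrable_def by (intro borel_integrable_compact) auto
    then show ?thesis by (rule set_integrable_subset) auto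
  qed (simp add: m_def)
  show ?thesis unfolding \<open>{0<..} = P \<union> {0<..m}\<close>
    by (rule set_integrable_Un[OF P m']) auto
qed

text \<open>
  At \<open>q0 = 0\<close> only a derivative from the right makes sense. For \<open>q0 > 0\<close> and \<open>q < q0\<close> the radii below
  \<open>sqrt (q0 - q)\<close> escape the integral representation of increments. They contribute an integral over an
  interval of length \<open>sqrt \<bar>h\<bar>\<close> of increments of size \<open>O(h)\<close>, by differentiability of \<open>g\<close> at \<open>q0\<close>
  alone, hence \<open>o(h)\<close>.
\<close>

lemma truncated_integral_derivative:
  assumes A: "A = {q0..} \<or> A = UNIV \<and> 0 < q0"
  shows "((\<lambda>q. LINT r:{..s}|lborel. g (r\<^sup>2 + q)) has_real_derivative (LINT r:{..s}|lborel. g' (r\<^sup>2 + q0)))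
    (at q0 within A)"
proof -
  define c where "c = fold_weight s"
  have c: "c \<in> borel_measurable borel" "\<bar>c r\<bar> \<le> 2" for r
    by (auto simp: c_def fold_weight_def[abs_def] indicator_def)
  have lc: "AE v in lborel. 0 < v \<longrightarrow> (\<forall>\<^sub>F r in nhds v. c r = c v)"
    using AE_lborel_singleton[of s]
  proof eventually_elim
    case (elim v)
    show ?case
    proof (cases "v < s")
      case True
      then have "\<forall>\<^sub>F r in nhds v. r < s" by (intro order_tendstoD(2)[OF filterlim_ident]) auto
      then show ?thesis using True by (auto elim!: eventually_mono simp: c_def fold_weight_def)
    next
      case False
      then have "\<forall>\<^sub>F r in nhds v. s < r" using elim by (intro order_tendstoD(1)[OF filterlim_ident]) auto
      then show ?thesis using False elim by (auto elim!: eventually_mono simp: c_def fold_weight_def)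
    qed
  qed
  define D where "D = (LINT r:{..s}|lborel. g' (r\<^sup>2 + q0))"
  have D: "D = (LINT v:{0<..}|lborel. c v * g' (v\<^sup>2 + q0))"
    unfolding D_def c_def by (rule fold_even(3)[OF _ s integrable_derivative_translate]) simp
  define F where "F q = (LINT r:{..s}|lborel. g (r\<^sup>2 + q))" for q
  have F: "F q = (LINT r:{0<..}|lborel. c r * g (r\<^sup>2 + q))"
    and Fi: "set_integrable lborel {0<..} (\<lambda>r. c r * g (r\<^sup>2 + q))" if "q0 \<le> q \<or> 0 < q" for q
    unfolding F_def c_def using integrable_translate[OF that]
    by (auto intro!: fold_even(2,3) s)
  define P where "P h = {r. 0 < r \<and> 0 < r\<^sup>2 + h}" for h :: real
  define m where "m h = sqrt (max 0 (- h))" for h :: real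
  have m: "0 \<le> m h" "(m h)\<^sup>2 = max 0 (- h)" for h by (auto simp: m_def)
  have [measurable]: "P h \<in> sets borel" for h unfolding P_def by measurable
  have split: "{0<..} = P h \<union> {0<..m h}" "P h \<inter> {0<..m h} = {}" for h
  proof -
    have *: "0 < r\<^sup>2 + h \<longleftrightarrow> \<not> r \<le> m h" if "0 < r" for r
    proof -
      have "r \<le> m h \<longleftrightarrow> r\<^sup>2 \<le> (m h)\<^sup>2" using that m(1)[of h] by (auto simp: abs_le_square_iff[symmetric])
      then show ?thesis using m(2)[of h] that zero_less_power[OF that, of 2] by auto
    qed
    show "{0<..} = P h \<union> {0<..m h}" "P h \<inter> {0<..m h} = {}"
      using * by (auto simp: P_def)
  qed
  define I where "I h = (LINT r:P h|lborel. c r * (g (r\<^sup>2 + (q0 + h)) - g (r\<^sup>2 + q0)))" for h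
  define J where "J h = (LINT r:{0<..m h}|lborel. c r * (g (r\<^sup>2 + (q0 + h)) - g (r\<^sup>2 + q0)))" for h
  have F_diff: "F (q0 + h) - F q0 = I h + J h" if "0 \<le> h \<or> 0 < q0 + h" for h
  proof -
    have i: "set_integrable lborel {0<..} (\<lambda>r. c r * (g (r\<^sup>2 + (q0 + h)) - g (r\<^sup>2 + q0)))"
      using set_integral_diff(1)[OF Fi[of "q0 + h"] Fi[of q0]] that by (simp add: right_diff_distrib)
    have "F (q0 + h) - F q0 = (LINT r:{0<..}|lborel. c r * (g (r\<^sup>2 + (q0 + h)) - g (r\<^sup>2 + q0)))"
      using set_integral_diff(2)[OF Fi[of "q0 + h"] Fi[of q0]] that F[of "q0 + h"] F[of q0]
      by (simp add: right_diff_distrib)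
    also have "\<dots> = I h + J h"
      unfolding split(1)[of h] I_def J_def
      by (rule set_integral_Un[OF split(2)]) (auto intro!: set_integrable_subset[OF i] simp: P_def)
    finally show ?thesis .
  qed
  have I: "((\<lambda>h. I h / h) \<longlongrightarrow> D) (at 0)"
    unfolding I_def P_def D
    by (rule translate_increment(2)[where C=2, OF g' q0 integrable_derivative_translate c lc])
  have J: "((\<lambda>h. J h / h) \<longlongrightarrow> 0) (at 0)" if "0 < q0"
  proof -
    have "((\<lambda>t. (g t - g q0) / (t - q0)) \<longlongrightarrow> g' q0) (at q0)"
      using g'[OF that] by (simp add: has_field_derivative_iff)
    from tendstoD[OF this, of 1] obtain e where e: "e > 0"
      "\<And>t. t \<noteq> q0 \<Longrightarrow> dist t q0 < e \<Longrightarrow> \<bar>(g t - g q0) / (t - q0) - g' q0\<bar> < 1"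
      by (auto simp: eventually_at dist_real_def)
    define K where "K = \<bar>g' q0\<bar> + 1"
    have K: "\<bar>g t - g q0\<bar> \<le> K * \<bar>t - q0\<bar>" if "\<bar>t - q0\<bar> < e" for t
    proof (cases "t = q0")
      case False
      then have "\<bar>(g t - g q0) / (t - q0)\<bar> \<le> K" using e(2)[of t] that unfolding K_def dist_real_def by linarith
      then show ?thesis using False by (simp add: field_simps)
    qed simp
    \<comment> \<open>The weight is at most \<open>2\<close>, and each of the two values of \<open>g\<close> differs from \<open>g q0\<close> by at most
      \<open>K * \<bar>h\<bar>\<close>: whence the factor \<open>4\<close>.\<close>
    have "\<forall>\<^sub>F h in at 0. norm (J h / h) \<le> 4 * K * sqrt \<bar>h\<bar>"
      unfolding eventually_at
    proof (intro exI[of _ "min e q0"] conjI ballI impI)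
      fix h :: real assume h: "h \<noteq> 0 \<and> dist h 0 < min e q0"
      then have h': "h \<noteq> 0" "\<bar>h\<bar> < e" "\<bar>h\<bar> < q0" by (auto simp: dist_real_def)
      have bound: "\<bar>c r * (g (r\<^sup>2 + (q0 + h)) - g (r\<^sup>2 + q0))\<bar> \<le> 4 * K * \<bar>h\<bar>" if r: "r \<in> {0<..m h}" for r
      proof -
        have h0: "h < 0"
        proof (rule ccontr)
          assume "\<not> h < 0"
          then have "m h = 0" by (simp add: m_def)
          then show False using r by simp
        qed
        have "r\<^sup>2 \<le> (m h)\<^sup>2" using r by (intro power_mono) auto
        then have r2: "r\<^sup>2 \<le> - h" "0 \<le> r\<^sup>2" using m(2)[of h] h0 by auto
        have Kp: "0 \<le> K" by (simp add: K_def)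
        have "\<bar>g (r\<^sup>2 + (q0 + h)) - g q0\<bar> \<le> K * \<bar>r\<^sup>2 + (q0 + h) - q0\<bar>"
          by (intro K) (use r2 h0 h' in linarith)
        also have "\<dots> \<le> K * \<bar>h\<bar>" using r2 h0 Kp by (intro mult_left_mono) auto
        finally have 1: "\<bar>g (r\<^sup>2 + (q0 + h)) - g q0\<bar> \<le> K * \<bar>h\<bar>" .
        have "\<bar>g (r\<^sup>2 + q0) - g q0\<bar> \<le> K * \<bar>r\<^sup>2 + q0 - q0\<bar>"
          by (intro K) (use r2 h0 h' in linarith)
        also have "\<dots> \<le> K * \<bar>h\<bar>" using r2 h0 Kp by (intro mult_left_mono) auto
        finally have 2: "\<bar>g (r\<^sup>2 + q0) - g q0\<bar> \<le> K * \<bar>h\<bar>" .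
        have 3: "\<bar>g (r\<^sup>2 + (q0 + h)) - g (r\<^sup>2 + q0)\<bar> \<le> 2 * (K * \<bar>h\<bar>)" using 1 2 by linarith
        have "\<bar>c r\<bar> * \<bar>g (r\<^sup>2 + (q0 + h)) - g (r\<^sup>2 + q0)\<bar> \<le> 2 * (2 * (K * \<bar>h\<bar>))"
          by (rule mult_mono[OF c(2) 3]) auto
        then show ?thesis by (simp add: abs_mult)
      qed
      have "norm (J h) \<le> (LINT r:{0<..m h}|lborel. 4 * K * \<bar>h\<bar>)"
      proof -
        have i: "set_integrable lborel {0<..} (\<lambda>r. c r * (g (r\<^sup>2 + (q0 + h)) - g (r\<^sup>2 + q0)))"
          using set_integral_diff(1)[OF Fi[of "q0 + h"] Fi[of q0]] h' by (simp add: right_diff_distrib abs_less_iff)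
        have i: "set_integrable lborel {0<..m h} (\<lambda>r. c r * (g (r\<^sup>2 + (q0 + h)) - g (r\<^sup>2 + q0)))"
          by (rule set_integrable_subset[OF i]) auto
        have "norm (J h) \<le> (LINT r:{0<..m h}|lborel. norm (c r * (g (r\<^sup>2 + (q0 + h)) - g (r\<^sup>2 + q0))))"
          unfolding J_def by (rule set_integral_norm_bound[OF i])
        also have "\<dots> \<le> (LINT r:{0<..m h}|lborel. 4 * K * \<bar>h\<bar>)"
        proof (rule set_integral_mono[OF set_integrable_norm[OF i]])
          show "set_integrable lborel {0<..m h} (\<lambda>r. 4 * K * \<bar>h\<bar>)"
            unfolding set_integrable_def real_scaleR_def using m(1)[of h]
            by (intro integrable_mult_left integrable_real_indicator) auto
        qed (use bound in auto)
        finally show ?thesis .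
      qed
      also have "\<dots> = m h * (4 * K * \<bar>h\<bar>)" using m(1)[of h] by (simp add: set_lebesgue_integral_def)
      also have "\<dots> \<le> sqrt \<bar>h\<bar> * (4 * K * \<bar>h\<bar>)"
        by (intro mult_right_mono) (auto simp: m_def K_def)
      finally have "norm (J h) \<le> 4 * K * sqrt \<bar>h\<bar> * \<bar>h\<bar>" by (simp add: ac_simps)
      then show "norm (J h / h) \<le> 4 * K * sqrt \<bar>h\<bar>" using h' by (simp add: field_simps)
    qed (use e that in auto)
    moreover have "((\<lambda>h. 4 * K * sqrt \<bar>h\<bar>) \<longlongrightarrow> 4 * K * sqrt \<bar>0\<bar>) (at 0)" by (intro tendsto_intros)
    ultimately show ?thesis by (intro Lim_null_comparison[of "\<lambda>h. J h / h"]) auto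
  qed
  have fl: "filterlim (\<lambda>q. q - q0) (at 0) (at q0 within A)"
  proof (rule filterlim_atI)
    have "((\<lambda>q. q - q0) \<longlongrightarrow> q0 - q0) (at q0 within A)" by (intro tendsto_intros)
    then show "((\<lambda>q. q - q0) \<longlongrightarrow> 0) (at q0 within A)" by simp
  qed (auto simp: eventually_at_filter)
  have J': "((\<lambda>q. J (q - q0) / (q - q0)) \<longlongrightarrow> 0) (at q0 within A)"
  proof (cases "A = {q0..}")
    case True
    have "\<forall>\<^sub>F q in at q0 within A. 0 = J (q - q0) / (q - q0)"
      unfolding True eventually_at_filter by (auto simp: J_def m_def set_lebesgue_integral_def)
    then show ?thesis by (rule Lim_transform_eventually[OF tendsto_const])
  next
    case False
    then show ?thesis using A by (intro filterlim_compose[OF J fl]) auto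
  qed
  have "((\<lambda>q. I (q - q0) / (q - q0) + J (q - q0) / (q - q0)) \<longlongrightarrow> D + 0) (at q0 within A)"
    by (intro tendsto_add J' filterlim_compose[OF I fl])
  moreover have "\<forall>\<^sub>F q in at q0 within A. I (q - q0) / (q - q0) + J (q - q0) / (q - q0) = (F q - F q0) / (q - q0)"
  proof -
    have "\<forall>\<^sub>F q in at q0 within A. q0 \<le> q \<or> 0 < q"
    proof (cases "A = {q0..}")
      case False
      then have "0 < q0" using A by auto
      then have "\<forall>\<^sub>F q in at q0 within A. 0 < q" by (intro order_tendstoD(1)[OF tendsto_ident_at])
      then show ?thesis by eventually_elim auto
    qed (auto simp: eventually_at_filter)
    then show ?thesis
    proof eventually_elim
      case (elim q)
      then show ?case using F_diff[of "q - q0"] by (auto simp: add_divide_distrib)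
    qed
  qed
  ultimately have "((\<lambda>q. (F q - F q0) / (q - q0)) \<longlongrightarrow> D) (at q0 within A)"
    using Lim_transform_eventually by fastforce
  then show ?thesis unfolding F_def D_def has_field_derivative_iff .
qed

end

lemma truncated_integral_increment_bound:
  fixes f :: "real \<Rightarrow> real"
  assumes f: "integrable lborel f" and xy: "x \<le> y" and b: "\<And>r. r \<in> {x<..y} \<Longrightarrow> \<bar>f r - c\<bar> \<le> \<epsilon>"
  shows "\<bar>(LINT r:{..y}|lborel. f r) - (LINT r:{..x}|lborel. f r) - (y - x) * c\<bar> \<le> \<epsilon> * (y - x)"
proof -
  have i: "set_integrable lborel A f" if "A \<in> sets borel" for A
    using integrable_mult_indicator[OF _ f, of A] that by (simp add: set_integrable_def)
  have ic: "set_integrable lborel {x<..y} (\<lambda>_. k)" for k :: real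
    unfolding set_integrable_def real_scaleR_def using xy
    by (intro integrable_mult_left integrable_real_indicator) auto
  have "{..y} = {..x} \<union> {x<..y}" using xy by auto
  then have "(LINT r:{..y}|lborel. f r) = (LINT r:{..x}|lborel. f r) + (LINT r:{x<..y}|lborel. f r)"
    by (simp only:) (rule set_integral_Un, auto intro!: i)
  moreover have "(LINT r:{x<..y}|lborel. f r) - (y - x) * c = (LINT r:{x<..y}|lborel. f r - c)"
    using set_integral_diff(2)[OF i[of "{x<..y}"] ic[of c]] xy by (simp add: set_lebesgue_integral_def)
  moreover have "\<bar>LINT r:{x<..y}|lborel. f r - c\<bar> \<le> \<epsilon> * (y - x)"
  proof -
    have d: "set_integrable lborel {x<..y} (\<lambda>r. f r - c)" by (rule set_integral_diff(1)[OF i ic]) simp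
    have "\<bar>LINT r:{x<..y}|lborel. f r - c\<bar> \<le> (LINT r:{x<..y}|lborel. norm (f r - c))"
      using set_integral_norm_bound[OF d] by simp
    also have "\<dots> \<le> (LINT r:{x<..y}|lborel. \<epsilon>)"
      by (rule set_integral_mono[OF set_integrable_norm[OF d] ic]) (use b in auto)
    also have "\<dots> = \<epsilon> * (y - x)" using xy by (simp add: set_lebesgue_integral_def)
    finally show ?thesis .
  qed
  ultimately show ?thesis by linarith
qed

text \<open>
  Joint differentiability: the upper limit is moved at the displaced value of \<open>q\<close>, and continuity of
  \<open>g\<close> near \<open>s\<^sup>2 + q0 > 0\<close> makes the resulting error uniformly small.
\<close>

lemma truncated_integral_has_derivative:
  fixes g g' :: "real \<Rightarrow> real"
  assumes g': "\<And>t. 0 < t \<Longrightarrow> (g has_real_derivative g' t) (at t)"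
    and q0: "0 < q0" and s: "0 \<le> s"
    and int': "set_integrable lborel {..s} (\<lambda>r. g' (r\<^sup>2 + q0))"
    and q1: "q0 < q1" and int1: "set_integrable lborel {0<..} (\<lambda>r. g (r\<^sup>2 + q1))"
  shows "((\<lambda>(t, q). LINT r:{..t}|lborel. g (r\<^sup>2 + q)) has_derivative
    (\<lambda>(dt, dq). dt * g (s\<^sup>2 + q0) + dq * (LINT r:{..s}|lborel. g' (r\<^sup>2 + q0)))) (at (s, q0))"
proof -
  define F where "F t q = (LINT r:{..t}|lborel. g (r\<^sup>2 + q))" for t q
  define J where "J = (LINT r:{..s}|lborel. g' (r\<^sup>2 + q0))"
  define c where "c = g (s\<^sup>2 + q0)"
  have int: "integrable lborel (\<lambda>r. g (r\<^sup>2 + q))" if "0 < q" for q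
    using that q0 by (intro fold_even(1)[OF _ s] integrable_translate[OF g' _ s int' q1 int1]) auto
  have "((\<lambda>q. F s q) has_derivative (\<lambda>dq. J * dq)) (at q0)"
    using truncated_integral_derivative[OF g' less_imp_le[OF q0] s int' q1 int1, where A=UNIV] q0
    unfolding F_def J_def has_field_derivative_def by simp
  then have 1: "((\<lambda>p. F s (snd p)) has_derivative (\<lambda>p. J * snd p)) (at (s, q0))"
    using has_derivative_compose[of snd snd "(s, q0)" UNIV "F s" "\<lambda>dq. J * dq"]
    by (simp add: bounded_linear_imp_has_derivative bounded_linear_snd)
  have 2: "((\<lambda>p. F (fst p) (snd p) - F s (snd p)) has_derivative (\<lambda>p. fst p * c)) (at (s, q0))"
    unfolding has_derivative_at_alt
  proof (intro conjI allI impI)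
    show "bounded_linear (\<lambda>p. fst p * c)" by (intro bounded_linear_intros)
    fix e :: real assume e: "0 < e"
    have "s\<^sup>2 + q0 > 0" using q0 by (simp add: add_nonneg_pos)
    then have "isCont g (s\<^sup>2 + q0)" using g' DERIV_isCont by blast
    moreover have "isCont (\<lambda>p. (fst p)\<^sup>2 + snd p) (s, q0)" by (intro continuous_intros)
    ultimately have "isCont (\<lambda>p. g ((fst p)\<^sup>2 + snd p)) (s, q0)"
      using isCont_o2[of "(s, q0)" "\<lambda>p. (fst p)\<^sup>2 + snd p" g] by simp
    then have "\<exists>\<eta>>0. \<forall>p. dist p (s, q0) < \<eta> \<longrightarrow> dist (g ((fst p)\<^sup>2 + snd p)) (g ((fst (s, q0))\<^sup>2 + snd (s, q0))) < e"
      unfolding continuous_at_eps_delta using e by blast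
    then obtain \<eta> where \<eta>: "\<eta> > 0" "\<And>p. dist p (s, q0) < \<eta> \<Longrightarrow> dist (g ((fst p)\<^sup>2 + snd p)) c < e"
      unfolding c_def fst_conv snd_conv by blast
    show "\<exists>d>0. \<forall>p. norm (p - (s, q0)) < d \<longrightarrow>
       norm (F (fst p) (snd p) - F s (snd p) - (F (fst (s, q0)) (snd (s, q0)) - F s (snd (s, q0))) - fst (p - (s, q0)) * c) \<le> e * norm (p - (s, q0))"
    proof (intro exI[of _ "min \<eta> q0"] conjI allI impI)
      fix p :: "real \<times> real" assume p: "norm (p - (s, q0)) < min \<eta> q0"
      obtain t q where tq: "p = (t, q)" by (cases p)
      have n: "\<bar>t - s\<bar> \<le> norm (p - (s, q0))" "\<bar>q - q0\<bar> \<le> norm (p - (s, q0))"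
        using norm_fst_le[of "t - s" "q - q0"] norm_snd_le[of "q - q0" "t - s"] by (auto simp: tq)
      have q: "0 < q" using n(2) p by linarith
      have bound: "\<bar>g (r\<^sup>2 + q) - c\<bar> \<le> e" if r: "\<bar>r - s\<bar> \<le> \<bar>t - s\<bar>" for r
      proof -
        have "norm ((r, q) - (s, q0)) \<le> norm (p - (s, q0))"
          using r unfolding tq by (auto simp: norm_prod_def abs_le_square_iff intro!: real_sqrt_le_mono)
        then show ?thesis using \<eta>(2)[of "(r, q)"] p by (simp add: dist_norm)
      qed
      have "\<bar>F t q - F s q - (t - s) * c\<bar> \<le> e * \<bar>t - s\<bar>"
      proof (cases "s \<le> t")
        case True
        then show ?thesis unfolding F_def
          using truncated_integral_increment_bound[OF int[OF q] True, of c e] bound by auto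
      next
        case False
        then have "\<bar>F s q - F t q - (s - t) * c\<bar> \<le> e * (s - t)" unfolding F_def
          by (intro truncated_integral_increment_bound[OF int[OF q]]) (auto intro!: bound)
        moreover have "F s q - F t q - (s - t) * c = - (F t q - F s q - (t - s) * c)" by (simp add: algebra_simps)
        ultimately show ?thesis using False by (simp add: abs_minus_commute)
      qed
      also have "\<dots> \<le> e * norm (p - (s, q0))" using n e by (intro mult_left_mono) auto
      finally show "norm (F (fst p) (snd p) - F s (snd p) - (F (fst (s, q0)) (snd (s, q0)) - F s (snd (s, q0))) - fst (p - (s, q0)) * c) \<le> e * norm (p - (s, q0))"
        by (simp add: tq)
    qed (use \<eta> q0 in auto)
  qed
  show ?thesis
    using has_derivative_add[OF 2 1] unfolding F_def J_def c_def by (simp add: case_prod_unfold mult.commute)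
qed

section \<open>Linear images of Lebesgue measure\<close>

text \<open>
  Uniqueness of Haar measure on a Euclidean space, by the classical exchange argument: for the unit
  cube \<open>C\<close>, the integral of \<open>1\<^sub>C(x) 1\<^sub>B(x + y)\<close> over \<open>M\<close> and Lebesgue measure is
  \<open>M(C) \<lambda>(B)\<close> in one order and, after translating \<open>x\<close>, \<open>M(B) \<lambda>(C)\<close> in the other.
\<close>

lemma translation_invariant_measure_eq:
  fixes M :: "'a::euclidean_space measure"
  assumes sets: "sets M = sets borel" and "sigma_finite_measure M"
    and inv: "\<And>t. distr M borel (\<lambda>x. t + x) = M"
  obtains c where "M = density lborel (\<lambda>_. c)"
proof -
  interpret M: sigma_finite_measure M by fact
  interpret pair_sigma_finite M "lborel :: 'a measure" ..
  note [measurable_cong] = sets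
  define C :: "'a set" where "C = cbox 0 One"
  have C: "C \<in> sets borel" "emeasure lborel C = 1" by (auto simp: C_def)
  have "emeasure M B = emeasure M C * emeasure lborel B" if B: "B \<in> sets borel" for B
  proof -
    note [measurable] = B C(1)
    have lt: "(\<integral>\<^sup>+y. f (x + y) \<partial>lborel) = (\<integral>\<^sup>+y. f y \<partial>lborel)" if "f \<in> borel_measurable borel" for f :: "'a \<Rightarrow> ennreal" and x
      using that by (subst (2) lborel_distr_plus[of x, symmetric]) (simp add: nn_integral_distr)
    have Mt: "(\<integral>\<^sup>+x. f (y + x) \<partial>M) = (\<integral>\<^sup>+x. f x \<partial>M)" if "f \<in> borel_measurable borel" for f :: "'a \<Rightarrow> ennreal" and y
      using that by (subst (2) inv[of y, symmetric]) (simp add: nn_integral_distr)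
    have neg: "(\<integral>\<^sup>+y. f (x - y) \<partial>lborel) = (\<integral>\<^sup>+y. f y \<partial>lborel)" if [measurable]: "f \<in> borel_measurable borel" for f :: "'a \<Rightarrow> ennreal" and x
    proof -
      have "(\<integral>\<^sup>+y. f y \<partial>lborel) = (\<integral>\<^sup>+y. f y \<partial>density (distr lborel borel (\<lambda>y. x + (- 1) *\<^sub>R y)) (\<lambda>_. ennreal (\<bar>- 1\<bar> ^ DIM('a))))"
        by (subst lborel_affine[of "-1" x]) auto
      then show ?thesis by (simp add: nn_integral_density nn_integral_distr)
    qed
    have "emeasure M C * emeasure lborel B = (\<integral>\<^sup>+x. indicator C x * (\<integral>\<^sup>+y. indicator B (x + y) \<partial>lborel) \<partial>M)"
      by (subst lt) (auto simp: nn_integral_multc)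
    also have "\<dots> = (\<integral>\<^sup>+x. \<integral>\<^sup>+y. indicator C x * indicator B (x + y) \<partial>lborel \<partial>M)"
      by (auto intro!: nn_integral_cong nn_integral_cmult[symmetric])
    also have "\<dots> = (\<integral>\<^sup>+y. \<integral>\<^sup>+x. indicator C x * indicator B (x + y) \<partial>M \<partial>lborel)"
      by (rule Fubini'[symmetric]) measurable
    also have "\<dots> = (\<integral>\<^sup>+y. \<integral>\<^sup>+x. indicator C (x - y) * indicator B x \<partial>M \<partial>lborel)"
    proof (rule nn_integral_cong)
      fix y :: 'a
      show "(\<integral>\<^sup>+x. indicator C x * indicator B (x + y) \<partial>M) = (\<integral>\<^sup>+x. indicator C (x - y) * (indicator B x :: ennreal) \<partial>M)"
        using Mt[of "\<lambda>x. indicator C (x - y) * indicator B x" y] by (simp add: add.commute)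
    qed
    also have "\<dots> = (\<integral>\<^sup>+x. \<integral>\<^sup>+y. indicator C (x - y) * indicator B x \<partial>lborel \<partial>M)"
      by (rule Fubini') measurable
    also have "\<dots> = (\<integral>\<^sup>+x. indicator B x \<partial>M)"
    proof (rule nn_integral_cong)
      fix x :: 'a
      have "(\<integral>\<^sup>+y. indicator C (x - y) * indicator B x \<partial>lborel) = (\<integral>\<^sup>+y. indicator C (x - y) \<partial>lborel) * (indicator B x :: ennreal)"
        by (rule nn_integral_multc) measurable
      also have "(\<integral>\<^sup>+y. indicator C (x - y) \<partial>lborel) = (1 :: ennreal)"
        using neg[of "indicator C" x] C by simp
      finally show "(\<integral>\<^sup>+y. indicator C (x - y) * indicator B x \<partial>lborel) = (indicator B x :: ennreal)" by simp
    qed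
    finally show ?thesis using B by (simp add: sets)
  qed
  then have "M = density lborel (\<lambda>_. emeasure M C)"
    by (intro measure_eqI) (auto simp: sets emeasure_density nn_integral_cmult)
  then show thesis by (rule that)
qed

text \<open>
  The factor is \<open>\<bar>det f\<bar>\<^sup>-\<^sup>1\<close>. When a probability density is transported, the total mass
  determines it.
\<close>

lemma lborel_distr_linear_bij:
  fixes f :: "'a::euclidean_space \<Rightarrow> 'a"
  assumes f: "linear f" and g: "linear g" and fg: "\<And>x. f (g x) = x" "\<And>x. g (f x) = x"
  obtains c where "distr lborel borel f = density lborel (\<lambda>_. c)"
proof (rule translation_invariant_measure_eq)
  have [measurable]: "f \<in> borel_measurable borel" "g \<in> borel_measurable borel"
    using f g by (auto intro!: borel_measurable_continuous_onI linear_continuous_on linear_conv_bounded_linear[THEN iffD1])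
  show "sets (distr lborel borel f) = sets borel" by simp
  show "sigma_finite_measure (distr lborel borel f)"
    by (rule sigma_finite_measure_distr[of _ lborel g])
       (auto simp: distr_distr o_def fg distr_id2 sigma_finite_lborel)
  fix t
  have "distr (distr lborel borel f) borel (\<lambda>x. t + x) = distr (distr lborel borel (\<lambda>x. g t + x)) borel f"
    by (simp add: distr_distr o_def linear_add[OF f] fg)
  then show "distr (distr lborel borel f) borel (\<lambda>x. t + x) = distr lborel borel f"
    by (simp add: lborel_distr_plus)
qed

text \<open>
  The factor of an involution squares to one.
\<close>

lemma lborel_distr_linear_involution:
  fixes f :: "'a::euclidean_space \<Rightarrow> 'a"
  assumes f: "linear f" and ff: "\<And>x. f (f x) = x"
  shows "distr lborel borel f = lborel"
proof -
  have [measurable]: "f \<in> borel_measurable borel"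
    using f by (auto intro!: borel_measurable_continuous_onI linear_continuous_on linear_conv_bounded_linear[THEN iffD1])
  obtain c where c: "distr lborel borel f = density lborel (\<lambda>_. c)"
    using lborel_distr_linear_bij[OF f f ff ff] .
  have "lborel = distr (distr lborel borel f) borel f" by (simp add: distr_distr o_def ff distr_id2)
  also have "\<dots> = density (distr lborel borel f) (\<lambda>_. c)"
    by (subst c, subst density_distr) auto
  also have "\<dots> = density lborel (\<lambda>_. c * c)" by (simp add: c density_density_eq)
  finally have "emeasure lborel (cbox 0 One :: 'a set) = emeasure (density lborel (\<lambda>_. c * c)) (cbox 0 One :: 'a set)" by simp
  then have "c * c = 1" by (simp add: emeasure_density nn_integral_cmult)
  have "c = 1"
  proof (cases c)
    case (real r)
    then have "r * r = 1" using \<open>c * c = 1\<close> by (simp add: ennreal_mult[symmetric] ennreal_eq_1)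
    then have "r = 1" using real by (simp add: square_eq_1_iff)
    then show ?thesis using real by simp
  qed (use \<open>c * c = 1\<close> in \<open>auto simp: ennreal_top_mult\<close>)
  then show ?thesis using c by (simp add: density_1)
qed

definition hyperplane_reflection :: "'a::real_inner \<Rightarrow> 'a \<Rightarrow> 'a" where
  "hyperplane_reflection u x = x - (2 * (u \<bullet> x) / (u \<bullet> u)) *\<^sub>R u"

lemma linear_hyperplane_reflection: "linear (hyperplane_reflection u)"
  by (rule linearI) (simp_all add: hyperplane_reflection_def inner_simps algebra_simps add_divide_distrib)

lemma inner_hyperplane_reflection:
  "hyperplane_reflection u x \<bullet> y = x \<bullet> y - 2 * (u \<bullet> x) * (u \<bullet> y) / (u \<bullet> u)"
  by (simp add: hyperplane_reflection_def inner_simps)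

lemma hyperplane_reflection_involution: "hyperplane_reflection u (hyperplane_reflection u x) = x"
  by (cases "u = 0") (simp_all add: hyperplane_reflection_def inner_simps)

lemma hyperplane_reflection_isometry: "hyperplane_reflection u x \<bullet> hyperplane_reflection u x = x \<bullet> x"
  by (cases "u = 0") (simp_all add: hyperplane_reflection_def inner_simps inner_commute)

text \<open>
  The reflection in the bisecting hyperplane of two unit vectors exchanges them.
\<close>

lemma hyperplane_reflection_swap:
  assumes "norm u = 1" "norm v = 1"
  shows "v \<bullet> hyperplane_reflection (u - v) x = u \<bullet> x"
proof (cases "u = v")
  case False
  have n: "u \<bullet> u = 1" "v \<bullet> v = 1" using assms by (auto simp: norm_eq_1)
  have e: "(u - v) \<bullet> (u - v) = 2 * (1 - u \<bullet> v)" using n by (simp add: inner_simps inner_commute)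
  have "(u - v) \<bullet> (u - v) \<noteq> 0" using False by simp
  then have "1 - u \<bullet> v \<noteq> 0" unfolding e by simp
  then show ?thesis
    using n unfolding hyperplane_reflection_def inner_simps e by (simp add: field_simps inner_simps inner_commute)
qed (simp add: hyperplane_reflection_def)

section \<open>Spherical measures\<close>

definition spherical_measure :: "(real \<Rightarrow> real) \<Rightarrow> 'a::euclidean_space measure" where
  "spherical_measure g = density lborel (\<lambda>x. ennreal (g (x \<bullet> x)))"

lemma sets_spherical_measure[simp, measurable_cong]: "sets (spherical_measure g) = sets borel"
  by (simp add: spherical_measure_def)

lemma space_spherical_measure[simp]: "space (spherical_measure g) = UNIV"
  by (simp add: spherical_measure_def)

text \<open>
  The generator is only known to be measurable after composition with \<open>x \<bullet> x\<close>; restricting to a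
  coordinate axis brings it back to the line.
\<close>

lemma borel_measurable_generator:
  assumes m: "(\<lambda>x::'a::euclidean_space. g (x \<bullet> x)) \<in> borel_measurable lborel"
  shows "(\<lambda>r. g (r\<^sup>2) :: real) \<in> borel_measurable borel"
proof -
  obtain e :: 'a where e: "e \<in> Basis" using nonempty_Basis by blast
  have "(\<lambda>r. g ((r *\<^sub>R e) \<bullet> (r *\<^sub>R e))) \<in> borel_measurable borel"
    using m by measurable
  then show ?thesis using e by (simp add: power2_eq_square)
qed

lemma distr_spherical_measure:
  fixes f :: "'a::euclidean_space \<Rightarrow> 'a"
  assumes m[measurable]: "(\<lambda>x::'a. g (x \<bullet> x)) \<in> borel_measurable lborel"
    and f: "linear f" "\<And>x. f (f x) = x" "\<And>x. f x \<bullet> f x = x \<bullet> x"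
  shows "distr (spherical_measure g) borel f = spherical_measure g"
proof -
  have [measurable]: "f \<in> borel_measurable borel"
    using f by (auto intro!: borel_measurable_continuous_onI linear_continuous_on linear_conv_bounded_linear[THEN iffD1])
  have "spherical_measure g = density (distr lborel borel f) (\<lambda>x. ennreal (g (x \<bullet> x)))"
    unfolding spherical_measure_def lborel_distr_linear_involution[OF f(1,2)] ..
  also have "\<dots> = distr (spherical_measure g) borel f"
    unfolding spherical_measure_def by (subst density_distr) (simp_all add: f(3))
  finally show ?thesis ..
qed

text \<open>
  All one-dimensional projections agree, because a reflection carries one unit vector to any other.
\<close>

lemma distr_spherical_inner:
  fixes u v :: "'a::euclidean_space"
  assumes m[measurable]: "(\<lambda>x::'a. g (x \<bullet> x)) \<in> borel_measurable lborel"
    and uv: "norm u = 1" "norm v = 1"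
  shows "distr (spherical_measure g) borel (\<lambda>x. u \<bullet> x) = distr (spherical_measure g) borel (\<lambda>x. v \<bullet> x)"
proof -
  have [measurable]: "hyperplane_reflection (u - v) \<in> borel_measurable borel"
    using linear_hyperplane_reflection
    by (auto intro!: borel_measurable_continuous_onI linear_continuous_on linear_conv_bounded_linear[THEN iffD1])
  have "distr (spherical_measure g) borel (\<lambda>x. v \<bullet> x)
    = distr (distr (spherical_measure g) borel (hyperplane_reflection (u - v))) borel (\<lambda>x. v \<bullet> x)"
    by (subst distr_spherical_measure[OF m])
      (simp_all add: linear_hyperplane_reflection hyperplane_reflection_involution hyperplane_reflection_isometry)
  also have "\<dots> = distr (spherical_measure g) borel (\<lambda>x. u \<bullet> x)"
    by (subst distr_distr) (auto simp: o_def hyperplane_reflection_swap[OF uv])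
  finally show ?thesis ..
qed

lemma nn_integral_scaleR:
  fixes f :: "'a::euclidean_space \<Rightarrow> ennreal"
  assumes [measurable]: "f \<in> borel_measurable borel" and "0 < t"
  shows "(\<integral>\<^sup>+x. f x \<partial>lborel) = ennreal (t ^ DIM('a)) * (\<integral>\<^sup>+x. f (t *\<^sub>R x) \<partial>lborel)"
proof -
  have "(\<integral>\<^sup>+x. f x \<partial>lborel) = (\<integral>\<^sup>+x. f x \<partial>density (distr lborel borel (\<lambda>x. 0 + t *\<^sub>R x)) (\<lambda>_. ennreal (\<bar>t\<bar> ^ DIM('a))))"
    using lborel_affine[of t "0::'a"] assms(2) by simp
  also have "\<dots> = (\<integral>\<^sup>+x. ennreal (t ^ DIM('a)) * f (t *\<^sub>R x) \<partial>lborel)"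
    using assms(2) by (simp add: nn_integral_density nn_integral_distr)
  finally show ?thesis by (simp add: nn_integral_cmult)
qed

text \<open>
  Integration in polar coordinates, for integrands whose angular part \<open>H\<close> is homogeneous of degree
  \<open>p\<close>. Weighted by \<open>H\<close>, the ball of radius \<open>t\<close> has mass \<open>t ^ (DIM + p) * K\<close> by scaling, and the masses
  of balls determine the law of the norm. So the surface measure enters through the
  constant \<open>K\<close> only, an integral over the unit ball.
\<close>

lemma nn_integral_homogeneous_radial:
  fixes H :: "'a::euclidean_space \<Rightarrow> real" and p :: nat and G :: "real \<Rightarrow> ennreal"
  assumes [measurable]: "H \<in> borel_measurable borel" "G \<in> borel_measurable borel"
    and H: "\<And>x. 0 \<le> H x" "\<And>t x. 0 < t \<Longrightarrow> H (t *\<^sub>R x) = t ^ p * H x"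
    and K: "(\<integral>\<^sup>+x. ennreal (H x) * indicator (ball 0 1) x \<partial>lborel) = ennreal K" "0 \<le> K"
  shows "(\<integral>\<^sup>+x. ennreal (H x) * G (norm x) \<partial>lborel) =
    (\<integral>\<^sup>+r. ennreal (real (DIM('a) + p) * K * r ^ (DIM('a) + p - 1)) * G r * indicator {0<..} r \<partial>lborel)"
proof -
  define n where "n = DIM('a) + p"
  have n: "0 < n" by (simp add: n_def)
  have [measurable]: "ball (0::'a) t \<in> sets borel" for t by simp
  \<comment> \<open>The sign turns balls into the upper rays that determine a measure on the line.\<close>
  define M1 where "M1 = distr (density lborel (\<lambda>x. ennreal (H x))) borel (\<lambda>x. - norm x)"
  define M2 where "M2 = distr (density lborel (\<lambda>r. ennreal (real n * K * r ^ (n - 1)) * indicator {0<..} r)) borel (\<lambda>r::real. - r)"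
  have M1: "emeasure M1 {t<..} = ennreal (if t < 0 then (- t) ^ n * K else 0)" for t
  proof -
    have "emeasure M1 {t<..} = (\<integral>\<^sup>+x. ennreal (H x) * indicator (ball 0 (- t)) x \<partial>lborel)"
    proof -
      have "(\<lambda>x::'a. - norm x) -` {t<..} = ball 0 (- t)" by auto
      then show ?thesis unfolding M1_def by (simp add: emeasure_distr emeasure_density)
    qed
    also have "\<dots> = ennreal (if t < 0 then (- t) ^ n * K else 0)"
    proof (cases "t < 0")
      case True
      have "(\<integral>\<^sup>+x. ennreal (H x) * indicator (ball 0 (- t)) x \<partial>lborel)
        = ennreal ((- t) ^ DIM('a)) * (\<integral>\<^sup>+x. ennreal (H ((- t) *\<^sub>R x)) * indicator (ball 0 (- t)) ((- t) *\<^sub>R x) \<partial>lborel)"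
      proof (rule nn_integral_scaleR)
        show "(\<lambda>x. ennreal (H x) * indicator (ball 0 (- t)) x) \<in> borel_measurable borel" by measurable
        show "0 < - t" using True by simp
      qed
      also have "(\<integral>\<^sup>+x. ennreal (H ((- t) *\<^sub>R x)) * indicator (ball 0 (- t)) ((- t) *\<^sub>R x) \<partial>lborel)
        = (\<integral>\<^sup>+x. ennreal ((- t) ^ p) * (ennreal (H x) * indicator (ball 0 1) x) \<partial>lborel)"
      proof (rule nn_integral_cong)
        fix x :: 'a
        have "ennreal (H ((- t) *\<^sub>R x)) = ennreal ((- t) ^ p) * ennreal (H x)"
          using H(2)[of "- t" x] True H(1)[of x] by (simp add: ennreal_mult)
        moreover have "(- t) *\<^sub>R x \<in> ball 0 (- t) \<longleftrightarrow> x \<in> ball 0 1"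
          using True by (simp add: mult_less_cancel_left)
        ultimately show "ennreal (H ((- t) *\<^sub>R x)) * indicator (ball 0 (- t)) ((- t) *\<^sub>R x)
          = ennreal ((- t) ^ p) * (ennreal (H x) * indicator (ball 0 1) x)"
          by (simp add: indicator_def ac_simps)
      qed
      also have "\<dots> = ennreal ((- t) ^ p) * ennreal K" by (simp add: nn_integral_cmult K)
      finally show ?thesis using True K(2) by (simp add: n_def power_add ennreal_mult mult.assoc)
    qed (simp add: ball_empty)
    finally show ?thesis .
  qed
  have M2: "emeasure M2 {t<..} = ennreal (if t < 0 then (- t) ^ n * K else 0)" for t
  proof -
    have "emeasure M2 {t<..} = (\<integral>\<^sup>+r. ennreal (real n * K * r ^ (n - 1)) * indicator {0..- t} r \<partial>lborel)"
    proof -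
      have "uminus -` {t<..} = {..<- t}" by auto
      then have "emeasure M2 {t<..} = (\<integral>\<^sup>+r. ennreal (real n * K * r ^ (n - 1)) * indicator {0<..} r * indicator {..<- t} r \<partial>lborel)"
        unfolding M2_def by (simp add: emeasure_distr emeasure_density)
      also have "\<dots> = (\<integral>\<^sup>+r. ennreal (real n * K * r ^ (n - 1)) * indicator {0..- t} r \<partial>lborel)"
      proof (rule nn_integral_cong_AE)
        show "AE r in lborel. ennreal (real n * K * r ^ (n - 1)) * indicator {0<..} r * indicator {..<- t} r
          = ennreal (real n * K * r ^ (n - 1)) * indicator {0..- t} r"
          using AE_lborel_singleton[of 0] AE_lborel_singleton[of "- t"]
          by eventually_elim (auto simp: indicator_def)
      qed
      finally show ?thesis .
    qed
    also have "\<dots> = ennreal (if t < 0 then (- t) ^ n * K else 0)"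
    proof (cases "t < 0")
      case True
      have "(\<integral>\<^sup>+r. ennreal (real n * K * r ^ (n - 1)) * indicator {0..- t} r \<partial>lborel) = ennreal (K * (- t) ^ n - K * 0 ^ n)"
        by (rule nn_integral_FTC_Icc) (use True K n in \<open>auto intro!: derivative_eq_intros\<close>)
      then show ?thesis using True n by (simp add: ac_simps zero_power)
    next
      case False
      have "(\<integral>\<^sup>+r. ennreal (real n * K * r ^ (n - 1)) * indicator {0..- t} r \<partial>lborel) = (\<integral>\<^sup>+(r::real). 0 \<partial>lborel)"
      proof (rule nn_integral_cong_AE)
        show "AE r in lborel. ennreal (real n * K * r ^ (n - 1)) * indicator {0..- t} r = 0"
          using AE_lborel_singleton[of 0] by eventually_elim (use False in \<open>auto simp: indicator_def\<close>)
      qed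
      then show ?thesis using False by simp
    qed
    finally show ?thesis .
  qed
  have "M1 = M2"
    by (rule measure_eqI_lessThan) (auto simp: M1 M2, auto simp: M1_def M2_def)
  then have "(\<integral>\<^sup>+s. G (- s) \<partial>M1) = (\<integral>\<^sup>+s. G (- s) \<partial>M2)" by simp
  then show ?thesis unfolding M1_def M2_def n_def
    by (simp add: nn_integral_distr nn_integral_density ac_simps)
qed

text \<open>
  The case of degree \<open>0\<close>, where the constant is the volume of the unit ball.
\<close>

lemma distr_spherical_norm:
  assumes m[measurable]: "(\<lambda>x::'a::euclidean_space. g (x \<bullet> x)) \<in> borel_measurable lborel"
    and dim: "DIM('a) = k + 1"
  shows "distr (spherical_measure g :: 'a measure) borel norm = density lborel (\<lambda>r. ennreal (radial_density k g r))"
proof (rule measure_eqI)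
  fix A assume "A \<in> sets (distr (spherical_measure g :: 'a measure) borel norm)"
  then have [measurable]: "A \<in> sets borel" by simp
  have gm[measurable]: "(\<lambda>r. g (r\<^sup>2)) \<in> borel_measurable borel" by (rule borel_measurable_generator[OF m])
  have [measurable]: "radial_density k g \<in> borel_measurable borel"
    unfolding radial_density_def[abs_def] by measurable
  define K where "K = unit_ball_vol (real (k + 1))"
  have K: "real (k + 1) * K = 2 * pi powr ((real k + 1) / 2) / Gamma ((real k + 1) / 2)"
  proof -
    define c where "c = (real k + 1) / 2"
    have c: "0 < c" "real (k + 1) = 2 * c" "real (k + 1) / 2 = c" by (simp_all add: c_def)
    have "Gamma (c + 1) = c * Gamma c" using c(1) by (intro Gamma_plus1) (auto elim!: nonpos_Ints_cases)
    moreover have "0 < Gamma c" using c(1) by (rule Gamma_real_pos)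
    ultimately show ?thesis unfolding K_def unit_ball_vol_def c_def[symmetric] c(2,3) using c(1) by simp
  qed
  have [measurable]: "(norm :: 'a \<Rightarrow> real) -` A \<in> sets borel"
    using measurable_sets[of norm "borel :: 'a measure" borel A] by simp
  have "emeasure (distr (spherical_measure g :: 'a measure) borel norm) A
    = (\<integral>\<^sup>+(x::'a). ennreal 1 * (ennreal (g ((norm x)\<^sup>2)) * indicator A (norm x)) \<partial>lborel)"
    unfolding spherical_measure_def
    by (simp add: emeasure_distr emeasure_density power2_norm_eq_inner)
       (auto intro!: nn_integral_cong simp: indicator_def)
  also have "\<dots> = (\<integral>\<^sup>+r. ennreal (real (DIM('a) + 0) * K * r ^ (DIM('a) + 0 - 1)) *
      (ennreal (g (r\<^sup>2)) * indicator A r) * indicator {0<..} r \<partial>lborel)"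
    by (rule nn_integral_homogeneous_radial) (auto simp: emeasure_ball K_def dim)
  also have "\<dots> = (\<integral>\<^sup>+r. ennreal (radial_density k g r) * indicator A r \<partial>lborel)"
  proof (rule nn_integral_cong)
    fix r :: real
    have "ennreal (real (DIM('a) + 0) * K * r ^ (DIM('a) + 0 - 1)) * ennreal (g (r\<^sup>2)) = ennreal (radial_density k g r)" if "0 < r"
    proof -
      have "0 \<le> real (k + 1) * K" by (simp add: K_def)
      then have "ennreal (real (k + 1) * K * r ^ k) * ennreal (g (r\<^sup>2)) = ennreal (real (k + 1) * K * r ^ k * g (r\<^sup>2))"
        using that by (intro ennreal_mult'[symmetric]) auto
      then show ?thesis using that K by (simp add: radial_density_def dim)
    qed
    then show "ennreal (real (DIM('a) + 0) * K * r ^ (DIM('a) + 0 - 1)) * (ennreal (g (r\<^sup>2)) * indicator A r) * indicator {0<..} r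
      = ennreal (radial_density k g r) * indicator A r"
      by (cases "0 < r") (auto simp: radial_density_def indicator_def)
  qed
  also have "\<dots> = emeasure (density lborel (\<lambda>r. ennreal (radial_density k g r))) A"
    by (simp add: emeasure_density)
  finally show "emeasure (distr (spherical_measure g :: 'a measure) borel norm) A = emeasure (density lborel (\<lambda>r. ennreal (radial_density k g r))) A" .
qed simp

lemma nn_integral_abs_sqrt_power:
  "(\<integral>\<^sup>+r. ennreal (\<bar>r\<bar> * sqrt (1 - r\<^sup>2) ^ k) * indicator {-1..1} r \<partial>lborel) = ennreal (2 / (real k + 2))"
proof -
  define f where "f r = r * sqrt (1 - r\<^sup>2) ^ k" for r :: real
  define F where "F r = - (sqrt (1 - r\<^sup>2) ^ (k + 2)) / (real k + 2)" for r :: real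
  have "(f has_integral (F 1 - F 0)) {0..1}"
  proof (rule fundamental_theorem_of_calculus_interior)
    show "continuous_on {0..1} F" unfolding F_def by (intro continuous_intros) auto
    fix r :: real assume r: "r \<in> {0<..<1}"
    then have "r\<^sup>2 < 1" by (simp add: power_less_one_iff abs_square_less_1)
    then have p: "0 < 1 - r\<^sup>2" by simp
    have "((\<lambda>r. sqrt (1 - r\<^sup>2)) has_real_derivative - r / sqrt (1 - r\<^sup>2)) (at r)"
      using p by (auto intro!: derivative_eq_intros simp: field_simps)
    from DERIV_cdivide[OF DERIV_minus[OF DERIV_power[OF this, of "k + 2"]], of "real k + 2"]
    have "(F has_real_derivative - (real (k + 2) * (- r / sqrt (1 - r\<^sup>2) * sqrt (1 - r\<^sup>2) ^ (k + 1))) / (real k + 2)) (at r)"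
      unfolding F_def by simp
    also have "- (real (k + 2) * (- r / sqrt (1 - r\<^sup>2) * sqrt (1 - r\<^sup>2) ^ (k + 1))) / (real k + 2) = f r"
      using p by (simp add: f_def add.commute)
    finally show "(F has_vector_derivative f r) (at r)"
      by (simp add: has_real_derivative_iff_has_vector_derivative)
  qed simp
  moreover have "F 1 - F 0 = 1 / (real k + 2)" by (simp add: F_def)
  ultimately have "(f has_integral (1 / (real k + 2))) {0..1}" by simp
  then have I: "(\<integral>\<^sup>+r. ennreal (f r) * indicator {0..1} r \<partial>lborel) = ennreal (1 / (real k + 2))"
    by (rule nn_integral_has_integral_lebesgue'[rotated]) (auto simp: f_def abs_square_le_1)
  have "(\<integral>\<^sup>+r. ennreal (\<bar>r\<bar> * sqrt (1 - r\<^sup>2) ^ k) * indicator {-1..1} r \<partial>lborel)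
    = (\<integral>\<^sup>+r. ennreal (f r) * indicator {0..1} r + ennreal (f (- r)) * indicator {0..1} (- r) \<partial>lborel)"
    by (intro nn_integral_cong) (auto simp: indicator_def f_def)
  also have "\<dots> = (\<integral>\<^sup>+r. ennreal (f r) * indicator {0..1} r \<partial>lborel) + (\<integral>\<^sup>+r. ennreal (f (- r)) * indicator {0..1} (- r) \<partial>lborel)"
    by (rule nn_integral_add) (auto simp: f_def[abs_def])
  also have "(\<integral>\<^sup>+r. ennreal (f (- r)) * indicator {0..1} (- r) \<partial>lborel) = (\<integral>\<^sup>+r. ennreal (f r) * indicator {0..1} r \<partial>lborel)"
    by (subst (2) lborel_distr_uminus[symmetric], subst nn_integral_distr) (auto simp: f_def[abs_def])
  finally show ?thesis unfolding I by (simp add: ennreal_plus[symmetric] del: ennreal_plus)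
qed

text \<open>
  Slicing the unit ball at height \<open>r\<close> gives balls of radius \<open>sqrt (1 - r\<^sup>2)\<close>.
\<close>

lemma nn_integral_abs_snd_ball:
  "(\<integral>\<^sup>+x. ennreal \<bar>snd (x :: 'a::euclidean_space \<times> real)\<bar> * indicator (ball 0 1) x \<partial>lborel)
     = ennreal (2 * unit_ball_vol (real DIM('a)) / (real DIM('a) + 2))"
proof -
  let ?k = "DIM('a)"
  have [measurable]: "ball (0::'a \<times> real) 1 \<in> sets (borel \<Otimes>\<^sub>M borel)"
    unfolding borel_prod by simp
  have "(\<integral>\<^sup>+x. ennreal \<bar>snd (x :: 'a \<times> real)\<bar> * indicator (ball 0 1) x \<partial>lborel)
    = (\<integral>\<^sup>+r. \<integral>\<^sup>+z. ennreal \<bar>r\<bar> * indicator (ball 0 1) (z :: 'a, r) \<partial>lborel \<partial>lborel)"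
    unfolding lborel_prod[symmetric]
    by (subst lborel_pair.nn_integral_snd[symmetric]) auto
  also have "\<dots> = (\<integral>\<^sup>+r. ennreal (unit_ball_vol (real ?k)) * (ennreal (\<bar>r\<bar> * sqrt (1 - r\<^sup>2) ^ ?k) * indicator {-1..1} r) \<partial>lborel)"
  proof (rule nn_integral_cong)
    fix r :: real
    have "(\<integral>\<^sup>+z. ennreal \<bar>r\<bar> * indicator (ball 0 1) (z :: 'a, r) \<partial>lborel)
      = ennreal \<bar>r\<bar> * (\<integral>\<^sup>+z. indicator (ball 0 (sqrt (1 - r\<^sup>2))) (z :: 'a) \<partial>lborel)"
    proof (subst nn_integral_cmult[symmetric])
      show "indicator (ball (0::'a) (sqrt (1 - r\<^sup>2))) \<in> borel_measurable lborel"
        by (intro borel_measurable_indicator) simp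
      have "norm (z, r) < 1 \<longleftrightarrow> norm z < sqrt (1 - r\<^sup>2)" for z :: 'a
      proof -
        have "norm (z, r) < 1 \<longleftrightarrow> (norm z)\<^sup>2 + r\<^sup>2 < 1" by (simp add: norm_prod_def)
        also have "\<dots> \<longleftrightarrow> (norm z)\<^sup>2 < 1 - r\<^sup>2" by auto
        also have "\<dots> \<longleftrightarrow> norm z < sqrt (1 - r\<^sup>2)"
          using real_sqrt_less_iff[of "(norm z)\<^sup>2" "1 - r\<^sup>2"] by simp
        finally show ?thesis .
      qed
      then show "(\<integral>\<^sup>+z. ennreal \<bar>r\<bar> * indicator (ball 0 1) (z :: 'a, r) \<partial>lborel)
        = (\<integral>\<^sup>+z. ennreal \<bar>r\<bar> * indicator (ball 0 (sqrt (1 - r\<^sup>2))) (z :: 'a) \<partial>lborel)"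
        by (intro nn_integral_cong) (auto simp: indicator_def)
    qed
    also have "\<dots> = ennreal (unit_ball_vol (real ?k)) * (ennreal (\<bar>r\<bar> * sqrt (1 - r\<^sup>2) ^ ?k) * indicator {-1..1} r)"
    proof (cases "r \<in> {-1..1}")
      case True
      then have "0 \<le> 1 - r\<^sup>2" by (simp add: abs_square_le_1 abs_le_iff)
      then show ?thesis using True by (simp add: emeasure_ball ennreal_mult ac_simps)
    next
      case False
      then have "sqrt (1 - r\<^sup>2) < 0" by (auto simp: abs_square_le_1 abs_le_iff not_le[symmetric])
      then show ?thesis using False by (simp add: ball_empty)
    qed
    finally show "(\<integral>\<^sup>+z. ennreal \<bar>r\<bar> * indicator (ball 0 1) (z :: 'a, r) \<partial>lborel) = \<dots>" .
  qed
  also have "\<dots> = ennreal (unit_ball_vol (real ?k)) * ennreal (2 / (real ?k + 2))"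
    by (subst nn_integral_cmult) (auto simp: nn_integral_abs_sqrt_power)
  finally show ?thesis by (simp add: ennreal_mult[symmetric])
qed

text \<open>
  The case of degree \<open>1\<close>. The ratio of the two first absolute moments depends on the dimension only,
  as \<open>\<bar>snd x\<bar> / norm x\<close> is a function of the direction.
\<close>

lemma nn_integral_abs_snd_spherical:
  fixes g :: "real \<Rightarrow> real"
  defines "k \<equiv> DIM('a)"
  assumes m[measurable]: "(\<lambda>x::'a::euclidean_space \<times> real. g (x \<bullet> x)) \<in> borel_measurable lborel"
  shows "(\<integral>\<^sup>+x. ennreal \<bar>snd x\<bar> \<partial>(spherical_measure g :: ('a \<times> real) measure))
    = ennreal (Gamma ((real k + 1) / 2) / (sqrt pi * Gamma (real k / 2 + 1)))
      * (\<integral>\<^sup>+x. ennreal (norm x) \<partial>(spherical_measure g :: ('a \<times> real) measure))"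
proof -
  have gm[measurable]: "(\<lambda>r. g (r\<^sup>2)) \<in> borel_measurable borel" by (rule borel_measurable_generator[OF m])
  have [measurable]: "radial_density k g \<in> borel_measurable borel"
    unfolding radial_density_def[abs_def] by measurable
  have [measurable]: "(\<lambda>x::'a \<times> real. \<bar>snd x\<bar>) \<in> borel_measurable borel"
    by (intro borel_measurable_continuous_onI continuous_intros)
  define \<kappa> where "\<kappa> = Gamma ((real k + 1) / 2) / (sqrt pi * Gamma (real k / 2 + 1))"
  define K where "K = 2 * unit_ball_vol (real k) / (real k + 2)"
  have dim: "DIM('a \<times> real) = k + 1" by (simp add: k_def)
  have G: "0 < Gamma ((real k + 1) / 2)" "0 < Gamma (real k / 2 + 1)" by (auto intro!: Gamma_real_pos)
  have \<kappa>: "0 \<le> \<kappa>" using G by (simp add: \<kappa>_def)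
  have coeff: "real (k + 2) * K = \<kappa> * (2 * pi powr ((real k + 1) / 2) / Gamma ((real k + 1) / 2))"
  proof -
    have "pi powr ((real k + 1) / 2) = pi powr (real k / 2) * sqrt pi"
      by (simp add: add_divide_distrib powr_add powr_half_sqrt)
    moreover have "real (k + 2) = real k + 2" "real k + 2 \<noteq> 0" by simp_all
    ultimately show ?thesis using G[THEN less_imp_neq] unfolding K_def \<kappa>_def unit_ball_vol_def by (simp add: add.commute)
  qed
  have "(\<integral>\<^sup>+x. ennreal \<bar>snd x\<bar> \<partial>(spherical_measure g :: ('a \<times> real) measure))
    = (\<integral>\<^sup>+(x::'a \<times> real). ennreal \<bar>snd x\<bar> * ennreal (g ((norm x)\<^sup>2)) \<partial>lborel)"
    unfolding spherical_measure_def
    by (subst nn_integral_density) (auto intro!: nn_integral_cong simp: power2_norm_eq_inner ac_simps)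
  also have "\<dots> = (\<integral>\<^sup>+r. ennreal (real (DIM('a \<times> real) + 1) * K * r ^ (DIM('a \<times> real) + 1 - 1)) * ennreal (g (r\<^sup>2)) * indicator {0<..} r \<partial>lborel)"
  proof (rule nn_integral_homogeneous_radial)
    show "(\<integral>\<^sup>+(x::'a \<times> real). ennreal \<bar>snd x\<bar> * indicator (ball 0 1) x \<partial>lborel) = ennreal K"
      unfolding K_def k_def by (rule nn_integral_abs_snd_ball)
  qed (auto simp: abs_mult K_def)
  also have "\<dots> = (\<integral>\<^sup>+r. ennreal \<kappa> * (ennreal (radial_density k g r) * ennreal r) \<partial>lborel)"
  proof (rule nn_integral_cong)
    fix r :: real
    show "ennreal (real (DIM('a \<times> real) + 1) * K * r ^ (DIM('a \<times> real) + 1 - 1)) * ennreal (g (r\<^sup>2)) * indicator {0<..} r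
      = ennreal \<kappa> * (ennreal (radial_density k g r) * ennreal r)"
    proof (cases "0 < r")
      case True
      have "0 \<le> real (k + 2) * K" by (simp add: K_def)
      then have "ennreal (real (k + 2) * K * r ^ (k + 1)) * ennreal (g (r\<^sup>2)) = ennreal (real (k + 2) * K * r ^ (k + 1) * g (r\<^sup>2))"
        using True by (intro ennreal_mult'[symmetric]) auto
      also have "real (k + 2) * K * r ^ (k + 1) * g (r\<^sup>2) = \<kappa> * (radial_density k g r * r)"
        using True unfolding coeff radial_density_def by simp
      also have "ennreal (\<kappa> * (radial_density k g r * r)) = ennreal \<kappa> * (ennreal (radial_density k g r) * ennreal r)"
        using \<kappa> True by (simp add: ennreal_mult' ennreal_mult'')
      finally show ?thesis using True by (simp add: k_def)
    qed (simp add: radial_density_def)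
  qed
  also have "\<dots> = ennreal \<kappa> * (\<integral>\<^sup>+r. ennreal r \<partial>density lborel (\<lambda>r. ennreal (radial_density k g r)))"
    by (simp add: nn_integral_cmult nn_integral_density)
  also have "(\<integral>\<^sup>+r. ennreal r \<partial>density lborel (\<lambda>r. ennreal (radial_density k g r)))
    = (\<integral>\<^sup>+x. ennreal (norm x) \<partial>(spherical_measure g :: ('a \<times> real) measure))"
    unfolding distr_spherical_norm[OF m dim, symmetric] by (simp add: nn_integral_distr)
  finally show ?thesis unfolding \<kappa>_def .
qed

lemma AE_inner_neq_0:
  fixes v :: "'a::euclidean_space"
  assumes "v \<noteq> 0" shows "AE x in lborel. v \<bullet> x \<noteq> 0"
proof (rule AE_I')
  have "closed {x. v \<bullet> x = 0}" by (intro closed_Collect_eq continuous_intros)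
  then have m: "{x. v \<bullet> x = 0} \<in> sets lborel" by simp
  have "negligible {x. v \<bullet> x = 0}" using assms by (intro negligible_hyperplane) auto
  then show "{x. v \<bullet> x = 0} \<in> null_sets lborel"
    using m by (auto simp: negligible_iff_null_sets null_sets_def)
qed auto

text \<open>
  For a law that is symmetric about the origin and does not charge the boundary hyperplane, this is the
  conditional law given the half-space.
\<close>

definition doubled_half :: "'b::real_inner measure \<Rightarrow> 'b \<Rightarrow> 'b measure" where
  "doubled_half P v = density P (\<lambda>x. 2 * indicator {x. 0 \<le> v \<bullet> x} x)"

context
  fixes g :: "real \<Rightarrow> real" and S :: "('a::euclidean_space \<times> real) measure"
  assumes gen: "spherical_generator TYPE('a \<times> real) g"
  defines "S \<equiv> spherical_measure g"
begin

lemma measurable_spherical_generator: "(\<lambda>x::'a \<times> real. g (x \<bullet> x)) \<in> borel_measurable lborel"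
  using gen by (simp add: spherical_generator_def)

lemma sets_spherical[measurable_cong]: "sets S = sets borel" and space_spherical: "space S = UNIV"
  by (simp_all add: S_def)

lemma measurable_inner_spherical[measurable]: "(\<lambda>x. w \<bullet> x) \<in> borel_measurable S" for w :: "'a \<times> real"
  by (simp add: measurable_cong_sets[OF sets_spherical refl])

lemma measurable_snd_spherical[measurable]: "snd \<in> borel_measurable S"
proof -
  have "(\<lambda>x. (0, 1) \<bullet> x) \<in> borel_measurable S" by measurable
  then show ?thesis by (simp add: inner_prod_def)
qed

lemma prob_space_spherical: "prob_space S"
proof
  show "emeasure S (space S) = 1"
    using gen unfolding S_def spherical_measure_def spherical_generator_def
    by (simp add: emeasure_density)
qed

interpretation S: prob_space S by (rule prob_space_spherical)

lemma AE_spherical_inner_neq_0: "v \<noteq> 0 \<Longrightarrow> AE x in S. v \<bullet> x \<noteq> 0"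
  using AE_inner_neq_0[of v] measurable_spherical_generator unfolding S_def spherical_measure_def
  by (subst AE_density) auto

lemma spherical_distr_uminus: "distr S borel uminus = S"
  unfolding S_def by (rule distr_spherical_measure[OF measurable_spherical_generator]) (auto intro!: linearI)

lemma spherical_distr_reflection: "distr S borel (hyperplane_reflection v) = S"
  unfolding S_def
  by (rule distr_spherical_measure[OF measurable_spherical_generator])
     (simp_all add: linear_hyperplane_reflection hyperplane_reflection_involution hyperplane_reflection_isometry)

lemma measurable_uminus_spherical[measurable]: "uminus \<in> measurable S borel"
  by (simp add: measurable_cong_sets[OF sets_spherical refl])

lemma measurable_reflection_spherical[measurable]: "hyperplane_reflection v \<in> measurable S borel"
proof -
  have "hyperplane_reflection v \<in> borel_measurable borel"
    using linear_hyperplane_reflection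
    by (auto intro!: borel_measurable_continuous_onI linear_continuous_on linear_conv_bounded_linear[THEN iffD1])
  then show ?thesis by (simp add: measurable_cong_sets[OF sets_spherical refl])
qed

lemma spherical_distr_inner_snd:
  assumes "norm u = 1" shows "distr S borel (\<lambda>x. u \<bullet> x) = distr S borel snd"
proof -
  have "distr S borel (\<lambda>x. u \<bullet> x) = distr S borel (\<lambda>x. (0, 1) \<bullet> x)"
    unfolding S_def by (rule distr_spherical_inner[OF measurable_spherical_generator assms]) (simp add: norm_prod_def)
  then show ?thesis by (simp add: inner_prod_def)
qed

lemma spherical_nn_integral_inner:
  assumes "norm u = 1" and [measurable]: "H \<in> borel_measurable borel"
  shows "(\<integral>\<^sup>+x. H (u \<bullet> x) \<partial>S) = (\<integral>\<^sup>+x. H (snd x) \<partial>S)"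
proof -
  have "(\<integral>\<^sup>+x. H (u \<bullet> x) \<partial>S) = (\<integral>\<^sup>+r. H r \<partial>distr S borel (\<lambda>x. u \<bullet> x))" by (simp add: nn_integral_distr)
  also have "\<dots> = (\<integral>\<^sup>+x. H (snd x) \<partial>S)" unfolding spherical_distr_inner_snd[OF assms(1)] by (simp add: nn_integral_distr)
  finally show ?thesis .
qed

lemma spherical_integral_inner:
  fixes H :: "real \<Rightarrow> real"
  assumes "norm u = 1" and [measurable]: "H \<in> borel_measurable borel"
  shows "(\<integral>x. H (u \<bullet> x) \<partial>S) = (\<integral>x. H (snd x) \<partial>S)"
proof -
  have "(\<integral>x. H (u \<bullet> x) \<partial>S) = (\<integral>r. H r \<partial>distr S borel (\<lambda>x. u \<bullet> x))" by (simp add: integral_distr)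
  also have "\<dots> = (\<integral>x. H (snd x) \<partial>S)" unfolding spherical_distr_inner_snd[OF assms(1)] by (simp add: integral_distr)
  finally show ?thesis .
qed

lemma spherical_second_moment_inner:
  "(\<integral>\<^sup>+x. ennreal ((w \<bullet> x)\<^sup>2) \<partial>S) = ennreal (w \<bullet> w) * (\<integral>\<^sup>+x. ennreal ((snd x)\<^sup>2) \<partial>S)"
proof (cases "w = 0")
  case False
  define u where "u = w /\<^sub>R norm w"
  have u: "norm u = 1" "w = norm w *\<^sub>R u" using False by (auto simp: u_def)
  have "(\<integral>\<^sup>+x. ennreal ((w \<bullet> x)\<^sup>2) \<partial>S) = (\<integral>\<^sup>+x. ennreal (w \<bullet> w) * ennreal ((u \<bullet> x)\<^sup>2) \<partial>S)"
    by (subst (1) u(2)) (simp add: power_mult_distrib power2_norm_eq_inner ennreal_mult)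
  also have "\<dots> = ennreal (w \<bullet> w) * (\<integral>\<^sup>+x. ennreal ((u \<bullet> x)\<^sup>2) \<partial>S)"
    by (rule nn_integral_cmult) measurable
  also have "(\<integral>\<^sup>+x. ennreal ((u \<bullet> x)\<^sup>2) \<partial>S) = (\<integral>\<^sup>+x. ennreal ((snd x)\<^sup>2) \<partial>S)"
    by (rule spherical_nn_integral_inner[OF u(1)]) measurable
  finally show ?thesis .
qed simp

lemma spherical_second_moment_norm:
  "(\<integral>\<^sup>+x. ennreal ((norm x)\<^sup>2) \<partial>S) = ennreal (real DIM('a) + 1) * (\<integral>\<^sup>+x. ennreal ((snd x)\<^sup>2) \<partial>S)"
proof -
  have "(\<integral>\<^sup>+x. ennreal ((norm x)\<^sup>2) \<partial>S) = (\<integral>\<^sup>+x. (\<Sum>b\<in>Basis. ennreal ((b \<bullet> x)\<^sup>2)) \<partial>S)"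
  proof (rule nn_integral_cong)
    fix x :: "'a \<times> real"
    have "(norm x)\<^sup>2 = (\<Sum>b\<in>Basis. (b \<bullet> x)\<^sup>2)"
      unfolding power2_norm_eq_inner by (subst euclidean_inner) (simp add: power2_eq_square inner_commute)
    then show "ennreal ((norm x)\<^sup>2) = (\<Sum>b\<in>Basis. ennreal ((b \<bullet> x)\<^sup>2))" by simp
  qed
  also have "\<dots> = (\<Sum>b\<in>Basis. (\<integral>\<^sup>+x. ennreal ((b \<bullet> x)\<^sup>2) \<partial>S))"
    by (rule nn_integral_sum) measurable
  also have "\<dots> = (\<Sum>b\<in>(Basis :: ('a \<times> real) set). (\<integral>\<^sup>+x. ennreal ((snd x)\<^sup>2) \<partial>S))"
    by (intro sum.cong refl) (simp add: spherical_second_moment_inner)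
  finally show ?thesis by (simp add: ennreal_of_nat_eq_real_of_nat add.commute)
qed

lemma half_space_sets[measurable]: "{x. 0 \<le> v \<bullet> x} \<in> sets S" "{x. v \<bullet> x \<le> 0} \<in> sets S"
proof -
  have "closed {x. 0 \<le> v \<bullet> x}" "closed {x. v \<bullet> x \<le> 0}" by (intro closed_Collect_le continuous_intros)+
  then show "{x. 0 \<le> v \<bullet> x} \<in> sets S" "{x. v \<bullet> x \<le> 0} \<in> sets S" by (auto simp: sets_spherical)
qed

text \<open>
  The reflection at the origin exchanges the half-space with its opposite, and the boundary
  hyperplane is a null set.
\<close>

lemma nn_integral_half_even:
  assumes [measurable]: "F \<in> borel_measurable S" and even: "\<And>x. F (- x) = F x" and v: "v \<noteq> 0"
  shows "(\<integral>\<^sup>+x. F x \<partial>doubled_half S v) = (\<integral>\<^sup>+x. F x \<partial>S)"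
proof -
  have Fb: "F \<in> borel_measurable borel" using assms(1) by (simp add: measurable_cong_sets[OF sets_spherical refl])
  have ib: "indicator {x. 0 \<le> v \<bullet> x} \<in> borel_measurable (borel :: ('a \<times> real) measure)"
    using half_space_sets(1)[of v] unfolding sets_spherical by (rule borel_measurable_indicator)
  have sym: "(\<integral>\<^sup>+x. indicator {x. 0 \<le> v \<bullet> x} x * F x \<partial>S) = (\<integral>\<^sup>+x. indicator {x. v \<bullet> x \<le> 0} x * F x \<partial>S)"
  proof -
    have "(\<integral>\<^sup>+x. indicator {x. 0 \<le> v \<bullet> x} x * F x \<partial>S) = (\<integral>\<^sup>+x. indicator {x. 0 \<le> v \<bullet> x} x * F x \<partial>distr S borel uminus)"
      by (simp only: spherical_distr_uminus)
    also have "\<dots> = (\<integral>\<^sup>+x. indicator {x. v \<bullet> x \<le> 0} x * F x \<partial>S)"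
      using Fb ib by (subst nn_integral_distr) (auto intro!: nn_integral_cong simp: even indicator_def)
    finally show ?thesis .
  qed
  have "(\<integral>\<^sup>+x. F x \<partial>doubled_half S v) = (\<integral>\<^sup>+x. indicator {x. 0 \<le> v \<bullet> x} x * F x + indicator {x. 0 \<le> v \<bullet> x} x * F x \<partial>S)"
  proof -
    have "(\<integral>\<^sup>+x. F x \<partial>doubled_half S v) = (\<integral>\<^sup>+x. 2 * indicator {x. 0 \<le> v \<bullet> x} x * F x \<partial>S)"
      unfolding doubled_half_def by (rule nn_integral_density) measurable
    also have "\<dots> = (\<integral>\<^sup>+x. indicator {x. 0 \<le> v \<bullet> x} x * F x + indicator {x. 0 \<le> v \<bullet> x} x * F x \<partial>S)"
      by (intro nn_integral_cong) (simp add: indicator_def mult_2)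
    finally show ?thesis .
  qed
  also have "\<dots> = (\<integral>\<^sup>+x. indicator {x. 0 \<le> v \<bullet> x} x * F x \<partial>S) + (\<integral>\<^sup>+x. indicator {x. 0 \<le> v \<bullet> x} x * F x \<partial>S)"
    by (rule nn_integral_add) measurable
  also have "\<dots> = (\<integral>\<^sup>+x. indicator {x. v \<bullet> x \<le> 0} x * F x \<partial>S) + (\<integral>\<^sup>+x. indicator {x. 0 \<le> v \<bullet> x} x * F x \<partial>S)"
    by (simp add: sym)
  also have "\<dots>
    = (\<integral>\<^sup>+x. indicator {x. v \<bullet> x \<le> 0} x * F x + indicator {x. 0 \<le> v \<bullet> x} x * F x \<partial>S)"
    by (rule nn_integral_add[symmetric]) measurable
  also have "\<dots> = (\<integral>\<^sup>+x. F x \<partial>S)"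
  proof (rule nn_integral_cong_AE)
    show "AE x in S. indicator {x. v \<bullet> x \<le> 0} x * F x + indicator {x. 0 \<le> v \<bullet> x} x * F x = F x"
      using AE_spherical_inner_neq_0[OF v] by eventually_elim (auto simp: indicator_def)
  qed
  finally show ?thesis .
qed

lemma integrable_inner_spherical:
  assumes "(\<integral>\<^sup>+x. ennreal ((snd x)\<^sup>2) \<partial>S) < \<infinity>"
  shows "integrable S (\<lambda>x. (w \<bullet> x)\<^sup>2)" "integrable S (\<lambda>x. w \<bullet> x)"
proof -
  show 1: "integrable S (\<lambda>x. (w \<bullet> x)\<^sup>2)"
    by (rule integrableI_nonneg) (use assms in \<open>auto simp: spherical_second_moment_inner ennreal_mult_less_top\<close>)
  show "integrable S (\<lambda>x. w \<bullet> x)"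
  proof (rule Bochner_Integration.integrable_bound[of S "\<lambda>x. 1 + (w \<bullet> x)\<^sup>2"])
    show "AE x in S. norm (w \<bullet> x) \<le> norm (1 + (w \<bullet> x)\<^sup>2)"
    proof (rule AE_I2)
      fix x
      have "0 \<le> (1 - \<bar>w \<bullet> x\<bar>)\<^sup>2" "0 \<le> (w \<bullet> x)\<^sup>2" by auto
      then show "norm (w \<bullet> x) \<le> norm (1 + (w \<bullet> x)\<^sup>2)" by (simp add: power2_diff)
    qed
  qed (use 1 in auto)
qed

text \<open>
  Averaging over the reflection at the origin turns the integral into that of \<open>(w \<bullet> x) * sgn (v \<bullet> x)\<close>.
  The component of \<open>w\<close> orthogonal to \<open>v\<close> changes sign under the reflection along it,
  which leaves \<open>v \<bullet> x\<close> fixed, and so contributes nothing; the component along \<open>v\<close> gives \<open>\<bar>v \<bullet> x\<bar>\<close>.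
\<close>

lemma first_moment_half:
  assumes fin: "(\<integral>\<^sup>+x. ennreal ((snd x)\<^sup>2) \<partial>S) < \<infinity>" and v: "v \<noteq> 0"
  shows "integrable (doubled_half S v) (\<lambda>x. w \<bullet> x)"
    and "(\<integral>x. w \<bullet> x \<partial>doubled_half S v) = (w \<bullet> v) / norm v * (\<integral>x. \<bar>snd x\<bar> \<partial>S)"
proof -
  note int = integrable_inner_spherical(2)[OF fin]
  have half: "doubled_half S v = density S (\<lambda>x. ennreal (2 * indicator {x. 0 \<le> v \<bullet> x} x))"
    unfolding doubled_half_def by (intro density_cong AE_I2) (auto simp: indicator_def)
  have i1: "integrable S (\<lambda>x. indicator {x. 0 \<le> v \<bullet> x} x * (w \<bullet> x))" for w
    using integrable_mult_indicator[OF half_space_sets(1) int, of v w] by simp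
  have i2: "integrable S (\<lambda>x. indicator {x. v \<bullet> x \<le> 0} x * (w \<bullet> x))" for w
    using integrable_mult_indicator[OF half_space_sets(2) int, of v w] by simp
  show "integrable (doubled_half S v) (\<lambda>x. w \<bullet> x)"
    unfolding half using integrable_mult_right[of 2, OF i1[of w]]
    by (subst integrable_density) (auto simp: ac_simps)
  have ib: "indicator {x. 0 \<le> v \<bullet> x} \<in> borel_measurable (borel :: ('a \<times> real) measure)"
    using half_space_sets(1)[of v] unfolding sets_spherical by (rule borel_measurable_indicator)
  have sgn: "(\<integral>x. w \<bullet> x \<partial>doubled_half S v) = (\<integral>x. (w \<bullet> x) * sgn (v \<bullet> x) \<partial>S)" for w
  proof -
    have sym: "(\<integral>x. indicator {x. 0 \<le> v \<bullet> x} x * (w \<bullet> x) \<partial>S) = - (\<integral>x. indicator {x. v \<bullet> x \<le> 0} x * (w \<bullet> x) \<partial>S)"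
    proof -
      have "(\<integral>x. indicator {x. 0 \<le> v \<bullet> x} x * (w \<bullet> x) \<partial>S) = (\<integral>x. indicator {x. 0 \<le> v \<bullet> x} x * (w \<bullet> x) \<partial>distr S borel uminus)"
        by (simp only: spherical_distr_uminus)
      also have "\<dots> = (\<integral>x. - (indicator {x. v \<bullet> x \<le> 0} x * (w \<bullet> x)) \<partial>S)"
        using ib by (subst integral_distr) (auto intro!: Bochner_Integration.integral_cong simp: indicator_def)
      finally show ?thesis by simp
    qed
    have "(\<integral>x. w \<bullet> x \<partial>doubled_half S v) = (\<integral>x. indicator {x. 0 \<le> v \<bullet> x} x * (w \<bullet> x) + indicator {x. 0 \<le> v \<bullet> x} x * (w \<bullet> x) \<partial>S)"
    proof -
      have "(\<integral>x. w \<bullet> x \<partial>doubled_half S v) = (\<integral>x. (2 * indicator {x. 0 \<le> v \<bullet> x} x) * (w \<bullet> x) \<partial>S)"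
        unfolding half by (subst integral_density) auto
      also have "\<dots> = (\<integral>x. indicator {x. 0 \<le> v \<bullet> x} x * (w \<bullet> x) + indicator {x. 0 \<le> v \<bullet> x} x * (w \<bullet> x) \<partial>S)"
        by (intro Bochner_Integration.integral_cong refl) (simp add: indicator_def)
      finally show ?thesis .
    qed
    also have "\<dots> = (\<integral>x. indicator {x. 0 \<le> v \<bullet> x} x * (w \<bullet> x) \<partial>S) + (\<integral>x. indicator {x. 0 \<le> v \<bullet> x} x * (w \<bullet> x) \<partial>S)"
      by (rule Bochner_Integration.integral_add[OF i1 i1])
    also have "\<dots> = (\<integral>x. indicator {x. 0 \<le> v \<bullet> x} x * (w \<bullet> x) \<partial>S) - (\<integral>x. indicator {x. v \<bullet> x \<le> 0} x * (w \<bullet> x) \<partial>S)"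
      by (simp add: sym)
    also have "\<dots> = (\<integral>x. indicator {x. 0 \<le> v \<bullet> x} x * (w \<bullet> x) - indicator {x. v \<bullet> x \<le> 0} x * (w \<bullet> x) \<partial>S)"
      by (rule Bochner_Integration.integral_diff[OF i1 i2, symmetric])
    also have "\<dots> = (\<integral>x. (w \<bullet> x) * sgn (v \<bullet> x) \<partial>S)"
      by (intro Bochner_Integration.integral_cong) (auto simp: indicator_def sgn_if)
    finally show ?thesis .
  qed
  have isgn: "integrable S (\<lambda>x. (w \<bullet> x) * sgn (v \<bullet> x))" for w
    by (rule Bochner_Integration.integrable_bound[OF int[of w]]) (auto simp: sgn_if)
  define c where "c = (w \<bullet> v) / (v \<bullet> v)"
  define u where "u = w - c *\<^sub>R v"
  have vu: "v \<bullet> u = 0" using v by (simp add: u_def c_def inner_simps inner_commute)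
  \<comment> \<open>The reflection along \<open>u\<close> reverses the sign of the integrand.\<close>
  have u0: "(\<integral>x. (u \<bullet> x) * sgn (v \<bullet> x) \<partial>S) = 0"
  proof (cases "u = 0")
    case False
    have vr: "v \<bullet> hyperplane_reflection u x = v \<bullet> x" for x
      using inner_hyperplane_reflection[of u x v] vu by (simp add: inner_commute)
    have ur: "u \<bullet> hyperplane_reflection u x = - (u \<bullet> x)" for x
      using inner_hyperplane_reflection[of u x u] False by (simp add: inner_commute)
    have "(\<integral>x. (u \<bullet> x) * sgn (v \<bullet> x) \<partial>S) = (\<integral>x. (u \<bullet> x) * sgn (v \<bullet> x) \<partial>distr S borel (hyperplane_reflection u))"
      by (simp only: spherical_distr_reflection)
    also have "\<dots> = (\<integral>x. - ((u \<bullet> x) * sgn (v \<bullet> x)) \<partial>S)"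
      by (subst integral_distr) (auto simp: vr ur)
    finally show ?thesis by simp
  qed simp
  have "(\<integral>x. w \<bullet> x \<partial>doubled_half S v) = (\<integral>x. (u \<bullet> x) * sgn (v \<bullet> x) + c * ((v \<bullet> x) * sgn (v \<bullet> x)) \<partial>S)"
    unfolding sgn by (intro Bochner_Integration.integral_cong) (auto simp: u_def inner_simps algebra_simps)
  also have "\<dots> = c * (\<integral>x. (v \<bullet> x) * sgn (v \<bullet> x) \<partial>S)"
    by (subst Bochner_Integration.integral_add[OF isgn integrable_mult_right[OF isgn]]) (simp add: u0)
  also have "(\<integral>x. (v \<bullet> x) * sgn (v \<bullet> x) \<partial>S) = (\<integral>x. norm v * \<bar>(v /\<^sub>R norm v) \<bullet> x\<bar> \<partial>S)"
    using v by (intro Bochner_Integration.integral_cong) (auto simp: abs_mult sgn_if)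
  also have "\<dots> = norm v * (\<integral>x. \<bar>snd x\<bar> \<partial>S)"
    using spherical_integral_inner[of "v /\<^sub>R norm v" abs] v by simp
  finally show "(\<integral>x. w \<bullet> x \<partial>doubled_half S v) = (w \<bullet> v) / norm v * (\<integral>x. \<bar>snd x\<bar> \<partial>S)"
    using v by (simp add: c_def dot_square_norm power2_eq_square)
qed

end

section \<open>Scale parameters of the radial law\<close>

lemma nn_integral_Gamma_half:
  assumes s: "0 < (s::real)"
  shows "(\<integral>\<^sup>+t. ennreal (t powr (s - 1) * exp (- (t / 2))) * indicator {0<..} t \<partial>lborel) = ennreal (2 powr s * Gamma s)"
proof -
  have G: "0 < Gamma s" using s by (rule Gamma_real_pos)
  have "((\<lambda>t. t powr (s - 1) / exp t) has_integral Gamma s) {0..}" using s by (rule Gamma_integral_real)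
  then have *: "(\<integral>\<^sup>+t. ennreal (t powr (s - 1) / exp t) * indicator {0..} t \<partial>lborel) = ennreal (Gamma s)"
    by (rule nn_integral_has_integral_lebesgue'[rotated]) simp
  have "(\<integral>\<^sup>+t. ennreal (t powr (s - 1) * exp (- (t / 2))) * indicator {0<..} t \<partial>lborel)
    = ennreal (2 ^ DIM(real)) * (\<integral>\<^sup>+t. ennreal ((2 *\<^sub>R t) powr (s - 1) * exp (- ((2 *\<^sub>R t) / 2))) * indicator {0<..} (2 *\<^sub>R t) \<partial>lborel)"
    by (rule nn_integral_scaleR) auto
  also have "(\<integral>\<^sup>+t. ennreal ((2 *\<^sub>R t) powr (s - 1) * exp (- ((2 *\<^sub>R t) / 2))) * indicator {0<..} (2 *\<^sub>R t) \<partial>lborel)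
    = (\<integral>\<^sup>+t. ennreal (2 powr (s - 1)) * (ennreal (t powr (s - 1) / exp t) * indicator {0..} t) \<partial>lborel)"
  proof (rule nn_integral_cong_AE)
    show "AE t in lborel. ennreal ((2 *\<^sub>R t) powr (s - 1) * exp (- ((2 *\<^sub>R t) / 2))) * indicator {0<..} (2 *\<^sub>R t)
      = ennreal (2 powr (s - 1)) * (ennreal (t powr (s - 1) / exp t) * indicator {0..} t)"
      using AE_lborel_singleton[of 0]
    proof eventually_elim
      case (elim t)
      show ?case
      proof (cases "0 < t")
        case True
        then show ?thesis by (simp add: powr_mult exp_minus field_simps ennreal_mult'[symmetric])
      qed (use elim in \<open>auto simp: indicator_def\<close>)
    qed
  qed
  also have "\<dots> = ennreal (2 powr (s - 1)) * ennreal (Gamma s)"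
    by (subst nn_integral_cmult) (auto simp: * )
  also have "ennreal (2 ^ DIM(real)) * \<dots> = ennreal (2 powr s * Gamma s)"
  proof -
    have "ennreal (2 ^ DIM(real)) * (ennreal (2 powr (s - 1)) * ennreal (Gamma s)) = ennreal (2 * (2 powr (s - 1) * Gamma s))"
      by (simp add: ennreal_mult')
    also have "2 * (2 powr (s - 1) * Gamma s) = 2 powr s * Gamma s" by (simp add: powr_diff)
    finally show ?thesis .
  qed
  finally show ?thesis .
qed

lemma chi_square_powr_moment:
  assumes n: "0 < n" and q: "0 \<le> q"
  shows "(\<integral>x. chi_square_density n x * x powr q \<partial>lborel) = 2 powr q * Gamma (real n / 2 + q) / Gamma (real n / 2)"
proof -
  define c where "c = 1 / (2 powr (real n / 2) * Gamma (real n / 2))"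
  have G: "0 < Gamma (real n / 2)" "0 < Gamma (real n / 2 + q)" using n q by (auto intro!: Gamma_real_pos add_pos_nonneg)
  have c: "0 \<le> c" using G by (simp add: c_def)
  have eq: "chi_square_density n x * x powr q
    = c * (x powr (real n / 2 + q - 1) * exp (- x / 2)) * indicator {0<..} x" for x
    by (cases "0 < x") (auto simp: chi_square_density_def c_def powr_add[symmetric] algebra_simps)
  have "(\<integral>\<^sup>+x. ennreal (chi_square_density n x * x powr q) \<partial>lborel)
    = (\<integral>\<^sup>+x. ennreal c * (ennreal (x powr (real n / 2 + q - 1) * exp (- x / 2)) * indicator {0<..} x) \<partial>lborel)"
    unfolding eq using c by (intro nn_integral_cong) (auto simp: indicator_def ennreal_mult)
  also have "\<dots> = ennreal c * ennreal (2 powr (real n / 2 + q) * Gamma (real n / 2 + q))"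
    by (subst nn_integral_cmult) (use n q in \<open>auto simp: nn_integral_Gamma_half\<close>)
  also have "\<dots> = ennreal (2 powr q * Gamma (real n / 2 + q) / Gamma (real n / 2))"
    using c G by (simp add: ennreal_mult[symmetric] c_def powr_add)
  finally have "(\<integral>\<^sup>+x. ennreal (chi_square_density n x * x powr q) \<partial>lborel)
    = ennreal (2 powr q * Gamma (real n / 2 + q) / Gamma (real n / 2))" .
  moreover have "0 \<le> chi_square_density n x * x powr q" for x
    unfolding eq using c by simp
  moreover have "(\<lambda>x. chi_square_density n x * x powr q) \<in> borel_measurable lborel"
    unfolding chi_square_density_def[abs_def] by measurable
  ultimately show ?thesis using G by (intro integral_eq_nn_integral[THEN trans]) auto
qed

lemma chi_moments:
  assumes chi: "chi_distributed N0 R0 n" and n: "0 < n"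
  shows "(\<integral>\<omega>. R0 \<omega> \<partial>N0) = sqrt 2 * Gamma ((real n + 1) / 2) / Gamma (real n / 2)"
    and "(\<integral>\<omega>. (R0 \<omega>)\<^sup>2 \<partial>N0) = real n"
proof -
  have R0: "R0 \<in> borel_measurable N0" "AE \<omega> in N0. 0 \<le> R0 \<omega>"
    and D: "distributed N0 lborel (\<lambda>\<omega>. (R0 \<omega>)\<^sup>2) (\<lambda>x. ennreal (chi_square_density n x))"
    using chi by (auto simp: chi_distributed_def)
  have nn: "0 \<le> chi_square_density n x" for x
    using n Gamma_real_pos[of "real n / 2"] by (simp add: chi_square_density_def)
  have *: "(\<integral>\<omega>. ((R0 \<omega>)\<^sup>2) powr q \<partial>N0) = 2 powr q * Gamma (real n / 2 + q) / Gamma (real n / 2)" if "0 \<le> q" for q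
    using distributed_integral[OF D, of "\<lambda>x. x powr q"] nn chi_square_powr_moment[OF n that] by simp
  have "(\<integral>\<omega>. R0 \<omega> \<partial>N0) = (\<integral>\<omega>. ((R0 \<omega>)\<^sup>2) powr (1/2) \<partial>N0)"
    using R0 by (intro integral_cong_AE) (auto simp: powr_half_sqrt elim!: eventually_mono)
  then show "(\<integral>\<omega>. R0 \<omega> \<partial>N0) = sqrt 2 * Gamma ((real n + 1) / 2) / Gamma (real n / 2)"
    using *[of "1/2"] by (simp add: powr_half_sqrt add_divide_distrib)
  have Gpos: "0 < Gamma (real n / 2)" using n by (intro Gamma_real_pos) simp
  have "(\<integral>\<omega>. (R0 \<omega>)\<^sup>2 \<partial>N0) = (\<integral>\<omega>. ((R0 \<omega>)\<^sup>2) powr 1 \<partial>N0)" by simp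
  also have "\<dots> = 2 * Gamma (real n / 2 + 1) / Gamma (real n / 2)" using *[of 1] by simp
  also have "Gamma (real n / 2 + 1) = real n / 2 * Gamma (real n / 2)"
    using n by (intro Gamma_plus1) (auto elim!: nonpos_Ints_cases)
  finally show "(\<integral>\<omega>. (R0 \<omega>)\<^sup>2 \<partial>N0) = real n" using Gpos by simp
qed

text \<open>
  \<open>R\<close> has the law of the norm of a spherical vector. So \<open>E|X\<^sub>0|\<close> is \<open>E R\<close> times
  \<open>\<Gamma>((k + 1) / 2) / (sqrt \<pi> \<Gamma>(k / 2 + 1))\<close>, which is what division by \<open>E R\<^sub>0\<close> and multiplication by
  \<open>sqrt (2 / \<pi>)\<close> produce; and \<open>E R\<^sup>2\<close> is the sum of \<open>k + 1\<close> equal second moments.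
\<close>

lemma radial_parameters:
  fixes R :: "'u \<Rightarrow> real" and R0 :: "'v \<Rightarrow> real" and S :: "('a::euclidean_space \<times> real) measure"
  assumes gen: "spherical_generator TYPE('a \<times> real) g"
    and R: "distributed N lborel R (\<lambda>r. ennreal (radial_density DIM('a) g r))"
    and R0: "chi_distributed N0 R0 (DIM('a) + 1)"
  defines "S \<equiv> spherical_measure g"
  shows "(\<integral>\<omega>. R \<omega> \<partial>N) / (\<integral>\<omega>. R0 \<omega> \<partial>N0) * sqrt (2 / pi) = (\<integral>x. \<bar>snd x\<bar> \<partial>S)"
    and "(\<integral>\<omega>. (R \<omega>)\<^sup>2 \<partial>N) / (\<integral>\<omega>. (R0 \<omega>)\<^sup>2 \<partial>N0) = (\<integral>x. (snd x)\<^sup>2 \<partial>S)"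
proof -
  let ?k = "real DIM('a)"
  note m = measurable_spherical_generator[OF gen]
  have [measurable]: "snd \<in> borel_measurable S" unfolding S_def by (rule measurable_snd_spherical[OF gen])
  have [measurable]: "norm \<in> borel_measurable S"
    by (simp add: S_def measurable_cong_sets[OF sets_spherical_measure refl])
  have Rm[measurable]: "R \<in> borel_measurable N" using R by (simp add: distributed_def)
  have law: "distr N borel R = distr S borel norm"
  proof -
    have "distr N borel R = distr N lborel R" by (rule distr_cong) auto
    also have "\<dots> = density lborel (\<lambda>r. ennreal (radial_density DIM('a) g r))" using R by (simp add: distributed_def)
    also have "\<dots> = distr S borel norm" unfolding S_def by (rule distr_spherical_norm[OF m, symmetric]) simp
    finally show ?thesis .
  qed
  have ER: "(\<integral>\<omega>. H (R \<omega>) \<partial>N) = (\<integral>x. H (norm x) \<partial>S)" if [measurable]: "H \<in> borel_measurable borel" for H :: "real \<Rightarrow> real"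
  proof -
    have "(\<integral>\<omega>. H (R \<omega>) \<partial>N) = (\<integral>r. H r \<partial>distr N borel R)" by (simp add: integral_distr)
    also have "\<dots> = (\<integral>x. H (norm x) \<partial>S)" unfolding law by (simp add: integral_distr)
    finally show ?thesis .
  qed
  have G: "0 < Gamma ((?k + 1) / 2)" "0 < Gamma (?k / 2 + 1)" by (auto intro!: Gamma_real_pos add_pos_nonneg)
  define \<kappa> where "\<kappa> = Gamma ((?k + 1) / 2) / (sqrt pi * Gamma (?k / 2 + 1))"
  have \<kappa>: "0 \<le> \<kappa>" using G by (simp add: \<kappa>_def)
  have "(\<integral>x. \<bar>snd x\<bar> \<partial>S) = enn2real (\<integral>\<^sup>+x. ennreal \<bar>snd x\<bar> \<partial>S)" by (rule integral_eq_nn_integral) auto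
  also have "\<dots> = \<kappa> * enn2real (\<integral>\<^sup>+x. ennreal (norm x) \<partial>S)"
    unfolding S_def nn_integral_abs_snd_spherical[OF m] \<kappa>_def[symmetric] using \<kappa> by (simp add: enn2real_mult)
  also have "enn2real (\<integral>\<^sup>+x. ennreal (norm x) \<partial>S) = (\<integral>x. norm x \<partial>S)" by (rule integral_eq_nn_integral[symmetric]) auto
  finally have 1: "(\<integral>x. \<bar>snd x\<bar> \<partial>S) = \<kappa> * (\<integral>x. norm x \<partial>S)" .
  have "(\<integral>\<omega>. R0 \<omega> \<partial>N0) = sqrt 2 * Gamma (?k / 2 + 1) / Gamma ((?k + 1) / 2)"
    using chi_moments(1)[OF R0] by (simp add: add_divide_distrib add.commute)
  then have "(\<integral>\<omega>. R \<omega> \<partial>N) / (\<integral>\<omega>. R0 \<omega> \<partial>N0) * sqrt (2 / pi)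
    = (\<integral>x. norm x \<partial>S) / (sqrt 2 * Gamma (?k / 2 + 1) / Gamma ((?k + 1) / 2)) * (sqrt 2 / sqrt pi)"
    using ER[of "\<lambda>x. x"] by (simp add: real_sqrt_divide)
  also have "\<dots> = \<kappa> * (\<integral>x. norm x \<partial>S)" using G by (simp add: \<kappa>_def ac_simps)
  finally show "(\<integral>\<omega>. R \<omega> \<partial>N) / (\<integral>\<omega>. R0 \<omega> \<partial>N0) * sqrt (2 / pi) = (\<integral>x. \<bar>snd x\<bar> \<partial>S)" using 1 by simp
  have "(\<integral>\<omega>. (R \<omega>)\<^sup>2 \<partial>N) = (\<integral>x. (norm x)\<^sup>2 \<partial>S)" by (rule ER) simp
  also have "\<dots> = enn2real (\<integral>\<^sup>+x. ennreal ((norm x)\<^sup>2) \<partial>S)" by (rule integral_eq_nn_integral) auto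
  also have "\<dots> = (?k + 1) * enn2real (\<integral>\<^sup>+x. ennreal ((snd x)\<^sup>2) \<partial>S)"
    unfolding S_def spherical_second_moment_norm[OF gen] by (simp add: enn2real_mult)
  also have "enn2real (\<integral>\<^sup>+x. ennreal ((snd x)\<^sup>2) \<partial>S) = (\<integral>x. (snd x)\<^sup>2 \<partial>S)" by (rule integral_eq_nn_integral[symmetric]) auto
  finally have "(\<integral>\<omega>. (R \<omega>)\<^sup>2 \<partial>N) = (?k + 1) * (\<integral>x. (snd x)\<^sup>2 \<partial>S)" .
  moreover have "(\<integral>\<omega>. (R0 \<omega>)\<^sup>2 \<partial>N0) = ?k + 1" using chi_moments(2)[OF R0] by simp
  moreover have "?k + 1 \<noteq> 0" by simp
  ultimately show "(\<integral>\<omega>. (R \<omega>)\<^sup>2 \<partial>N) / (\<integral>\<omega>. (R0 \<omega>)\<^sup>2 \<partial>N0) = (\<integral>x. (snd x)\<^sup>2 \<partial>S)" by simp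
qed

section \<open>Isometries for a positive definite form\<close>

text \<open>
  Gram-Schmidt for the form \<open>B\<close>, indexed by Euclidean basis vectors: fewer than \<open>DIM\<close> vectors do not
  span, so a new vector can be found and orthonormalised.
\<close>

lemma form_orthonormal_family:
  fixes B :: "'a::euclidean_space \<Rightarrow> 'a \<Rightarrow> real"
  assumes B: "bilinear B" and sym: "\<And>x y. B x y = B y x" and pos: "\<And>x. x \<noteq> 0 \<Longrightarrow> 0 < B x x"
    and "finite F" "F \<subseteq> (Basis :: 'a set)"
  shows "\<exists>e :: 'a \<Rightarrow> 'a. \<forall>b\<in>F. \<forall>c\<in>F. B (e b) (e c) = (if b = c then 1 else 0)"
  using assms(4,5)
proof (induction F)
  case (insert b0 F)
  then obtain e :: "'a \<Rightarrow> 'a" where e: "\<And>b c. b \<in> F \<Longrightarrow> c \<in> F \<Longrightarrow> B (e b) (e c) = (if b = c then 1 else 0)" by auto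
  have "card (e ` F) \<le> card F" using insert.hyps(1) by (rule card_image_le)
  also have "\<dots> < DIM('a)" using insert by (metis card_insert_disjoint card_mono finite_Basis Suc_le_eq)
  finally have "dim (e ` F) < DIM('a)" using dim_le_card'[of "e ` F"] insert.hyps(1) by simp
  then have "span (e ` F) \<noteq> UNIV" by (metis dim_UNIV dim_span less_irrefl)
  then obtain v where v: "v \<notin> span (e ` F)" by auto
  define w where "w = v - (\<Sum>c\<in>F. B v (e c) *\<^sub>R e c)"
  have "(\<Sum>c\<in>F. B v (e c) *\<^sub>R e c) \<in> span (e ` F)" by (intro span_sum span_scale span_base) auto
  then have w0: "w \<noteq> 0" using v unfolding w_def by auto
  have Bsum: "B (\<Sum>c\<in>F. f c *\<^sub>R e c) y = (\<Sum>c\<in>F. f c * B (e c) y)" for f y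
  proof -
    have "linear (\<lambda>x. B x y)" using B by (simp add: bilinear_def)
    then show ?thesis by (simp add: linear_sum[where f="\<lambda>x. B x y"] linear_scale[where f="\<lambda>x. B x y"])
  qed
  have wF: "B w (e b) = 0" if "b \<in> F" for b
  proof -
    have "B w (e b) = B v (e b) - (\<Sum>c\<in>F. B v (e c) * B (e c) (e b))"
      unfolding w_def by (simp add: bilinear_lsub[OF B] Bsum)
    also have "(\<Sum>c\<in>F. B v (e c) * B (e c) (e b)) = (\<Sum>c\<in>F. if c = b then B v (e b) else 0)"
      using that by (intro sum.cong) (auto simp: e)
    finally show ?thesis using that insert.hyps(1) by simp
  qed
  define u where "u = (1 / sqrt (B w w)) *\<^sub>R w"
  have "B u u = B w w / (sqrt (B w w) * sqrt (B w w))"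
    by (simp add: u_def bilinear_lmul[OF B] bilinear_rmul[OF B])
  then have "B u u = 1" using pos[OF w0] by simp
  moreover have "\<And>b. b \<in> F \<Longrightarrow> B u (e b) = 0" "\<And>b. b \<in> F \<Longrightarrow> B (e b) u = 0"
    using wF sym unfolding u_def by (auto simp: bilinear_lmul[OF B] bilinear_rmul[OF B])
  ultimately have "\<forall>b\<in>insert b0 F. \<forall>c\<in>insert b0 F. B ((e(b0 := u)) b) ((e(b0 := u)) c) = (if b = c then 1 else 0)"
    using e insert.hyps(2) by auto
  then show ?case by blast
qed auto

lemma form_isometry:
  fixes B :: "'a::euclidean_space \<Rightarrow> 'a \<Rightarrow> real"
  assumes B: "bilinear B" and sym: "\<And>x y. B x y = B y x" and pos: "\<And>x. x \<noteq> 0 \<Longrightarrow> 0 < B x x"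
  obtains L Li :: "'a \<Rightarrow> 'a" where "linear L" "linear Li" "\<And>x. L (Li x) = x" "\<And>x. Li (L x) = x" "\<And>x y. B (L x) (L y) = x \<bullet> y"
proof -
  obtain e :: "'a \<Rightarrow> 'a" where e: "\<And>b c. b \<in> Basis \<Longrightarrow> c \<in> Basis \<Longrightarrow> B (e b) (e c) = (if b = c then 1 else 0)"
    using form_orthonormal_family[OF assms finite_Basis order_refl] by blast
  define L where "L x = (\<Sum>b\<in>Basis. (x \<bullet> b) *\<^sub>R e b)" for x
  have lin: "linear L"
    by (rule linearI) (simp_all add: L_def inner_simps sum.distrib scaleR_sum_right algebra_simps)
  have iso: "B (L x) (L y) = x \<bullet> y" for x y
  proof -
    have "B (L x) (L y) = (\<Sum>b\<in>Basis. (x \<bullet> b) * B (e b) (L y))"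
    proof -
      have "linear (\<lambda>x. B x (L y))" using B by (simp add: bilinear_def)
      then show ?thesis unfolding L_def[of x]
        by (simp add: linear_sum[where f="\<lambda>x. B x (L y)"] linear_scale[where f="\<lambda>x. B x (L y)"])
    qed
    also have "\<dots> = (\<Sum>b\<in>Basis. (x \<bullet> b) * (y \<bullet> b))"
    proof (intro sum.cong refl)
      fix b :: 'a assume b: "b \<in> Basis"
      have "linear (B (e b))" using B by (simp add: bilinear_def)
      then have "B (e b) (L y) = (\<Sum>c\<in>Basis. (y \<bullet> c) * B (e b) (e c))"
        unfolding L_def by (simp add: linear_sum linear_scale)
      also have "\<dots> = (\<Sum>c\<in>Basis. if c = b then y \<bullet> b else 0)"
        using b by (intro sum.cong) (auto simp: e)
      finally show "(x \<bullet> b) * B (e b) (L y) = (x \<bullet> b) * (y \<bullet> b)" using b by simp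
    qed
    finally show ?thesis by (simp add: euclidean_inner[of x y])
  qed
  have "inj L"
  proof (subst linear_injective_0[OF lin], intro allI impI)
    fix x assume "L x = 0"
    then have "x \<bullet> x = 0" using iso[of x x] bilinear_lzero[OF B] by simp
    then show "x = 0" by simp
  qed
  then obtain Li where "linear Li" "\<forall>x. Li (L x) = x" "\<forall>x. L (Li x) = x"
    using linear_injective_isomorphism[OF lin] by blast
  then show thesis using lin iso by (intro that[of L Li]) auto
qed

lemma positive_definite_inverse_form:
  fixes \<Omega> :: "real^'n^'n"
  assumes "positive_definite \<Omega>"
  shows "det \<Omega> \<noteq> 0"
    and "bilinear (\<lambda>x y. x \<bullet> (matrix_inv \<Omega> *v y))"
    and "x \<bullet> (matrix_inv \<Omega> *v y) = y \<bullet> (matrix_inv \<Omega> *v x)"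
    and "x \<noteq> 0 \<Longrightarrow> 0 < x \<bullet> (matrix_inv \<Omega> *v x)"
proof -
  have sym: "transpose \<Omega> = \<Omega>" and pos: "\<And>x. x \<noteq> 0 \<Longrightarrow> 0 < x \<bullet> (\<Omega> *v x)"
    using assms by (auto simp: positive_definite_def)
  have "\<forall>x. \<Omega> *v x = 0 \<longrightarrow> x = 0"
  proof (intro allI impI)
    fix x assume "\<Omega> *v x = 0"
    then show "x = 0" using pos[of x] by (cases "x = 0") auto
  qed
  then have inv: "invertible \<Omega>"
    by (simp add: invertible_left_inverse matrix_left_invertible_ker)
  then show "det \<Omega> \<noteq> 0" by (simp add: invertible_det_nz)
  have "\<Omega> ** matrix_inv \<Omega> = mat 1"
    using someI_ex[OF inv[unfolded invertible_def]] by (simp add: matrix_inv_def)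
  then have \<Omega>i: "\<Omega> *v (matrix_inv \<Omega> *v x) = x" for x
    by (simp add: matrix_vector_mul_assoc)
  have sa: "x \<bullet> (\<Omega> *v y) = (\<Omega> *v x) \<bullet> y" for x y
    using dot_lmul_matrix[of x \<Omega> y] transpose_matrix_vector[of \<Omega> x] sym by simp
  show "bilinear (\<lambda>x y. x \<bullet> (matrix_inv \<Omega> *v y))"
    unfolding bilinear_def
    by (auto intro!: linearI simp: inner_simps matrix_vector_right_distrib matrix_vector_mult_scaleR)
  show "x \<bullet> (matrix_inv \<Omega> *v y) = y \<bullet> (matrix_inv \<Omega> *v x)"
  proof -
    have "x \<bullet> (matrix_inv \<Omega> *v y) = (\<Omega> *v (matrix_inv \<Omega> *v x)) \<bullet> (matrix_inv \<Omega> *v y)" by (simp add: \<Omega>i)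
    also have "\<dots> = (matrix_inv \<Omega> *v x) \<bullet> (\<Omega> *v (matrix_inv \<Omega> *v y))" by (simp add: sa)
    finally show ?thesis by (simp add: \<Omega>i inner_commute)
  qed
  show "0 < x \<bullet> (matrix_inv \<Omega> *v x)" if "x \<noteq> 0"
  proof -
    have "matrix_inv \<Omega> *v x \<noteq> 0" using \<Omega>i[of x] that by (metis matrix_vector_mult_0_right)
    from pos[OF this] show ?thesis by (simp add: \<Omega>i inner_commute)
  qed
qed

section \<open>The standardized skew-elliptical law and its moments\<close>

text \<open>
  The vector \<open>\<nu>\<close> is a normal of the half-space \<open>{(z, r). r \<le> \<theta> \<bullet> z / sqrt (1 - \<theta> \<bullet> \<theta>)}\<close>, over which the
  density of the standardized vector integrates.
\<close>

context
  fixes M :: "'w measure" and Y :: "'w \<Rightarrow> real^'n" and \<mu> \<delta> \<theta> :: "real^'n" and \<Omega> :: "real^'n^'n"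
    and g :: "real \<Rightarrow> real" and L Li :: "real^'n \<Rightarrow> real^'n" and S :: "((real^'n) \<times> real) measure"
    and \<nu> :: "(real^'n) \<times> real"
  assumes M: "prob_space M" and SE: "skew_elliptical M Y \<mu> \<Omega> \<delta> g"
    and L: "linear L" "linear Li" "\<And>x. L (Li x) = x" "\<And>x. Li (L x) = x"
    and iso: "\<And>x y. L x \<bullet> (matrix_inv \<Omega> *v L y) = x \<bullet> y"
  defines "S \<equiv> spherical_measure g" and "\<theta> \<equiv> Li \<delta>"
    and "\<nu> \<equiv> ((1 / sqrt (1 - \<theta> \<bullet> \<theta>)) *\<^sub>R \<theta>, - 1)"
begin

lemma generator: "spherical_generator TYPE((real^'n) \<times> real) g"
  using SE by (simp add: skew_elliptical_def)

lemma inner_theta: "\<theta> \<bullet> \<theta> = \<delta> \<bullet> (matrix_inv \<Omega> *v \<delta>)" "\<theta> \<bullet> \<theta> < 1"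
  using iso[of \<theta> \<theta>] SE by (auto simp: \<theta>_def L skew_elliptical_def)

lemma norm_nu: "\<nu> \<noteq> 0" "norm \<nu> = 1 / sqrt (1 - \<theta> \<bullet> \<theta>)"
proof -
  show "\<nu> \<noteq> 0" by (simp add: \<nu>_def zero_prod_def)
  have "\<nu> \<bullet> \<nu> = \<theta> \<bullet> \<theta> / (1 - \<theta> \<bullet> \<theta>) + 1"
    using inner_theta(2) by (simp add: \<nu>_def inner_prod_def)
  also have "\<dots> = 1 / (1 - \<theta> \<bullet> \<theta>)" using inner_theta(2) by (simp add: field_simps)
  finally show "norm \<nu> = 1 / sqrt (1 - \<theta> \<bullet> \<theta>)" by (simp add: norm_eq_sqrt_inner real_sqrt_divide)
qed

lemma measurable_standardization[measurable]: "L \<in> borel_measurable borel" "Li \<in> borel_measurable borel"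
  using L(1,2) by (auto intro!: borel_measurable_continuous_onI linear_continuous_on linear_conv_bounded_linear[THEN iffD1])

lemma se_density_standardized:
  "se_density \<mu> \<Omega> \<delta> g (\<mu> + L z) = 2 * det \<Omega> powr (- 1 / 2) *
     (LINT r:{..(1 / sqrt (1 - \<theta> \<bullet> \<theta>)) * (\<theta> \<bullet> z)}|lborel. g (r\<^sup>2 + z \<bullet> z))"
proof -
  have "skew_alpha \<Omega> \<delta> \<bullet> L z = (1 / sqrt (1 - \<theta> \<bullet> \<theta>)) * (\<delta> \<bullet> (matrix_inv \<Omega> *v L z))"
    by (simp add: skew_alpha_def dot_lmul_matrix inner_theta(1))
  also have "\<delta> \<bullet> (matrix_inv \<Omega> *v L z) = \<theta> \<bullet> z" using iso[of \<theta> z] by (simp add: \<theta>_def L)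
  finally show ?thesis by (simp add: se_density_def iso)
qed

lemma measurable_generator_norm[measurable]: "(\<lambda>x::(real^'n) \<times> real. g (x \<bullet> x)) \<in> borel_measurable borel"
  using measurable_spherical_generator[OF generator] by simp

lemma measurable_generator_pair[measurable]:
  "(\<lambda>(z, r). g (r\<^sup>2 + z \<bullet> z)) \<in> borel_measurable ((borel :: (real^'n) measure) \<Otimes>\<^sub>M borel)"
  using measurable_generator_norm by (simp add: borel_prod inner_prod_def case_prod_unfold power2_eq_square add.commute)

lemma measurable_generator_section[measurable]: "(\<lambda>r. g (r\<^sup>2 + z \<bullet> z)) \<in> borel_measurable borel" for z :: "real^'n"
  using measurable_compose_Pair1[OF _ measurable_generator_pair, of z] by simp

lemma g_nonneg: "0 \<le> t \<Longrightarrow> 0 \<le> g t"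
  using generator by (simp add: spherical_generator_def)

lemma nn_integral_generator:
  assumes [measurable]: "H \<in> borel_measurable (borel \<Otimes>\<^sub>M borel)"
  shows "(\<integral>\<^sup>+x. H x \<partial>S) = (\<integral>\<^sup>+z. \<integral>\<^sup>+r. ennreal (g (r\<^sup>2 + z \<bullet> z)) * H (z, r) \<partial>lborel \<partial>(lborel :: (real^'n) measure))"
proof -
  have "(\<integral>\<^sup>+x. H x \<partial>S) = (\<integral>\<^sup>+x. (case x of (z, r) \<Rightarrow> ennreal (g (r\<^sup>2 + z \<bullet> z)) * H (z, r)) \<partial>(lborel \<Otimes>\<^sub>M lborel))"
    unfolding S_def spherical_measure_def lborel_prod using assms measurable_generator_norm
    by (subst nn_integral_density)
       (auto intro!: nn_integral_cong simp: borel_prod inner_prod_def power2_eq_square add.commute)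
  also have "\<dots> = (\<integral>\<^sup>+z. \<integral>\<^sup>+r. ennreal (g (r\<^sup>2 + z \<bullet> z)) * H (z, r) \<partial>lborel \<partial>lborel)"
    by (subst lborel.nn_integral_fst[symmetric]) auto
  finally show ?thesis .
qed

text \<open>
  By Fubini's theorem; it links the Bochner integral in the density, which is zero where the section is
  not integrable, to the nonnegative integrals used here.
\<close>

lemma AE_integrable_section: "AE z in lborel. integrable lborel (\<lambda>r. g (r\<^sup>2 + (z :: real^'n) \<bullet> z))"
proof -
  have "(\<integral>\<^sup>+z. \<integral>\<^sup>+r. ennreal (g (r\<^sup>2 + z \<bullet> z)) \<partial>lborel \<partial>(lborel :: (real^'n) measure)) = (\<integral>\<^sup>+x. 1 \<partial>S)"
    using nn_integral_generator[of "\<lambda>_. 1"] by simp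
  also have "\<dots> = 1" using prob_space.emeasure_space_1[OF prob_space_spherical[OF generator]] by (simp add: S_def)
  finally have "(\<integral>\<^sup>+z. \<integral>\<^sup>+r. ennreal (g (r\<^sup>2 + z \<bullet> z)) \<partial>lborel \<partial>(lborel :: (real^'n) measure)) \<noteq> \<infinity>" by simp
  then have "AE z in lborel. (\<integral>\<^sup>+r. ennreal (g (r\<^sup>2 + (z :: real^'n) \<bullet> z)) \<partial>lborel) \<noteq> \<infinity>"
    by (intro nn_integral_PInf_AE) auto
  then show ?thesis
  proof eventually_elim
    case (elim z)
    show ?case
      by (rule integrableI_nonneg) (use elim in \<open>auto simp: top.not_eq_extremum intro!: g_nonneg\<close>)
  qed
qed

text \<open>
  Both sides have densities proportional to the integral of the spherical density over
  \<open>r \<le> \<theta> \<bullet> z / sqrt (1 - \<theta> \<bullet> \<theta>)\<close>. The factor combines \<open>det \<Omega>\<close> with the unknown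
  constant by which \<open>Li\<close> scales Lebesgue measure; it is one because both laws have total mass one.
\<close>

lemma standardized_law: "distr M borel (\<lambda>\<omega>. Li (Y \<omega> - \<mu>)) = distr (doubled_half S \<nu>) borel fst"
proof -
  define f where "f = se_density \<mu> \<Omega> \<delta> g"
  have D: "distributed M lborel Y (\<lambda>y. ennreal (f y))" using SE by (simp add: skew_elliptical_def f_def)
  then have fm[measurable]: "(\<lambda>y. ennreal (f y)) \<in> borel_measurable borel"
    and Ym[measurable]: "Y \<in> borel_measurable M" and DY: "distr M lborel Y = density lborel (\<lambda>y. ennreal (f y))"
    by (auto simp: distributed_def)
  define K where "K = det \<Omega> powr (- 1 / 2)"
  define q where "q z = 2 * (\<integral>\<^sup>+r. ennreal (g (r\<^sup>2 + z \<bullet> z)) * indicator {..(1 / sqrt (1 - \<theta> \<bullet> \<theta>)) * (\<theta> \<bullet> z)} r \<partial>lborel)" for z :: "real^'n"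
  have qm[measurable]: "q \<in> borel_measurable borel"
  proof -
    have "(\<lambda>(z, r). ennreal (g (r\<^sup>2 + z \<bullet> z)) * (if r \<le> (1 / sqrt (1 - \<theta> \<bullet> \<theta>)) * (\<theta> \<bullet> z) then 1 else 0)) \<in> borel_measurable (borel \<Otimes>\<^sub>M lborel)"
    proof -
      have [measurable]: "(\<lambda>x::(real^'n) \<times> real. g ((snd x)\<^sup>2 + fst x \<bullet> fst x)) \<in> borel_measurable (borel \<Otimes>\<^sub>M borel)"
        using measurable_generator_pair by (simp add: case_prod_unfold)
      show ?thesis unfolding case_prod_unfold by measurable
    qed
    then have "(\<lambda>z. \<integral>\<^sup>+r. ennreal (g (r\<^sup>2 + z \<bullet> z)) * (if r \<le> (1 / sqrt (1 - \<theta> \<bullet> \<theta>)) * (\<theta> \<bullet> z) then 1 else 0) \<partial>lborel) \<in> borel_measurable borel"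
      by (rule lborel.borel_measurable_nn_integral)
    then show ?thesis unfolding q_def[abs_def] indicator_def atMost_iff of_bool_def by measurable
  qed
  have fq: "AE z in lborel. ennreal (f (\<mu> + L z)) = ennreal K * q z"
    using AE_integrable_section
  proof eventually_elim
    case (elim z)
    let ?A = "{..(1 / sqrt (1 - \<theta> \<bullet> \<theta>)) * (\<theta> \<bullet> z)}"
    have i: "integrable lborel (\<lambda>r. indicator ?A r * g (r\<^sup>2 + z \<bullet> z))"
      using integrable_mult_indicator[OF _ elim, of ?A] by simp
    have "q z = 2 * (\<integral>\<^sup>+r. ennreal (indicator ?A r * g (r\<^sup>2 + z \<bullet> z)) \<partial>lborel)"
      unfolding q_def by (intro arg_cong[where f="(*) 2"] nn_integral_cong) (auto simp: indicator_def)
    also have "\<dots> = 2 * ennreal (\<integral>r. indicator ?A r * g (r\<^sup>2 + z \<bullet> z) \<partial>lborel)"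
      by (subst nn_integral_eq_integral[OF i]) (auto intro!: AE_I2 mult_nonneg_nonneg g_nonneg)
    finally have "ennreal K * q z = ennreal (K * (2 * (\<integral>r. indicator ?A r * g (r\<^sup>2 + z \<bullet> z) \<partial>lborel)))"
      by (simp add: ennreal_mult' K_def)
    then show ?case unfolding f_def se_density_standardized K_def[symmetric]
      by (simp add: set_lebesgue_integral_def ac_simps)
  qed
  \<comment> \<open>The constant \<open>c\<close> stays unknown until the total masses are compared.\<close>
  obtain c where c: "distr lborel borel Li = density lborel (\<lambda>_. c)"
    using lborel_distr_linear_bij[OF L(2,1,4,3)] .
  define T where "T y = Li (y - \<mu>)" for y
  have [measurable]: "T \<in> borel_measurable borel" unfolding T_def by measurable
  have Tl: "distr lborel borel T = density lborel (\<lambda>_. c)"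
  proof -
    have "distr lborel borel T = distr (distr lborel borel (\<lambda>y. - \<mu> + y)) borel Li"
      by (subst distr_distr) (auto simp: o_def T_def[abs_def])
    then show ?thesis by (simp only: lborel_distr_plus c)
  qed
  have UT: "\<mu> + L (T y) = y" for y by (simp add: T_def L)
  have "distr M borel (\<lambda>\<omega>. Li (Y \<omega> - \<mu>)) = distr (distr M lborel Y) borel T"
    by (subst distr_distr) (auto simp: o_def T_def)
  also have "\<dots> = distr (density lborel (\<lambda>y. ennreal (f (\<mu> + L (T y))))) borel T" by (simp add: DY UT)
  also have "\<dots> = density (distr lborel borel T) (\<lambda>z. ennreal (f (\<mu> + L z)))"
    by (rule density_distr[symmetric]) measurable
  also have "\<dots> = density lborel (\<lambda>z. c * ennreal (f (\<mu> + L z)))"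
    unfolding Tl by (subst density_density_eq) auto
  also have "\<dots> = density lborel (\<lambda>z. (c * ennreal K) * q z)"
    by (rule density_cong) (use fq in \<open>auto simp: mult.assoc\<close>)
  finally have ZL: "distr M borel (\<lambda>\<omega>. Li (Y \<omega> - \<mu>)) = density lborel (\<lambda>z. (c * ennreal K) * q z)" .
  have HL: "distr (doubled_half S \<nu>) borel fst = density lborel q"
  proof (rule measure_eqI)
    fix A :: "(real^'n) set" assume "A \<in> sets (distr (doubled_half S \<nu>) borel fst)"
    then have [measurable]: "A \<in> sets borel" by simp
    have fstm: "fst \<in> measurable S borel"
      by (simp add: S_def measurable_cong_sets[OF sets_spherical_measure refl] borel_prod[symmetric])
    have hm: "{x. 0 \<le> \<nu> \<bullet> x} \<in> sets S"
      using half_space_sets(1)[OF generator, of \<nu>] by (simp add: S_def)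
    have "emeasure (distr (doubled_half S \<nu>) borel fst) A = (\<integral>\<^sup>+x. 2 * indicator {x. 0 \<le> \<nu> \<bullet> x} x * indicator A (fst x) \<partial>S)"
    proof -
      have "emeasure (distr (doubled_half S \<nu>) borel fst) A = (\<integral>\<^sup>+z. indicator A z \<partial>distr (doubled_half S \<nu>) borel fst)" by simp
      also have "\<dots> = (\<integral>\<^sup>+x. indicator A (fst x) \<partial>doubled_half S \<nu>)"
        using fstm by (intro nn_integral_distr) (auto simp: doubled_half_def)
      also have "\<dots> = (\<integral>\<^sup>+x. 2 * indicator {x. 0 \<le> \<nu> \<bullet> x} x * indicator A (fst x) \<partial>S)"
        unfolding doubled_half_def using hm fstm by (intro nn_integral_density) auto
      finally show ?thesis .
    qed
    also have "\<dots> = (\<integral>\<^sup>+z. \<integral>\<^sup>+r. ennreal (g (r\<^sup>2 + z \<bullet> z)) * (2 * indicator {x. 0 \<le> \<nu> \<bullet> x} (z, r) * indicator A z) \<partial>lborel \<partial>lborel)"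
    proof (subst nn_integral_generator)
      have "{x. 0 \<le> \<nu> \<bullet> x} \<in> sets (borel \<Otimes>\<^sub>M borel)" using hm unfolding S_def sets_spherical_measure borel_prod .
      then show "(\<lambda>x. (2 :: ennreal) * indicator {x. 0 \<le> \<nu> \<bullet> x} x * indicator A (fst x)) \<in> borel_measurable (borel \<Otimes>\<^sub>M borel)"
        by measurable
    qed simp
    also have "\<dots> = (\<integral>\<^sup>+z. q z * indicator A z \<partial>lborel)"
    proof (rule nn_integral_cong)
      fix z :: "real^'n"
      let ?B = "{..(1 / sqrt (1 - \<theta> \<bullet> \<theta>)) * (\<theta> \<bullet> z)}"
      have "(\<integral>\<^sup>+r. ennreal (g (r\<^sup>2 + z \<bullet> z)) * (2 * indicator {x. 0 \<le> \<nu> \<bullet> x} (z, r) * indicator A z) \<partial>lborel)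
        = (\<integral>\<^sup>+r. (2 * indicator A z) * (ennreal (g (r\<^sup>2 + z \<bullet> z)) * indicator ?B r) \<partial>lborel)"
        by (intro nn_integral_cong) (auto simp: \<nu>_def indicator_def inner_prod_def mult.commute)
      also have "\<dots> = (2 * indicator A z) * (\<integral>\<^sup>+r. ennreal (g (r\<^sup>2 + z \<bullet> z)) * indicator ?B r \<partial>lborel)"
        by (rule nn_integral_cmult) measurable
      finally show "(\<integral>\<^sup>+r. ennreal (g (r\<^sup>2 + z \<bullet> z)) * (2 * indicator {x. 0 \<le> \<nu> \<bullet> x} (z, r) * indicator A z) \<partial>lborel)
        = q z * indicator A z" by (simp add: q_def ac_simps)
    qed
    also have "\<dots> = emeasure (density lborel q) A" by (simp add: emeasure_density)
    finally show "emeasure (distr (doubled_half S \<nu>) borel fst) A = emeasure (density lborel q) A" .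
  qed simp
  have "emeasure (density lborel q) UNIV = emeasure (doubled_half S \<nu>) UNIV"
  proof -
    have "fst \<in> measurable (doubled_half S \<nu>) (borel :: (real^'n) measure)"
      by (simp add: doubled_half_def S_def measurable_cong_sets[OF sets_spherical_measure refl] borel_prod[symmetric])
    from emeasure_distr[OF this, of UNIV] show ?thesis unfolding HL by (simp add: doubled_half_def S_def)
  qed
  also have "\<dots> = (\<integral>\<^sup>+x. 1 \<partial>doubled_half S \<nu>)" by (simp add: doubled_half_def S_def)
  also have "\<dots> = (\<integral>\<^sup>+x. 1 \<partial>S)"
    unfolding S_def by (rule nn_integral_half_even[OF generator]) (use norm_nu in auto)
  also have "\<dots> = 1" using prob_space.emeasure_space_1[OF prob_space_spherical[OF generator]] by (simp add: S_def)
  finally have q1: "(\<integral>\<^sup>+z. q z \<partial>lborel) = 1" by (simp add: emeasure_density)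
  interpret Z: prob_space "distr M borel (\<lambda>\<omega>. Li (Y \<omega> - \<mu>))"
    by (rule prob_space.prob_space_distr[OF M]) measurable
  have "1 = emeasure (density lborel (\<lambda>z. (c * ennreal K) * q z)) UNIV"
    using Z.emeasure_space_1 unfolding ZL by simp
  also have "\<dots> = c * ennreal K" by (simp add: emeasure_density nn_integral_cmult q1)
  finally have "c * ennreal K = 1" ..
  then show ?thesis unfolding ZL HL by simp
qed

context
  assumes mom: "moments_exist M Y 4"
begin

lemma measurable_skew_elliptical[measurable]: "Y \<in> borel_measurable M"
  using SE by (simp add: skew_elliptical_def distributed_def)

lemma integrable_component: "integrable M (\<lambda>\<omega>. Y \<omega> $ i)"
  using mom[unfolded moments_exist_def, rule_format, of 1 "\<lambda>_. i"] by simp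

lemma integrable_component_product: "integrable M (\<lambda>\<omega>. Y \<omega> $ i * Y \<omega> $ j)"
  using mom[unfolded moments_exist_def, rule_format, of 2 "\<lambda>n. if n = 0 then i else j"]
  by (simp add: numeral_2_eq_2 lessThan_Suc mult.commute)

lemma integrable_linear: "integrable M (\<lambda>\<omega>. l \<bullet> (Y \<omega> - \<mu>))"
proof -
  interpret prob_space M by (rule M)
  have "integrable M (\<lambda>\<omega>. (\<Sum>i\<in>UNIV. l $ i * Y \<omega> $ i) - l \<bullet> \<mu>)"
    by (intro Bochner_Integration.integrable_diff Bochner_Integration.integrable_sum integrable_mult_right integrable_component) simp
  then show ?thesis unfolding inner_diff_right by (simp add: inner_vec_def)
qed

lemma integrable_linear_square: "integrable M (\<lambda>\<omega>. (l \<bullet> (Y \<omega> - \<mu>))\<^sup>2)"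
proof -
  interpret prob_space M by (rule M)
  have sq: "(l \<bullet> Y \<omega>)\<^sup>2 = (\<Sum>i\<in>UNIV. \<Sum>j\<in>UNIV. (l $ i * l $ j) * (Y \<omega> $ i * Y \<omega> $ j))" for \<omega>
    by (simp add: inner_vec_def power2_eq_square sum_product ac_simps)
  have 1: "integrable M (\<lambda>\<omega>. (l \<bullet> Y \<omega>)\<^sup>2)"
    unfolding sq by (intro Bochner_Integration.integrable_sum integrable_mult_right integrable_component_product)
  have "integrable M (\<lambda>\<omega>. (l \<bullet> Y \<omega>)\<^sup>2 - 2 * (l \<bullet> \<mu>) * (l \<bullet> (Y \<omega> - \<mu>)) - (l \<bullet> \<mu>)\<^sup>2)"
    by (intro Bochner_Integration.integrable_diff 1 integrable_mult_right integrable_linear) simp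
  then show ?thesis by (simp add: inner_diff_right power2_eq_square algebra_simps)
qed

lemma measurable_standardized[measurable]: "(\<lambda>\<omega>. Li (Y \<omega> - \<mu>)) \<in> borel_measurable M"
  by measurable

lemma measurable_fst_doubled_half[measurable]: "fst \<in> measurable (doubled_half S \<nu>) (borel :: (real^'n) measure)"
  by (simp add: doubled_half_def S_def measurable_cong_sets[OF sets_spherical_measure refl] borel_prod[symmetric])

lemma inner_standardized: "l \<bullet> (Y \<omega> - \<mu>) = adjoint L l \<bullet> Li (Y \<omega> - \<mu>)"
  using adjoint_works[OF L(1), of "Li (Y \<omega> - \<mu>)" l] by (simp add: L inner_commute)

text \<open>
  A squared linear form is even, so that the half-space may be dropped.
\<close>

lemma nn_second_moment:
  "(\<integral>\<^sup>+\<omega>. ennreal ((l \<bullet> (Y \<omega> - \<mu>))\<^sup>2) \<partial>M)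
    = ennreal (adjoint L l \<bullet> adjoint L l) * (\<integral>\<^sup>+x. ennreal ((snd x)\<^sup>2) \<partial>S)"
proof -
  define w where "w = adjoint L l"
  have "(\<integral>\<^sup>+\<omega>. ennreal ((l \<bullet> (Y \<omega> - \<mu>))\<^sup>2) \<partial>M) = (\<integral>\<^sup>+z. ennreal ((w \<bullet> z)\<^sup>2) \<partial>distr M borel (\<lambda>\<omega>. Li (Y \<omega> - \<mu>)))"
    unfolding inner_standardized w_def by (subst nn_integral_distr) auto
  also have "\<dots> = (\<integral>\<^sup>+x. ennreal ((w \<bullet> fst x)\<^sup>2) \<partial>doubled_half S \<nu>)"
    unfolding standardized_law by (subst nn_integral_distr) auto
  also have "\<dots> = (\<integral>\<^sup>+x. ennreal (((w, 0) \<bullet> x)\<^sup>2) \<partial>doubled_half S \<nu>)"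
    by (simp add: inner_prod_def)
  also have "\<dots> = (\<integral>\<^sup>+x. ennreal (((w, 0) \<bullet> x)\<^sup>2) \<partial>S)"
    unfolding S_def using measurable_inner_spherical[OF generator, of "(w, 0)"] norm_nu(1)
    by (intro nn_integral_half_even[OF generator]) auto
  also have "\<dots> = ennreal (w \<bullet> w) * (\<integral>\<^sup>+x. ennreal ((snd x)\<^sup>2) \<partial>S)"
    unfolding S_def by (subst spherical_second_moment_inner[OF generator]) (simp add: inner_prod_def)
  finally show ?thesis unfolding w_def .
qed

text \<open>
  Existence of moments of \<open>Y\<close> thus passes to the spherical law: take for \<open>l\<close> the linear form that
  reads off one coordinate of the standardized vector.
\<close>

lemma finite_second_moment: "(\<integral>\<^sup>+x. ennreal ((snd x)\<^sup>2) \<partial>S) < \<infinity>"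
proof -
  obtain e :: "real^'n" where e: "e \<in> Basis" using nonempty_Basis by blast
  define l where "l = adjoint Li e"
  have l: "adjoint L l = e"
  proof (rule vector_eq_ldot[THEN iffD1], intro allI)
    fix x show "x \<bullet> adjoint L l = x \<bullet> e"
      unfolding l_def using adjoint_works[OF L(1)] adjoint_works[OF L(2)] by (simp add: L)
  qed
  have "(\<integral>\<^sup>+\<omega>. ennreal ((l \<bullet> (Y \<omega> - \<mu>))\<^sup>2) \<partial>M) < \<infinity>"
    using integrable_linear_square[of l] by (simp add: integrable_iff_bounded)
  then show ?thesis unfolding nn_second_moment l using e by (simp add: inner_Basis)
qed

lemma second_moment:
  "(\<integral>\<omega>. (l \<bullet> (Y \<omega> - \<mu>))\<^sup>2 \<partial>M) = (adjoint L l \<bullet> adjoint L l) * (\<integral>x. (snd x)\<^sup>2 \<partial>S)"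
proof -
  have [measurable]: "snd \<in> borel_measurable S" unfolding S_def by (rule measurable_snd_spherical[OF generator])
  have "(\<integral>\<omega>. (l \<bullet> (Y \<omega> - \<mu>))\<^sup>2 \<partial>M) = enn2real (\<integral>\<^sup>+\<omega>. ennreal ((l \<bullet> (Y \<omega> - \<mu>))\<^sup>2) \<partial>M)"
    by (rule integral_eq_nn_integral) auto
  also have "\<dots> = (adjoint L l \<bullet> adjoint L l) * enn2real (\<integral>\<^sup>+x. ennreal ((snd x)\<^sup>2) \<partial>S)"
    unfolding nn_second_moment by (simp add: enn2real_mult)
  also have "enn2real (\<integral>\<^sup>+x. ennreal ((snd x)\<^sup>2) \<partial>S) = (\<integral>x. (snd x)\<^sup>2 \<partial>S)"
    by (rule integral_eq_nn_integral[symmetric]) auto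
  finally show ?thesis .
qed

lemma first_moment: "(\<integral>\<omega>. l \<bullet> (Y \<omega> - \<mu>) \<partial>M) = (l \<bullet> \<delta>) * (\<integral>x. \<bar>snd x\<bar> \<partial>S)"
proof -
  define w where "w = adjoint L l"
  have "(\<integral>\<omega>. l \<bullet> (Y \<omega> - \<mu>) \<partial>M) = (\<integral>z. w \<bullet> z \<partial>distr M borel (\<lambda>\<omega>. Li (Y \<omega> - \<mu>)))"
    unfolding inner_standardized w_def by (subst integral_distr) auto
  also have "\<dots> = (\<integral>x. w \<bullet> fst x \<partial>doubled_half S \<nu>)"
    unfolding standardized_law by (subst integral_distr) auto
  also have "\<dots> = (\<integral>x. (w, 0) \<bullet> x \<partial>doubled_half S \<nu>)"
    by (simp add: inner_prod_def)
  also have "\<dots> = ((w, 0) \<bullet> \<nu>) / norm \<nu> * (\<integral>x. \<bar>snd x\<bar> \<partial>S)"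
    unfolding S_def by (rule first_moment_half(2)[OF generator finite_second_moment[unfolded S_def] norm_nu(1)])
  also have "((w, 0) \<bullet> \<nu>) / norm \<nu> = w \<bullet> \<theta>"
    using inner_theta(2) unfolding norm_nu(2) by (simp add: \<nu>_def inner_prod_def)
  also have "w \<bullet> \<theta> = l \<bullet> \<delta>"
    unfolding w_def \<theta>_def using adjoint_works[OF L(1), of "Li \<delta>" l] by (simp add: L inner_commute)
  finally show ?thesis .
qed

lemma mean_vector_eq: "mean_vector M Y = \<mu> + (\<integral>x. \<bar>snd x\<bar> \<partial>S) *\<^sub>R \<delta>"
proof -
  interpret prob_space M by (rule M)
  have "(\<integral>\<omega>. Y \<omega> $ i \<partial>M) = \<mu> $ i + (\<integral>x. \<bar>snd x\<bar> \<partial>S) * \<delta> $ i" for i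
  proof -
    have "(\<integral>\<omega>. Y \<omega> $ i \<partial>M) = (\<integral>\<omega>. axis i 1 \<bullet> (Y \<omega> - \<mu>) + \<mu> $ i \<partial>M)"
      by (simp add: inner_axis')
    also have "\<dots> = (\<integral>\<omega>. axis i 1 \<bullet> (Y \<omega> - \<mu>) \<partial>M) + \<mu> $ i"
      using integrable_linear[of "axis i 1"] by (subst Bochner_Integration.integral_add) (auto simp: prob_space)
    finally show ?thesis unfolding first_moment by (simp add: inner_axis')
  qed
  then show ?thesis by (simp add: mean_vector_def vec_eq_iff)
qed

text \<open>
  The quadratic form of the covariance matrix is the variance of \<open>v \<bullet> Y\<close>, expanded about \<open>\<mu>\<close>.
\<close>

lemma covariance_form:
  "v \<bullet> (covariance_matrix M Y *v v)
    = (adjoint L v \<bullet> adjoint L v) * (\<integral>x. (snd x)\<^sup>2 \<partial>S) - ((\<integral>x. \<bar>snd x\<bar> \<partial>S) * (v \<bullet> \<delta>))\<^sup>2"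
proof -
  interpret prob_space M by (rule M)
  define m where "m = mean_vector M Y"
  define a where "a = (\<integral>x. \<bar>snd x\<bar> \<partial>S)"
  have m: "m = \<mu> + a *\<^sub>R \<delta>" unfolding m_def a_def by (rule mean_vector_eq)
  have ip: "integrable M (\<lambda>\<omega>. (Y \<omega> $ i - m $ i) * (Y \<omega> $ j - m $ j))" for i j
  proof -
    have "integrable M (\<lambda>\<omega>. Y \<omega> $ i * Y \<omega> $ j - m $ j * Y \<omega> $ i - m $ i * Y \<omega> $ j + m $ i * m $ j)"
      by (intro Bochner_Integration.integrable_add Bochner_Integration.integrable_diff integrable_mult_right
          integrable_component integrable_component_product) simp
    then show ?thesis by (simp add: algebra_simps)
  qed
  have "v \<bullet> (covariance_matrix M Y *v v)
    = (\<Sum>i\<in>UNIV. \<Sum>j\<in>UNIV. v $ i * ((\<integral>\<omega>. (Y \<omega> $ i - m $ i) * (Y \<omega> $ j - m $ j) \<partial>M) * v $ j))"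
    by (simp add: inner_vec_def matrix_vector_mult_def covariance_matrix_def m_def sum_distrib_left)
  also have "\<dots> = (\<integral>\<omega>. (\<Sum>i\<in>UNIV. \<Sum>j\<in>UNIV. v $ i * (((Y \<omega> $ i - m $ i) * (Y \<omega> $ j - m $ j)) * v $ j)) \<partial>M)"
    using ip by simp
  also have "\<dots> = (\<integral>\<omega>. (v \<bullet> (Y \<omega> - m))\<^sup>2 \<partial>M)"
    by (intro Bochner_Integration.integral_cong) (auto simp: inner_vec_def power2_eq_square sum_product ac_simps)
  also have "\<dots> = (\<integral>\<omega>. (v \<bullet> (Y \<omega> - \<mu>))\<^sup>2 - 2 * (a * (v \<bullet> \<delta>)) * (v \<bullet> (Y \<omega> - \<mu>)) + (a * (v \<bullet> \<delta>))\<^sup>2 \<partial>M)"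
    by (intro Bochner_Integration.integral_cong) (auto simp: m inner_simps power2_eq_square algebra_simps)
  also have "\<dots> = (\<integral>\<omega>. (v \<bullet> (Y \<omega> - \<mu>))\<^sup>2 \<partial>M) - 2 * (a * (v \<bullet> \<delta>)) * (\<integral>\<omega>. v \<bullet> (Y \<omega> - \<mu>) \<partial>M) + (a * (v \<bullet> \<delta>))\<^sup>2"
    using integrable_linear[of v] integrable_linear_square[of v] by (simp add: prob_space)
  finally show ?thesis unfolding second_moment first_moment a_def[symmetric]
    by (simp add: power2_eq_square algebra_simps)
qed

end

end

section \<open>Positivity of the density at the mean\<close>

context
  fixes g :: "real \<Rightarrow> real" and S :: "('a::euclidean_space \<times> real) measure" and a :: real
  assumes gen: "spherical_generator TYPE('a \<times> real) g"
  defines "S \<equiv> spherical_measure g" and "a \<equiv> (\<integral>x. \<bar>snd x\<bar> \<partial>S)"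
  assumes fin: "(\<integral>\<^sup>+x. ennreal ((snd x)\<^sup>2) \<partial>S) < \<infinity>"
begin

lemma integrable_abs_snd: "integrable S (\<lambda>x. \<bar>snd x\<bar>)"
proof -
  have "integrable S (\<lambda>x. (0, 1) \<bullet> x)"
    unfolding S_def by (rule integrable_inner_spherical(2)[OF gen fin[unfolded S_def]])
  then have "integrable S (\<lambda>x. snd x)" by (simp add: inner_prod_def)
  then show ?thesis by (rule integrable_abs)
qed

lemma abs_snd_pos: "0 < a"
proof -
  interpret prob_space S unfolding S_def by (rule prob_space_spherical[OF gen])
  have "a \<noteq> 0"
  proof
    assume "a = 0"
    then have "AE x in S. \<bar>snd x\<bar> = 0"
      unfolding a_def using integral_nonneg_eq_0_iff_AE[OF integrable_abs_snd] by simp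
    moreover have "AE x in S. (0, 1) \<bullet> x \<noteq> 0"
      unfolding S_def by (rule AE_spherical_inner_neq_0[OF gen]) (simp add: zero_prod_def)
    ultimately have "AE x in S. False" by eventually_elim (simp add: inner_prod_def)
    then show False by simp
  qed
  moreover have "0 \<le> a" unfolding a_def by simp
  ultimately show ?thesis by simp
qed

text \<open>
  Suppose that the integral vanishes. By continuity \<open>g\<close> is zero beyond \<open>a\<^sup>2 * d\<^sup>2\<close>, the radii
  \<open>r < 0\<close> being within reach as \<open>s \<ge> 0\<close>. Then \<open>\<bar>snd x\<bar> \<le> norm x \<le> a * d\<close> almost surely, while the
  mean of \<open>\<bar>snd x\<bar>\<close> is \<open>a > 0\<close>.
\<close>

lemma generator_section_pos:
  assumes cont: "\<And>t. 0 < t \<Longrightarrow> isCont g t" and d: "0 \<le> d" "d < 1" and s: "0 \<le> s"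
    and int: "integrable lborel (\<lambda>r. g (r\<^sup>2 + a\<^sup>2 * d\<^sup>2))"
  shows "0 < (LINT r:{..s}|lborel. g (r\<^sup>2 + a\<^sup>2 * d\<^sup>2))"
proof (rule ccontr)
  define q where "q = a\<^sup>2 * d\<^sup>2"
  have q: "0 \<le> q" "q = (a * d)\<^sup>2" by (auto simp: q_def power_mult_distrib)
  have gn: "0 \<le> g t" if "0 \<le> t" for t using gen that by (simp add: spherical_generator_def)
  assume "\<not> 0 < (LINT r:{..s}|lborel. g (r\<^sup>2 + a\<^sup>2 * d\<^sup>2))"
  moreover have "0 \<le> (LINT r:{..s}|lborel. g (r\<^sup>2 + q))"
    unfolding set_lebesgue_integral_def using gn q by (intro Bochner_Integration.integral_nonneg) auto
  ultimately have "(\<integral>r. indicator {..s} r * g (r\<^sup>2 + q) \<partial>lborel) = 0"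
    by (simp add: q_def set_lebesgue_integral_def)
  moreover have "integrable lborel (\<lambda>r. indicator {..s} r * g (r\<^sup>2 + q))"
    using integrable_mult_indicator[OF _ int, of "{..s}"] by (simp add: q_def)
  ultimately have ae: "AE r in lborel. indicator {..s} r * g (r\<^sup>2 + q) = 0"
    using gn q by (subst (asm) integral_nonneg_eq_0_iff_AE) auto
  \<comment> \<open>The open set of negative radii where \<open>g\<close> does not vanish is null, hence empty.\<close>
  define U where "U = {..<0::real} \<inter> (\<lambda>r. g (r\<^sup>2 + q)) -` (- {0})"
  have "continuous_on {..<0::real} (\<lambda>r. g (r\<^sup>2 + q))"
  proof (intro continuous_at_imp_continuous_on ballI)
    fix r :: real assume "r \<in> {..<0}"
    then have "isCont g (r\<^sup>2 + q)" using q(1) by (intro cont add_pos_nonneg) auto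
    then show "isCont (\<lambda>r. g (r\<^sup>2 + q)) r"
      using isCont_o2[of r "\<lambda>r. r\<^sup>2 + q" g] by (simp add: continuous_intros)
  qed
  then have U: "open U" unfolding U_def by (rule continuous_open_preimage) auto
  have "U = {}"
  proof (rule ccontr)
    assume "U \<noteq> {}"
    then have "\<not> negligible U" using U by (rule open_not_negligible[rotated])
    moreover have "negligible U"
    proof -
      have "AE r in lborel. r \<notin> U" using ae by eventually_elim (use s in \<open>auto simp: U_def indicator_def\<close>)
      then have "U \<in> null_sets lborel" using U by (subst (asm) AE_iff_null_sets[symmetric]) auto
      then show ?thesis using negligible_iff_null_sets null_sets_completionI by blast
    qed
    ultimately show False by simp
  qed
  have g0: "g t = 0" if "q < t" for t
  proof (rule ccontr)
    assume "g t \<noteq> 0"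
    then have "- sqrt (t - q) \<in> U" using that by (simp add: U_def)
    then show False using \<open>U = {}\<close> by simp
  qed
  have "AE x in S. norm x \<le> a * d"
  proof -
    have le: "norm x \<le> a * d" if pos: "0 < ennreal (g (x \<bullet> x))" for x :: "'a \<times> real"
    proof -
      have "\<not> q < x \<bullet> x" using g0[of "x \<bullet> x"] pos by auto
      then have "(norm x)\<^sup>2 \<le> (a * d)\<^sup>2" using q(2) by (simp add: power2_norm_eq_inner)
      then show ?thesis using abs_snd_pos d by (auto intro: power2_le_imp_le)
    qed
    show ?thesis unfolding S_def spherical_measure_def
    proof (subst AE_density)
      show "(\<lambda>x::'a \<times> real. ennreal (g (x \<bullet> x))) \<in> borel_measurable lborel"
        using measurable_spherical_generator[OF gen] by simp
      show "AE x :: 'a \<times> real in lborel. 0 < ennreal (g (x \<bullet> x)) \<longrightarrow> norm x \<le> a * d"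
        using le by (intro AE_I2) blast
    qed
  qed
  then have ae: "AE x in S. \<bar>snd x\<bar> \<le> a * d"
  proof eventually_elim
    case (elim x)
    then show ?case using norm_snd_le[of "snd x" "fst x"] by simp
  qed
  interpret prob_space S unfolding S_def by (rule prob_space_spherical[OF gen])
  have "a \<le> a * d"
    unfolding a_def[THEN meta_eq_to_obj_eq] using ae by (intro integral_le_const integrable_abs_snd) (simp add: a_def)
  then show False using abs_snd_pos d by simp
qed

end

text \<open>
  The points \<open>z\<close> with \<open>z \<bullet> z \<le> q\<close> form a bounded set, and the complement of a bounded set is not null.
\<close>

lemma exists_integrable_section:
  fixes g :: "real \<Rightarrow> real"
  assumes ae: "AE z in lborel. integrable lborel (\<lambda>r::real. g (r\<^sup>2 + (z :: 'a::euclidean_space) \<bullet> z))"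
  shows "\<exists>q1>q. integrable lborel (\<lambda>r. g (r\<^sup>2 + q1))"
proof (rule ccontr)
  assume "\<not> (\<exists>q1>q. integrable lborel (\<lambda>r. g (r\<^sup>2 + q1)))"
  then have neg: "\<And>q1. q < q1 \<Longrightarrow> \<not> integrable lborel (\<lambda>r. g (r\<^sup>2 + q1))" by blast
  define \<rho> where "\<rho> = sqrt \<bar>q\<bar>"
  have "AE z in lborel. (z :: 'a) \<in> cball 0 \<rho>"
    using ae
  proof eventually_elim
    case (elim z)
    then have "z \<bullet> z \<le> q" using neg[of "z \<bullet> z"] by (auto simp: not_less[symmetric])
    then show ?case by (auto simp: \<rho>_def norm_eq_sqrt_inner intro!: real_sqrt_le_mono)
  qed
  then have "emeasure lborel (UNIV :: 'a set) = emeasure lborel (cball (0 :: 'a) \<rho>)"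
    by (intro emeasure_eq_AE) auto
  then show False using emeasure_lborel_cball_finite[of "0 :: 'a" \<rho>] by simp
qed

section \<open>The gradient of the log-density\<close>

lemma gradient_eq:
  assumes "(F has_derivative (\<lambda>h. h \<bullet> D)) (at x)" shows "gradient F x = D"
  unfolding gradient_def
proof (rule the_equality)
  show "GDERIV F x :> D" using assms by (simp add: gderiv_def)
  fix D' assume "GDERIV F x :> D'"
  then have "(\<lambda>h. h \<bullet> D') = (\<lambda>h. h \<bullet> D)" using has_derivative_unique assms by (auto simp: gderiv_def)
  then show "D' = D" using vector_eq_ldot[of D' D] by metis
qed

theorem proposition5:
  fixes M :: "'w measure" and N :: "'u measure" and N0 :: "'v measure"
    and Y :: "'w \<Rightarrow> real^'n" and R :: "'u \<Rightarrow> real" and R0 :: "'v \<Rightarrow> real"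
    and \<mu> \<delta> :: "real^'n" and \<Omega> :: "real^'n^'n"
    and g g' :: "real \<Rightarrow> real" and a b d :: real
  assumes "prob_space M" and "prob_space N" and "prob_space N0"
    and "skew_elliptical M Y \<mu> \<Omega> \<delta> g"
    and "moments_exist M Y 4"
    and "AE \<omega> in N. 0 \<le> R \<omega>"
    and "distributed N lborel R (\<lambda>r. ennreal (radial_density CARD('n) g r))"
    and "chi_distributed N0 R0 (CARD('n) + 1)"
    and "a = (\<integral>\<omega>. R \<omega> \<partial>N) / (\<integral>\<omega>. R0 \<omega> \<partial>N0) * sqrt (2 / pi)"
    and "b = (\<integral>\<omega>. (R \<omega>)\<^sup>2 \<partial>N) / (\<integral>\<omega>. (R0 \<omega>)\<^sup>2 \<partial>N0)"
    and "d = delta_star \<Omega> \<delta>"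
    and "\<And>t. 0 < t \<Longrightarrow> (g has_real_derivative g' t) (at t)"
    and "set_integrable lborel {..skew_eta d (a * d)} (\<lambda>r. g' (r\<^sup>2 + a\<^sup>2 * d\<^sup>2))"
  shows "(\<lambda>y. ln (se_density \<mu> \<Omega> \<delta> g y)) differentiable (at (mean_vector M Y)) \<and>
    delta_method_variance M Y (\<lambda>y. ln (se_density \<mu> \<Omega> \<delta> g y))
      = (b - a\<^sup>2 * d\<^sup>2) * (h_star g g' a d)\<^sup>2"
proof -
  note SE = assms(4) and g' = assms(12)
  have gen: "spherical_generator TYPE((real^'n) \<times> real) g" and pd: "positive_definite \<Omega>"
    using SE by (simp_all add: skew_elliptical_def)
  let ?W = "matrix_inv \<Omega>"
  obtain L Li :: "real^'n \<Rightarrow> real^'n" where L: "linear L" "linear Li" "\<And>x. L (Li x) = x" "\<And>x. Li (L x) = x"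
    and iso: "\<And>x y. L x \<bullet> (?W *v L y) = x \<bullet> y"
    using form_isometry[OF positive_definite_inverse_form(2-4)[OF pd]] by metis
  note st = assms(1) SE L iso
  define S :: "((real^'n) \<times> real) measure" where "S = spherical_measure g"
  define \<theta> where "\<theta> = Li \<delta>"
  have dim: "DIM(real^'n) = CARD('n)" by simp
  have a: "a = (\<integral>x. \<bar>snd x\<bar> \<partial>S)" and b: "b = (\<integral>x. (snd x)\<^sup>2 \<partial>S)"
    using radial_parameters[OF gen, unfolded dim, OF assms(7,8)] assms(9,10) by (simp_all add: S_def)
  note fin = finite_second_moment[OF st assms(5)]
  have a0: "0 < a" unfolding a S_def by (rule abs_snd_pos[OF gen fin])
  have dd: "\<theta> \<bullet> \<theta> = \<delta> \<bullet> (?W *v \<delta>)" "\<theta> \<bullet> \<theta> < 1" unfolding \<theta>_def by (rule inner_theta[OF st])+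
  then have d: "0 \<le> d" "d < 1" "d\<^sup>2 = \<theta> \<bullet> \<theta>" "d\<^sup>2 = \<delta> \<bullet> (?W *v \<delta>)" "d\<^sup>2 < 1"
    unfolding assms(11) delta_star_def dd(1)[symmetric] by auto
  define m where "m = mean_vector M Y"
  have m: "m - \<mu> = a *\<^sub>R \<delta>" unfolding m_def mean_vector_eq[OF st assms(5)] a S_def by simp
  define \<alpha> where "\<alpha> = skew_alpha \<Omega> \<delta>"
  have \<alpha>: "\<alpha> \<bullet> h = (\<delta> \<bullet> (?W *v h)) / sqrt (1 - d\<^sup>2)" for h
    by (simp add: \<alpha>_def skew_alpha_def dot_lmul_matrix d(4))
  define s where "s = skew_eta d (a * d)"
  define q where "q = a\<^sup>2 * d\<^sup>2"
  have s: "0 \<le> s" unfolding s_def skew_eta_def using a0 d by simp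
  have q: "0 \<le> q" unfolding q_def by simp
  define J where "J = (LINT r:{..s}|lborel. g' (r\<^sup>2 + q))"
  define F where "F t u = (LINT r:{..t}|lborel. g (r\<^sup>2 + u))" for t u
  have int': "set_integrable lborel {..s} (\<lambda>r. g' (r\<^sup>2 + q))" using assms(13) by (simp add: s_def q_def)
  obtain q1 where q1: "q < q1" "integrable lborel (\<lambda>r. g (r\<^sup>2 + q1))"
    using exists_integrable_section[OF AE_integrable_section[OF st], of q] by blast
  have int1: "set_integrable lborel {0<..} (\<lambda>r. g (r\<^sup>2 + q1))"
    using integrable_mult_indicator[OF _ q1(2), of "{0<..}"] by (simp add: set_integrable_def)
  have int0: "integrable lborel (\<lambda>r. g (r\<^sup>2 + q))"
    by (rule fold_even(1)[OF _ s integrable_translate0[OF g' q s int' q1(1) int1]]) simp_all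
  have cont: "isCont g t" if "0 < t" for t using g'[OF that] DERIV_isCont by blast
  have F0: "0 < F s q"
    unfolding F_def q_def a S_def
    by (rule generator_section_pos[OF gen fin cont d(1,2) s]) (use int0 in \<open>simp_all add: q_def a S_def\<close>)
  define Q where "Q y = (y - \<mu>) \<bullet> (?W *v (y - \<mu>))" for y
  have at_m: "\<alpha> \<bullet> (m - \<mu>) = s" "Q m = q"
    unfolding Q_def m \<alpha> s_def q_def skew_eta_def
    by (simp_all add: matrix_vector_mult_scaleR d(4)[symmetric] power2_eq_square)
  have Q_der: "(Q has_derivative (\<lambda>h. 2 * a * (\<delta> \<bullet> (?W *v h)))) (at m)"
  proof -
    have 1: "((\<lambda>y. y - \<mu>) has_derivative (\<lambda>h. h)) (at m)" by (auto intro!: derivative_eq_intros)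
    have 2: "((\<lambda>y. ?W *v (y - \<mu>)) has_derivative (\<lambda>h. ?W *v h)) (at m)"
      by (rule bounded_linear.has_derivative[OF matrix_vector_mul_bounded_linear 1])
    have "(m - \<mu>) \<bullet> (?W *v h) + h \<bullet> (?W *v (m - \<mu>)) = 2 * a * (\<delta> \<bullet> (?W *v h))" for h
      using positive_definite_inverse_form(3)[OF pd, of h \<delta>] by (simp add: m matrix_vector_mult_scaleR)
    then show ?thesis using has_derivative_inner[OF 1 2] unfolding Q_def by simp
  qed
  have \<alpha>_der: "((\<lambda>y. \<alpha> \<bullet> (y - \<mu>)) has_derivative (\<lambda>h. \<alpha> \<bullet> h)) (at m)"
    by (auto intro!: derivative_eq_intros)
  \<comment> \<open>If \<open>d = 0\<close>, then \<open>q = 0\<close> and the integral is only differentiable from the right in the value of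
    the quadratic form. This suffices, as the form is nonnegative and stationary at the mean.\<close>
  have F_der: "((\<lambda>y. F (\<alpha> \<bullet> (y - \<mu>)) (Q y)) has_derivative
      (\<lambda>h. (\<alpha> \<bullet> h) * g (s\<^sup>2 + q) + 2 * a * (\<delta> \<bullet> (?W *v h)) * J)) (at m)"
  proof (cases "d = 0")
    case False
    then have q': "0 < q" using a0 by (simp add: q_def)
    have "((\<lambda>(t, u). F t u) has_derivative (\<lambda>(dt, du). dt * g (s\<^sup>2 + q) + du * J)) (at (\<alpha> \<bullet> (m - \<mu>), Q m))"
      unfolding at_m F_def J_def by (rule truncated_integral_has_derivative[OF g' q' s int' q1(1) int1])
    from has_derivative_compose[OF has_derivative_Pair[OF \<alpha>_der Q_der] this] show ?thesis by simp
  next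
    case True
    then have "\<theta> = 0" using d(3) by simp
    then have "\<delta> = 0" using L(3)[of \<delta>] linear_0[OF L(1)] by (simp add: \<theta>_def)
    then have \<alpha>0: "\<alpha> \<bullet> h = 0" for h by (simp add: \<alpha>)
    have q0: "q = 0" "s = 0" using True by (simp_all add: q_def s_def skew_eta_def)
    have Q0: "0 \<le> Q y" for y
      using positive_definite_inverse_form(4)[OF pd, of "y - \<mu>"] by (cases "y - \<mu> = 0") (auto simp: Q_def)
    have "(F s has_real_derivative J) (at q within {q..})"
      unfolding F_def[abs_def] J_def by (rule truncated_integral_derivative[OF g' q s int' q1(1) int1]) simp_all
    then have "(F 0 has_derivative (\<lambda>h. J * h)) (at (Q m) within {0..})"
      unfolding at_m has_field_derivative_def q0 by simp
    then have "(F 0 has_derivative (\<lambda>h. J * h)) (at (Q m) within range Q)"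
      by (rule has_derivative_subset) (use Q0 in auto)
    from has_derivative_in_compose[OF Q_der this] show ?thesis by (simp add: \<alpha>0 mult.commute)
  qed
  define c where "c = 2 * det \<Omega> powr (- 1 / 2)"
  have c: "0 < c" unfolding c_def using positive_definite_inverse_form(1)[OF pd] by simp
  define G where "G y = ln (se_density \<mu> \<Omega> \<delta> g y)" for y
  have G: "G y = ln (c * F (\<alpha> \<bullet> (y - \<mu>)) (Q y))" for y
    by (simp add: G_def se_density_def c_def F_def \<alpha>_def Q_def)
  \<comment> \<open>Working with \<open>\<kappa> = h\<^sub>* / d\<close> instead of \<open>h\<^sub>*\<close> avoids a case distinction on \<open>d = 0\<close>.\<close>
  define \<kappa> where "\<kappa> = (2 * a * J + g (s\<^sup>2 + q) / sqrt (1 - d\<^sup>2)) / F s q"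
  define D where "D = \<kappa> *\<^sub>R (?W *v \<delta>)"
  have G_der: "(G has_derivative (\<lambda>h. h \<bullet> D)) (at m)"
  proof -
    have "((\<lambda>y. ln (c * F (\<alpha> \<bullet> (y - \<mu>)) (Q y))) has_derivative
      (\<lambda>h. (c * ((\<alpha> \<bullet> h) * g (s\<^sup>2 + q) + 2 * a * (\<delta> \<bullet> (?W *v h)) * J)) * inverse (c * F s q))) (at m)"
      using has_derivative_ln[OF _ has_derivative_mult_right[OF F_der, of c]] c F0 by (simp add: at_m)
    moreover have "(c * ((\<alpha> \<bullet> h) * g (s\<^sup>2 + q) + 2 * a * (\<delta> \<bullet> (?W *v h)) * J)) * inverse (c * F s q) = h \<bullet> D" for h
    proof -
      have "h \<bullet> D = \<kappa> * (\<delta> \<bullet> (?W *v h))"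
        using positive_definite_inverse_form(3)[OF pd, of h \<delta>] by (simp add: D_def)
      then show ?thesis using c F0 d(5) by (simp add: \<kappa>_def \<alpha> field_simps)
    qed
    ultimately show ?thesis by (simp add: G[abs_def])
  qed
  have "adjoint L D = \<kappa> *\<^sub>R \<theta>"
  proof (rule vector_eq_ldot[THEN iffD1], intro allI)
    fix x
    have "x \<bullet> adjoint L D = \<kappa> * (L x \<bullet> (?W *v L \<theta>))"
      using adjoint_works[OF L(1), of x D] by (simp add: D_def \<theta>_def L)
    then show "x \<bullet> adjoint L D = x \<bullet> (\<kappa> *\<^sub>R \<theta>)" by (simp add: iso)
  qed
  moreover have "D \<bullet> \<delta> = \<kappa> * d\<^sup>2" by (simp add: D_def d(4) inner_commute)
  ultimately have "D \<bullet> (covariance_matrix M Y *v D) = \<kappa>\<^sup>2 * d\<^sup>2 * b - (a * (\<kappa> * d\<^sup>2))\<^sup>2"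
    unfolding covariance_form[OF st assms(5)] a b S_def by (simp add: d(3)[unfolded power2_eq_square, symmetric] power2_eq_square)
  also have "\<dots> = (b - a\<^sup>2 * d\<^sup>2) * (\<kappa> * d)\<^sup>2"
    by (simp add: power2_eq_square algebra_simps)
  also have "\<kappa> * d = h_star g g' a d"
    unfolding h_star_def \<kappa>_def F_def J_def s_def q_def by (simp add: skew_eta_def algebra_simps)
  finally have "delta_method_variance M Y G = (b - a\<^sup>2 * d\<^sup>2) * (h_star g g' a d)\<^sup>2"
    unfolding delta_method_variance_def m_def[symmetric] gradient_eq[OF G_der] .
  moreover have "G differentiable (at m)" using G_der by (rule differentiableI)
  ultimately show ?thesis unfolding G_def[abs_def] m_def by simp
qed

end
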